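(* For $\ell\in\{3,5,7,11,23\}$ let $$H_\ell=H_\ell(\tau)=\left(\frac{\eta(2\tau)\eta(2\ell\tau)}{\eta(\tau)\eta(\ell\tau)}\right)^{\frac{24}{\ell+1}},$$ and let $q=e^{\pi i\tau}$. Then \begin{align*} \widehat{D}_3(q^2)&=2H_3,\\ \widehat{D}_5^2(q^2)&=4H_5^2(1+4H_5),\\ \widehat{D}_7(q^2)&=2H_7(1+3H_7),\\ \widehat{D}_{11}(q^2)&=2H_{11}(1+4H_{11}+5H_{11}^2),\\ \widehat{D}_{23}(q^2)&=2H_{23}(1+5H_{23}+13H_{23}^2+20H_{23}^3+20H_{23}^4+11H_{23}^5). \end{align*}
   Context: $\eta(\tau)=e^{\pi i\tau/12}\prod_{k\ge1}(1-e^{2\pi ik\tau})$ is the Dedekind eta function ($\operatorname{Im}\tau>0$). For $0<|q|<1$ let $\vartheta_4(q)=\sum_{k\in\mathbb Z}(-1)^kq^{k^2}$ and for a positive integer $\ell$ define $$\widehat{D}_\ell(q)=\frac{1}{\vartheta_4^3(q)\vartheta_4^3(q^\ell)}\det\begin{pmatrix}\vartheta_4(q)&\vartheta_4(q^\ell)\\ q\frac{d\vartheta_4(q)}{dq}& q\frac{d\vartheta_4(q^\ell)}{dq}\end{pmatrix}.$$ *)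

theory Defs
  imports "HOL-Analysis.Analysis"
begin

definition dedekind_eta :: "complex \<Rightarrow> complex" where
  "dedekind_eta \<tau> =
     exp (of_real pi * \<i> * \<tau> / 12) *
     (\<Prod>k. 1 - exp (2 * of_real pi * \<i> * of_nat (Suc k) * \<tau>))"

definition theta4 :: "complex \<Rightarrow> complex" where
  "theta4 q = (\<Sum>\<^sub>\<infinity>k::int. (-1) powi k * q powi (k\<^sup>2))"

text \<open>
  In the second row, \<open>q d/dq\<close> is applied to the composite \<open>q \<mapsto> theta4 (q ^ l)\<close>,
  not to \<open>theta4\<close> and then evaluated at \<open>q ^ l\<close>.
\<close>

definition D_hat :: "nat \<Rightarrow> complex \<Rightarrow> complex" where
  "D_hat l q =
     1 / (theta4 q ^ 3 * theta4 (q ^ l) ^ 3) *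
     det (vector [vector [theta4 q, theta4 (q ^ l)],
                  vector [q * deriv theta4 q, q * deriv (\<lambda>z. theta4 (z ^ l)) q]]
          :: complex ^ 2 ^ 2)"

text \<open>
  The exponent \<open>24 / (l + 1)\<close> is an integer for \<open>l\<close> in \<open>{3, 5, 7, 11, 23}\<close>, the only values
  of \<open>l\<close> of interest; the division on \<open>nat\<close> is then exact and no branch of a complex power
  has to be chosen.
\<close>

definition H_eta :: "nat \<Rightarrow> complex \<Rightarrow> complex" where
  "H_eta l \<tau> =
     (dedekind_eta (2 * \<tau>) * dedekind_eta (2 * of_nat l * \<tau>) /
      (dedekind_eta \<tau> * dedekind_eta (of_nat l * \<tau>))) ^ (24 div (l + 1))"

end

(*
Put x = q^2 = - exp (pi i z) with z = 2 tau + 1. Then theta4 x = th3 z, theta4 (x^l) = th3 (l z), and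
H = - (w z * w (l z))^(24/(l+1)) for the reciprocal w of Weber's function f, while D is the derivative
of phi = th3(z)^2 / th3(l z)^2 divided by - 2 pi i th3(z)^4. Poisson summation and
the Jacobi triple product give the behaviour of th3 and w under the theta group, generated by
z -> z + 2 and z -> - 1/z; an explicit formula for the 24th root of unity by which w is multiplied shows
that D^e (with e = 2 for l = 5 and e = 1 otherwise) and H are invariant under the matrices of the
theta group with lower left entry divisible by l, and both are compatible with z -> - 1/(l z). Let
P be the claimed polynomial, n its degree and F = D^e - P(H). At the cusp 1, D^e and P(H) grow at most
like H^n, and F = O(x^(n+1)) at infinity by comparing Taylor coefficients. Hence F^2 / H^(2n+1)
tends to 0 at every cusp, so its modulus attains a maximum, and it vanishes by the maximum principle.
*)

theory Submission
  imports Defs "HOL-Complex_Analysis.Complex_Analysis" "HOL-Probability.Probability" "HOL-Number_Theory.Cong"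
begin

section \<open>Infinite products\<close>

text \<open>Passing to \<open>2 * \<tau> + 1\<close> trades the fourth theta function for the third,
  whose group has two generators and two cusps, infinity and 1. In place of eta stands
  \<open>weber\<close>, of weight 0, without zeros, whose multiplier is a mere root of unity, so no
  Dedekind sums occur. The exponents in the five cases are forced. With r = 24/(l+1), there is a
  quantity b such that near the cusp 1 the modulus of D grows at most like b and that of H like the
  (r/6)th power of b; so the degree to expect is n = 6e/r, which for l = 5 is an integer only if e
  is even. Independently, if l is 1 modulo 4, some matrices of the level subgroup change the sign of
  D. Both facts account for the square at l = 5. No valence formula is used: the maximum principle
  on a compact piece of the half-plane does its work, and compatibility with the Fricke involution
  spares separate expansions at further cusps. As n + 1 \<le> l in all cases, factors taken at x^l
  enter the coefficient comparison through their constant terms only.\<close>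

definition qE :: "complex \<Rightarrow> complex" where "qE x = (\<Prod>k. 1 - x ^ Suc k)"
definition qU :: "complex \<Rightarrow> complex" where "qU x = (\<Prod>k. 1 + x ^ Suc k)"
definition qO :: "complex \<Rightarrow> complex" where "qO x = (\<Prod>k. 1 - x ^ (2 * k + 1))"

lemma summable_norm_power:
  fixes x :: complex
  assumes "norm x < 1" "strict_mono f"
  shows "summable (\<lambda>k. norm (x ^ f k))"
proof (rule summable_comparison_test)
  have "norm x ^ f k \<le> norm x ^ k" for k
    using assms strict_mono_imp_increasing[OF assms(2)] by (intro power_decreasing) auto
  then show "\<exists>N. \<forall>k\<ge>N. norm (norm (x ^ f k)) \<le> norm x ^ k"
    by (simp add: norm_power)
  show "summable (\<lambda>k. norm x ^ k)"
    using assms by (simp add: summable_geometric)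
qed

lemma power_Suc_neq_unit:
  fixes x c :: complex
  assumes "norm x < 1" "n > 0" "norm c = 1"
  shows "x ^ n \<noteq> c"
proof
  assume "x ^ n = c"
  then have "norm x ^ n = 1" using assms by (metis norm_power)
  moreover have "norm x ^ n < 1" using assms by (simp add: power_less_one_iff)
  ultimately show False by simp
qed

text \<open>Absolute convergence comes from a geometric majorant, and as no factor vanishes, neither
  does the product. A unimodular \<open>c\<close> covers both signs.\<close>

lemma conv_prod_one_plus_power:
  fixes x c :: complex
  assumes "norm x < 1" "strict_mono f" "\<And>k. f k > 0" "norm c = 1"
  shows "convergent_prod (\<lambda>k. 1 + c * x ^ f k)"
    and "(\<Prod>k. 1 + c * x ^ f k) \<noteq> 0"
proof -
  have ne: "c * x ^ f k \<noteq> -1" for k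
  proof
    assume "c * x ^ f k = -1"
    then have "x ^ f k = -1 / c" using assms(4)
      by (metis nonzero_mult_div_cancel_left norm_zero zero_neq_one)
    then show False using power_Suc_neq_unit[OF assms(1,3), of "-1/c"] assms(4)
      by (simp add: norm_divide)
  qed
  have "summable (\<lambda>k. norm (c * x ^ f k))"
    using summable_norm_power[OF assms(1,2)] assms(4) by (simp add: norm_mult)
  from summable_imp_convergent_prod_complex[OF this ne]
  show c: "convergent_prod (\<lambda>k. 1 + c * x ^ f k)" .
  have "1 + c * x ^ f k \<noteq> 0" for k
    using ne[of k] by (metis add_eq_0_iff)
  then show "(\<Prod>k. 1 + c * x ^ f k) \<noteq> 0"
    using c by (intro prodinf_nonzero)
qed

lemma strict_mono_Suc: "strict_mono Suc" by (simp add: strict_mono_def)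
lemma strict_mono_odd: "strict_mono (\<lambda>k::nat. 2 * k + 1)" by (simp add: strict_mono_def)

context
  fixes x :: complex assumes x: "norm x < 1"
begin

lemma conv_qE: "convergent_prod (\<lambda>k. 1 - x ^ Suc k)" and qE_nz: "qE x \<noteq> 0"
  using conv_prod_one_plus_power[OF x strict_mono_Suc, of "-1"]
  by (auto simp: qE_def)

lemma conv_qU: "convergent_prod (\<lambda>k. 1 + x ^ Suc k)" and qU_nz: "qU x \<noteq> 0"
  using conv_prod_one_plus_power[OF x strict_mono_Suc, of "1"]
  by (auto simp: qU_def)

lemma conv_qO: "convergent_prod (\<lambda>k. 1 - x ^ (2 * k + 1))"
  using conv_prod_one_plus_power(1)[OF x strict_mono_odd, of "-1"] by simp

lemma norm_square_less_1: "norm (x ^ 2) < 1"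
  using x by (simp add: norm_power power_less_one_iff)

lemma norm_uminus_less_1: "norm (- x) < 1"
  using x by simp

end

lemma LIMSEQ_prod: 
  fixes f :: "nat \<Rightarrow> complex"
  assumes "convergent_prod f"
  shows "(\<lambda>n. \<Prod>k<n. f k) \<longlonglongrightarrow> prodinf f"
proof -
  have "(\<lambda>n. \<Prod>k\<le>n. f k) \<longlonglongrightarrow> prodinf f" by (rule convergent_prod_LIMSEQ[OF assms])
  then have "(\<lambda>n. \<Prod>k<Suc n. f k) \<longlonglongrightarrow> prodinf f" by (simp add: lessThan_Suc_atMost)
  then show ?thesis by (subst (asm) filterlim_sequentially_Suc)
qed

lemma qE_LIMSEQ: "norm x < 1 \<Longrightarrow> (\<lambda>n. \<Prod>k<n. 1 - x ^ Suc k) \<longlonglongrightarrow> qE x"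
  unfolding qE_def by (intro LIMSEQ_prod conv_qE)
lemma qU_LIMSEQ: "norm x < 1 \<Longrightarrow> (\<lambda>n. \<Prod>k<n. 1 + x ^ Suc k) \<longlonglongrightarrow> qU x"
  unfolding qU_def by (intro LIMSEQ_prod conv_qU)
lemma qO_LIMSEQ: "norm x < 1 \<Longrightarrow> (\<lambda>n. \<Prod>k<n. 1 - x ^ (2 * k + 1)) \<longlonglongrightarrow> qO x"
  unfolding qO_def by (intro LIMSEQ_prod conv_qO)

lemma qE_mult_qU: "norm x < 1 \<Longrightarrow> qE x * qU x = qE (x ^ 2)"
proof -
  assume x: "norm x < 1"
  have "(\<lambda>n. (\<Prod>k<n. 1 - x ^ Suc k) * (\<Prod>k<n. 1 + x ^ Suc k)) \<longlonglongrightarrow> qE x * qU x"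
    by (intro tendsto_mult qE_LIMSEQ qU_LIMSEQ x)
  moreover have "(\<Prod>k<n. 1 - x ^ Suc k) * (\<Prod>k<n. 1 + x ^ Suc k) = (\<Prod>k<n. 1 - (x ^ 2) ^ Suc k)" for n
    unfolding prod.distrib[symmetric]
    by (intro prod.cong refl) (simp add: power_mult[symmetric] algebra_simps power2_eq_square power_add[symmetric] mult_2)
  ultimately show ?thesis
    using qE_LIMSEQ[OF norm_square_less_1[OF x]] LIMSEQ_unique by simp
qed

lemma prod_even_odd:
  fixes f :: "nat \<Rightarrow> 'a::comm_monoid_mult"
  shows "(\<Prod>k<2*n. f k) = (\<Prod>k<n. f (2*k)) * (\<Prod>k<n. f (2*k+1))"
  by (induction n) (simp_all add: mult_ac)

lemma LIMSEQ_double: "f \<longlonglongrightarrow> L \<Longrightarrow> (\<lambda>n. f (2 * n)) \<longlonglongrightarrow> (L::complex)"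
proof -
  assume "f \<longlonglongrightarrow> L"
  from LIMSEQ_subseq_LIMSEQ[OF this, of "\<lambda>n. 2 * n"]
  show ?thesis by (simp add: strict_mono_def comp_def)
qed

lemma qE_split: "norm x < 1 \<Longrightarrow> qE x = qO x * qE (x ^ 2)"
proof -
  assume x: "norm x < 1"
  have "(\<lambda>n. (\<Prod>k<n. 1 - x ^ (2 * k + 1)) * (\<Prod>k<n. 1 - (x ^ 2) ^ Suc k)) \<longlonglongrightarrow> qO x * qE (x ^ 2)"
    by (intro tendsto_mult qO_LIMSEQ qE_LIMSEQ x norm_square_less_1)
  moreover have "(\<Prod>k<2*n. 1 - x ^ Suc k) = (\<Prod>k<n. 1 - x ^ (2 * k + 1)) * (\<Prod>k<n. 1 - (x ^ 2) ^ Suc k)" for n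
    unfolding prod_even_odd power_mult[symmetric] by simp
  ultimately show ?thesis
    using LIMSEQ_double[OF qE_LIMSEQ[OF x]] LIMSEQ_unique by simp
qed

lemma qU_split: "norm x < 1 \<Longrightarrow> qU x = qO (- x) * qU (x ^ 2)"
proof -
  assume x: "norm x < 1"
  have "(\<lambda>n. (\<Prod>k<n. 1 - (-x) ^ (2 * k + 1)) * (\<Prod>k<n. 1 + (x ^ 2) ^ Suc k)) \<longlonglongrightarrow> qO (-x) * qU (x ^ 2)"
    by (intro tendsto_mult qO_LIMSEQ qU_LIMSEQ x norm_square_less_1 norm_uminus_less_1)
  moreover have "(\<Prod>k<2*n. 1 + x ^ Suc k) = (\<Prod>k<n. 1 - (-x) ^ (2 * k + 1)) * (\<Prod>k<n. 1 + (x ^ 2) ^ Suc k)" for n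
    unfolding prod_even_odd power_mult[symmetric] by simp
  ultimately show ?thesis
    using LIMSEQ_double[OF qU_LIMSEQ[OF x]] LIMSEQ_unique by simp
qed

lemma qO_mult_qO_minus: "norm x < 1 \<Longrightarrow> qO x * qO (-x) = qO (x ^ 2)"
proof -
  assume x: "norm x < 1"
  have "(\<lambda>n. (\<Prod>k<n. 1 - x ^ (2 * k + 1)) * (\<Prod>k<n. 1 - (-x) ^ (2 * k + 1))) \<longlonglongrightarrow> qO x * qO (-x)"
    by (intro tendsto_mult qO_LIMSEQ x norm_uminus_less_1)
  moreover have "(\<Prod>k<n. 1 - x ^ (2 * k + 1)) * (\<Prod>k<n. 1 - (-x) ^ (2 * k + 1)) = (\<Prod>k<n. 1 - (x ^ 2) ^ (2 * k + 1))" for n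
    unfolding prod.distrib[symmetric]
    by (intro prod.cong refl)
      (simp add: power_mult[symmetric] algebra_simps power2_eq_square power_add[symmetric] mult_2)
  ultimately show ?thesis
    using qO_LIMSEQ[OF norm_square_less_1[OF x]] LIMSEQ_unique by simp
qed

text \<open>Euler's theorem on partitions into distinct and into odd parts: both factors arise by
  comparing \<open>qE x\<close> with \<open>qE (x ^ 2)\<close>, and \<open>qE x\<close>
  cancels.\<close>

lemma qU_mult_qO: "norm x < 1 \<Longrightarrow> qU x * qO x = 1"
proof -
  assume x: "norm x < 1"
  have "qE x * (qU x * qO x) = qE x * 1"
    using qE_mult_qU[OF x] qE_split[OF x] by (metis mult.assoc mult.commute mult_1)
  then show ?thesis using qE_nz[OF x] by simp
qed

text \<open>This links the products at \<open>- nome z\<close>, which occur in \<open>th3\<close>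
  and \<open>weber\<close>, with those at \<open>nome z\<close> in \<open>th4\<close>.\<close>

lemma qU_mult_qU_minus: "norm x < 1 \<Longrightarrow> qU x * qU (-x) = qU (x ^ 2)"
proof -
  assume x: "norm x < 1"
  have "qU x * qU (-x) = (qO x * qO (-x)) * qU (x ^ 2) * qU (x ^ 2)"
    using qU_split[OF x] qU_split[OF norm_uminus_less_1[OF x]] by simp
  also have "\<dots> = qU (x ^ 2)"
    using qO_mult_qO_minus[OF x] qU_mult_qO[OF norm_square_less_1[OF x]] by (simp add: mult_ac)
  finally show ?thesis .
qed

lemma qE_holomorphic: "qE holomorphic_on ball 0 1"
proof (rule holomorphic_uniform_sequence[where f = "\<lambda>n x. \<Prod>k<n. 1 - x ^ Suc k"])
  show "open (ball (0::complex) 1)" by simp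
  show "(\<lambda>x. \<Prod>k<n. 1 - x ^ Suc k) holomorphic_on ball 0 1" for n
    by (intro holomorphic_intros)
  fix x :: complex assume x: "x \<in> ball 0 1"
  \<comment> \<open>Half the distance to the unit circle: on the closed disc the powers are then
    dominated by those of \<open>norm x + d < 1\<close>.\<close>
  define d where "d = (1 - norm x) / 2"
  have d: "d > 0" and nd: "norm x + d < 1" "0 \<le> norm x + d" using x by (auto simp: d_def field_simps)
  have sub: "norm y \<le> norm x + d" if "y \<in> cball x d" for y
    using that norm_triangle_ineq[of x "y - x"] by (simp add: dist_norm norm_minus_commute)
  have uc: "uniformly_convergent_on (cball x d) (\<lambda>N y. \<Prod>n<N. 1 - y ^ Suc n)"
  proof (rule uniformly_convergent_on_prod')
    show "continuous_on (cball x d) (\<lambda>y. 1 - y ^ Suc n)" for n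
      by (intro continuous_intros)
    show "uniformly_convergent_on (cball x d) (\<lambda>N y. \<Sum>n<N. norm (1 - y ^ Suc n - 1))"
    proof (rule Weierstrass_m_test'[where M = "\<lambda>n. (norm x + d) ^ Suc n"])
      show "norm (norm (1 - y ^ Suc n - 1)) \<le> (norm x + d) ^ Suc n" if "y \<in> cball x d" for n y
        using power_mono[OF sub[OF that] norm_ge_zero, of "Suc n"]
        by (simp add: norm_power norm_mult)
      show "summable (\<lambda>n. (norm x + d) ^ Suc n)"
        using nd by (simp add: summable_mult summable_geometric)
    qed
  qed auto
  moreover from sub have "(\<lambda>N. \<Prod>n<N. 1 - y ^ Suc n) \<longlonglongrightarrow> qE y" if "y \<in> cball x d" for y
    using sub[OF that] nd by (intro qE_LIMSEQ) auto
  then have "lim (\<lambda>N. \<Prod>n<N. 1 - y ^ Suc n) = qE y" if "y \<in> cball x d" for y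
    using that by (intro limI)
  ultimately have lim: "lim (\<lambda>N. \<Prod>n<N. 1 - y ^ Suc n) = qE y" if "y \<in> cball x d" for y
    using that by blast
  have "uniform_limit (cball x d) (\<lambda>N y. \<Prod>n<N. 1 - y ^ Suc n) qE sequentially"
    using uc unfolding uniformly_convergent_uniform_limit_iff
    by (rule uniform_limit_cong'[THEN iffD1, rotated 2]) (use lim in auto)
  moreover have "cball x d \<subseteq> ball 0 1"
    using sub nd by force
  ultimately show "\<exists>d>0. cball x d \<subseteq> ball 0 1 \<and> uniform_limit (cball x d) (\<lambda>N y. \<Prod>n<N. 1 - y ^ Suc n) qE sequentially"
    using d by blast
qed

text \<open>Writing the product as \<open>qE (x ^ 2) / qE x\<close> saves a second argument with
  uniform convergence.\<close>

lemma qU_holomorphic: "qU holomorphic_on ball 0 1"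
proof -
  have "(\<lambda>x. qE (x ^ 2) / qE x) holomorphic_on ball 0 1"
    by (intro holomorphic_intros holomorphic_on_compose_gen[OF _ qE_holomorphic, unfolded o_def] qE_holomorphic)
      (auto simp: qE_nz norm_power power_less_one_iff)
  moreover have "qE (x ^ 2) / qE x = qU x" if "x \<in> ball 0 1" for x
    using qE_mult_qU[of x] qE_nz[of x] that by (auto simp: field_simps)
  ultimately show ?thesis by (rule holomorphic_transform)
qed

section \<open>The Jacobi triple product\<close>

lemma UNIV_int_split: "UNIV = range int \<union> range (\<lambda>n. - int n - 1)"
proof -
  have "x \<in> range int \<union> range (\<lambda>n. - int n - 1)" for x
    by (cases x rule: int_cases) (auto intro: image_eqI[where x = "nat (-x-1)"])
  then show ?thesis by blast
qed

text \<open>Pairing n with -n-1 uses every integer exactly once, with no special role for 0, and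
  turns unordered sums over the integers into ordinary series.\<close>

lemma sums_int_split:
  fixes f :: "int \<Rightarrow> complex"
  assumes "f summable_on UNIV"
  shows "(\<lambda>n::nat. f (int n) + f (- int n - 1)) sums infsum f UNIV"
proof -
  let ?A = "range int" and ?B = "range (\<lambda>n. - int n - 1)"
  have "?A \<inter> ?B = {}" by auto
  moreover have s: "f summable_on ?A" "f summable_on ?B"
    using summable_on_subset_banach[OF assms] by auto
  ultimately have e: "infsum f UNIV = infsum f ?A + infsum f ?B"
    by (subst UNIV_int_split) (rule infsum_Un_disjoint)
  have "((f \<circ> int) has_sum infsum f ?A) UNIV"
    using s(1) by (subst has_sum_reindex[symmetric]) auto
  moreover have "((f \<circ> (\<lambda>n. - int n - 1)) has_sum infsum f ?B) UNIV"
    using s(2) by (subst has_sum_reindex[symmetric]) (auto simp: inj_on_def)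
  ultimately show ?thesis
    unfolding e by (intro sums_add has_sum_imp_sums) (auto simp: o_def)
qed

lemma summable_on_int:
  fixes f :: "int \<Rightarrow> complex"
  assumes "summable (\<lambda>n::nat. norm (f (int n)))" "summable (\<lambda>n::nat. norm (f (- int n - 1)))"
  shows "f summable_on UNIV"
proof -
  let ?A = "range int" and ?B = "range (\<lambda>n. - int n - 1)"
  have "(f \<circ> int) summable_on UNIV" "(f \<circ> (\<lambda>n. - int n - 1)) summable_on UNIV"
    using assms by (auto intro!: norm_summable_imp_summable_on simp: o_def)
  then have "f summable_on ?A" "f summable_on ?B"
    by (auto simp: summable_on_reindex[symmetric] inj_on_def)
  moreover have "?A \<inter> ?B = {}" by auto
  ultimately show ?thesis
    by (subst UNIV_int_split) (rule summable_on_Un_disjoint)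
qed

section \<open>Gaussian binomial coefficients and the finite triple product\<close>

definition qpoch :: "complex \<Rightarrow> nat \<Rightarrow> complex" where
  "qpoch q n = (\<Prod>k<n. 1 - q ^ Suc k)"

text \<open>Extending the reciprocals by \<open>0\<close> to negative indices makes the recurrence
  below hold for all integers, so the induction has no boundary cases.\<close>

definition rpoch :: "complex \<Rightarrow> int \<Rightarrow> complex" where
  "rpoch q j = (if j < 0 then 0 else inverse (qpoch q (nat j)))"

text \<open>The Gaussian binomial coefficient of \<open>2 * N\<close> over \<open>N + n\<close>,
  centred so that it is symmetric in \<open>n\<close>; it vanishes when the modulus of
  \<open>n\<close> exceeds \<open>N\<close>.\<close>

definition qbin :: "complex \<Rightarrow> nat \<Rightarrow> int \<Rightarrow> complex" where
  "qbin q N n = qpoch q (2 * N) * rpoch q (int N - n) * rpoch q (int N + n)"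

lemma one_minus_power_nz: "norm q < 1 \<Longrightarrow> 1 - q ^ Suc k \<noteq> (0::complex)"
  using power_Suc_neq_unit[of q "Suc k" 1] by auto

lemma qpoch_nz: "norm q < 1 \<Longrightarrow> qpoch q n \<noteq> 0"
  unfolding qpoch_def using one_minus_power_nz by (subst prod_zero_iff) auto

lemma rpoch_rec:
  assumes "norm q < 1" "q \<noteq> 0"
  shows "rpoch q (j - 1) = (1 - q powi j) * rpoch q j"
proof (cases "j \<le> 0")
  case False
  then obtain m where j: "j = int (Suc m)"
    by (metis gr0_conv_Suc not_le zero_less_imp_eq_int)
  define Q P where "Q = q ^ Suc m" and "P = qpoch q m"
  have "rpoch q (j - 1) = inverse P" by (simp add: rpoch_def j P_def)
  moreover have "rpoch q j = inverse (P * (1 - Q))"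
    unfolding rpoch_def j by (simp add: qpoch_def P_def Q_def nat_add_distrib del: of_nat_Suc)
  moreover have "q powi j = Q" unfolding j Q_def by (rule power_int_of_nat)
  moreover have "1 - Q \<noteq> 0" "P \<noteq> 0"
    using one_minus_power_nz[OF assms(1), of m] qpoch_nz[OF assms(1), of m] by (auto simp: P_def Q_def)
  ultimately show ?thesis by simp
qed (auto simp: rpoch_def)

text \<open>Two steps of the q-Pascal rule in one, from \<open>2 * N\<close> to
  \<open>2 * N + 2\<close>. In terms of \<open>A\<close>, \<open>B\<close> with
  \<open>A * B = q ^ (2 * N + 2)\<close> all four coefficients are multiples of the same product
  with \<open>R\<close> and \<open>S\<close>, and a polynomial identity in \<open>A\<close> and
  \<open>B\<close> remains.\<close>

lemma qbin_rec:
  assumes "norm q < 1" "q \<noteq> 0"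
  shows "qbin q (Suc N) n = (1 + q ^ (2 * N + 1)) * qbin q N n
           + q powi (int N + 1 - n) * qbin q N (n - 1) + q powi (int N + 1 + n) * qbin q N (n + 1)"
proof -
  note rec = rpoch_rec[OF assms]
  define A B R S where "A = q powi (int N + 1 - n)" and "B = q powi (int N + 1 + n)"
    and "R = rpoch q (int N + 1 - n)" and "S = rpoch q (int N + 1 + n)"
  have AB: "A * B = q ^ (2 * N + 2)"
    unfolding A_def B_def using assms(2)
    by (simp add: power_int_add[symmetric] power_int_of_nat[symmetric] add.commute)
  have A': "q powi (int N - n) = A / q" and B': "q powi (int N + n) = B / q"
    unfolding A_def B_def using assms(2) by (simp_all add: power_int_add power_int_diff)
  have 1: "rpoch q (int N - n) = (1 - A) * R"
    using rec[of "int N + 1 - n"] by (simp add: A_def R_def algebra_simps)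
  have 2: "rpoch q (int N + n) = (1 - B) * S"
    using rec[of "int N + 1 + n"] by (simp add: B_def S_def algebra_simps)
  have 3: "rpoch q (int N - n - 1) = (1 - A / q) * ((1 - A) * R)"
    using rec[of "int N - n"] by (simp add: 1 A')
  have 4: "rpoch q (int N + n - 1) = (1 - B / q) * ((1 - B) * S)"
    using rec[of "int N + n"] by (simp add: 2 B')
  have q1: "q ^ (2 * N + 1) = A * B / q" using AB assms(2) by (simp add: field_simps)
  have 5: "qpoch q (2 * Suc N) = qpoch q (2 * N) * (1 - A * B / q) * (1 - A * B)"
    using AB q1 by (simp add: qpoch_def mult_ac)
  have e1: "qbin q (Suc N) n = qpoch q (2 * N) * (1 - A * B / q) * (1 - A * B) * R * S"
  proof -
    have "int (Suc N) - n = int N + 1 - n" "int (Suc N) + n = int N + 1 + n" by auto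
    then show ?thesis by (simp only: qbin_def 5 R_def S_def)
  qed
  have e2: "qbin q N n = qpoch q (2 * N) * ((1 - A) * R) * ((1 - B) * S)"
    by (simp add: qbin_def 1 2)
  have e3: "qbin q N (n - 1) = qpoch q (2 * N) * R * ((1 - B / q) * ((1 - B) * S))"
  proof -
    have "int N - (n - 1) = int N + 1 - n" "int N + (n - 1) = int N + n - 1" by auto
    then show ?thesis by (simp only: qbin_def 4 R_def)
  qed
  have e4: "qbin q N (n + 1) = qpoch q (2 * N) * ((1 - A / q) * ((1 - A) * R)) * S"
  proof -
    have "int N - (n + 1) = int N - n - 1" "int N + (n + 1) = int N + 1 + n" by auto
    then show ?thesis by (simp only: qbin_def 3 S_def)
  qed
  show ?thesis
    unfolding e1 e2 e3 e4 q1 A_def[symmetric] B_def[symmetric] divide_inverse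
    by (simp add: algebra_simps)
qed

lemma power_int_nat_add: "p \<noteq> (0::complex) \<Longrightarrow> p powi (int k + m) = p ^ k * p powi m"
  by (simp add: power_int_add)

text \<open>The new pair of factors expands into \<open>1 + p ^ (4 * N + 2)\<close> and two terms
  that shift the index by one in either direction; this is the shape of \<open>qbin_rec\<close>.
  Summing over all integers, although only finitely many terms survive, makes the shifts bijections
  of the index set.\<close>

lemma finite_triple_product:
  assumes p: "norm p < 1" "p \<noteq> 0" and w: "w \<noteq> 0"
  shows "((\<lambda>n. qbin (p ^ 2) N n * p powi (n ^ 2) * w powi n) has_sum
           (\<Prod>k<N. (1 + p ^ (2 * k + 1) * w) * (1 + p ^ (2 * k + 1) / w))) UNIV"
proof (induction N)
  case 0
  have *: "qbin (p ^ 2) 0 n * p powi (n ^ 2) * w powi n = (if n = 0 then 1 else 0)" for n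
    by (auto simp: qbin_def rpoch_def qpoch_def)
  have "((\<lambda>n::int. if n = 0 then 1 else 0 :: complex) has_sum 1) {0}"
    using has_sum_finite[of "{0::int}" "\<lambda>n. if n = 0 then 1 else 0 :: complex"] by simp
  then show ?case unfolding *
    by (subst has_sum_cong_neutral[where T = "{0}"]) auto
next
  case (Suc N)
  let ?t = "\<lambda>N n. qbin (p ^ 2) N n * p powi (n ^ 2) * w powi n"
  let ?P = "\<Prod>k<N. (1 + p ^ (2 * k + 1) * w) * (1 + p ^ (2 * k + 1) / w)"
  have q: "norm (p ^ 2) < 1" "p ^ 2 \<noteq> 0" using p norm_square_less_1 by auto
  have q2: "(p ^ 2) powi k = p powi (2 * k)" for k
    by (simp add: power_int_mult)
  have rec: "?t (Suc N) n = (1 + p ^ (4 * N + 2)) * ?t N n + p ^ (2 * N + 1) * w * ?t N (n - 1)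
               + p ^ (2 * N + 1) / w * ?t N (n + 1)" for n
  proof -
    have a: "(p ^ 2) powi (int N + 1 - n) * p powi (n ^ 2) * w powi n
        = p ^ (2 * N + 1) * w * (p powi ((n - 1) ^ 2) * w powi (n - 1))"
    proof -
      have "(p ^ 2) powi (int N + 1 - n) * p powi (n ^ 2) = p powi (2 * (int N + 1 - n) + n ^ 2)"
        using p by (simp add: q2 power_int_add)
      also have "2 * (int N + 1 - n) + n ^ 2 = int (2 * N + 1) + (n - 1) ^ 2"
        by (simp add: power2_eq_square algebra_simps)
      also have "p powi \<dots> = p ^ (2 * N + 1) * p powi ((n - 1) ^ 2)"
        using p by (intro power_int_nat_add)
      finally show ?thesis using w by (simp add: power_int_diff)
    qed
    have b: "(p ^ 2) powi (int N + 1 + n) * p powi (n ^ 2) * w powi n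
        = p ^ (2 * N + 1) / w * (p powi ((n + 1) ^ 2) * w powi (n + 1))"
    proof -
      have "(p ^ 2) powi (int N + 1 + n) * p powi (n ^ 2) = p powi (2 * (int N + 1 + n) + n ^ 2)"
        using p by (simp add: q2 power_int_add)
      also have "2 * (int N + 1 + n) + n ^ 2 = int (2 * N + 1) + (n + 1) ^ 2"
        by (simp add: power2_eq_square algebra_simps)
      also have "p powi \<dots> = p ^ (2 * N + 1) * p powi ((n + 1) ^ 2)"
        using p by (intro power_int_nat_add)
      finally show ?thesis using w by (simp add: power_int_add)
    qed
    have c: "(p ^ 2) ^ (2 * N + 1) = p ^ (4 * N + 2)"
      unfolding power_mult[symmetric] by (rule arg_cong[where f = "power p"]) simp
    have "?t (Suc N) n = (1 + p ^ (4 * N + 2)) * ?t N n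
        + qbin (p ^ 2) N (n - 1) * ((p ^ 2) powi (int N + 1 - n) * p powi (n ^ 2) * w powi n)
        + qbin (p ^ 2) N (n + 1) * ((p ^ 2) powi (int N + 1 + n) * p powi (n ^ 2) * w powi n)"
      unfolding qbin_rec[OF q] c by (simp add: algebra_simps)
    then show ?thesis unfolding a b by (simp add: algebra_simps)
  qed
  have m: "((\<lambda>n. ?t N (n - 1)) has_sum ?P) UNIV"
    using Suc by (subst has_sum_reindex_bij_betw[where g = "\<lambda>n. n - 1" and B = UNIV and f = "?t N"])
      (auto intro!: bij_betwI[where g = "\<lambda>n. n + 1"])
  have pl: "((\<lambda>n. ?t N (n + 1)) has_sum ?P) UNIV"
    using Suc by (subst has_sum_reindex_bij_betw[where g = "\<lambda>n. n + 1" and B = UNIV and f = "?t N"])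
      (auto intro!: bij_betwI[where g = "\<lambda>n. n - 1"])
  have "(?t (Suc N) has_sum ((1 + p ^ (4 * N + 2)) * ?P + p ^ (2 * N + 1) * w * ?P + p ^ (2 * N + 1) / w * ?P)) UNIV"
    unfolding rec by (intro has_sum_add has_sum_cmult_right Suc m pl)
  moreover have "(1 + p ^ (4 * N + 2)) * ?P + p ^ (2 * N + 1) * w * ?P + p ^ (2 * N + 1) / w * ?P
     = ?P * ((1 + p ^ (2 * N + 1) * w) * (1 + p ^ (2 * N + 1) / w))"
  proof -
    have e: "p ^ (4 * N + 2) = p ^ (2 * N + 1) * p ^ (2 * N + 1)"
      unfolding power_add[symmetric] by (rule arg_cong[where f = "power p"]) simp
    have gen: "(1 + Q * Q) * X + Q * w * X + Q / w * X = X * ((1 + Q * w) * (1 + Q / w))" for Q X :: complex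
      using w by (simp add: field_simps)
    show ?thesis unfolding e by (rule gen)
  qed
  ultimately show ?case by simp
qed

lemma qpoch_LIMSEQ: "norm q < 1 \<Longrightarrow> (\<lambda>n. qpoch q n) \<longlonglongrightarrow> qE q"
  unfolding qpoch_def by (rule qE_LIMSEQ)

lemma rpoch_LIMSEQ:
  assumes "norm q < 1"
  shows "(\<lambda>N. rpoch q (int N + n)) \<longlonglongrightarrow> inverse (qE q)"
proof -
  have "(\<lambda>k. inverse (qpoch q k)) \<longlonglongrightarrow> inverse (qE q)"
    by (intro tendsto_inverse qpoch_LIMSEQ assms qE_nz)
  moreover have "filterlim (\<lambda>N. nat (int N + n)) at_top sequentially"
    unfolding filterlim_at_top_ge[where c = 0]
  proof (intro allI impI)
    fix Z :: nat
    show "eventually (\<lambda>N. Z \<le> nat (int N + n)) sequentially"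
      using eventually_ge_at_top[of "nat (int Z - n)"] by eventually_elim linarith
  qed
  ultimately have "(\<lambda>N. inverse (qpoch q (nat (int N + n)))) \<longlonglongrightarrow> inverse (qE q)"
    by (rule filterlim_compose)
  moreover have "eventually (\<lambda>N. inverse (qpoch q (nat (int N + n))) = rpoch q (int N + n)) sequentially"
    using eventually_ge_at_top[of "nat (- n)"] by eventually_elim (auto simp: rpoch_def)
  ultimately show ?thesis by (rule Lim_transform_eventually)
qed

lemma qbin_LIMSEQ:
  assumes "norm q < 1"
  shows "(\<lambda>N. qbin q N n) \<longlonglongrightarrow> inverse (qE q)"
proof -
  have "(\<lambda>N. qbin q N n) \<longlonglongrightarrow> qE q * inverse (qE q) * inverse (qE q)"
    unfolding qbin_def using rpoch_LIMSEQ[OF assms, of "-n"] rpoch_LIMSEQ[OF assms, of n]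
    by (intro tendsto_mult LIMSEQ_double qpoch_LIMSEQ assms) auto
  then show ?thesis using qE_nz[OF assms] by simp
qed

text \<open>A bound uniform in both indices, as domination for the limit of the finite
  identity.\<close>

lemma qbin_bounded:
  assumes "norm q < 1"
  obtains C where "\<And>N n. norm (qbin q N n) \<le> C" "C > 0"
proof -
  from convergent_imp_Bseq[OF convergentI[OF qpoch_LIMSEQ[OF assms]]]
  obtain C1 where C1: "C1 > 0" "\<And>n. norm (qpoch q n) \<le> C1" by (auto simp: Bseq_def)
  from convergent_imp_Bseq[OF convergentI[OF tendsto_inverse[OF qpoch_LIMSEQ[OF assms] qE_nz[OF assms]]]]
  obtain C2 where C2: "C2 > 0" "\<And>n. norm (inverse (qpoch q n)) \<le> C2" by (auto simp: Bseq_def)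
  have r: "norm (rpoch q j) \<le> C2" for j using C2 by (simp add: rpoch_def less_imp_le)
  have "norm (qbin q N n) \<le> C1 * C2 * C2" for N n
    unfolding qbin_def norm_mult using C1 C2 r by (intro mult_mono) (auto simp: less_imp_le)
  then show ?thesis using that C1 C2 by (meson mult_pos_pos)
qed

text \<open>Tannery's theorem lets \<open>N\<close> tend to infinity in the finite identity. The
  range of \<open>w\<close> contains the two values needed, 1 and \<open>p\<close>, and gives the
  majorant \<open>norm p ^ k\<close> on both halves of the series. The limit \<open>L\<close> is a
  parameter so that each application can identify the product in its own way.\<close>

theorem jacobi_triple_product:
  assumes p: "norm p < 1" "p \<noteq> 0" and w: "norm p \<le> norm w" "norm w \<le> 1"
    and L: "(\<lambda>N. \<Prod>k<N. (1 + p ^ (2 * k + 1) * w) * (1 + p ^ (2 * k + 1) / w)) \<longlonglongrightarrow> L"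
  shows "(\<lambda>k. p ^ (k ^ 2) * w ^ k + p ^ (Suc k ^ 2) / w ^ Suc k) sums (qE (p ^ 2) * L)"
proof -
  have w0: "w \<noteq> 0" using p w by auto
  define q where "q = p ^ 2"
  have q: "norm q < 1" using p norm_square_less_1 by (simp add: q_def)
  obtain C where C: "\<And>N n. norm (qbin q N n) \<le> C" "C > 0" using qbin_bounded[OF q] by blast
  define c where "c k = p ^ (k ^ 2) * w ^ k" for k
  define d where "d k = p ^ (Suc k ^ 2) / w ^ Suc k" for k
  have t1: "p powi ((int k) ^ 2) * w powi (int k) = c k" for k
    by (simp add: c_def power_int_of_nat flip: of_nat_power)
  have t2: "p powi ((- int k - 1) ^ 2) * w powi (- int k - 1) = d k" for k
  proof -
    have "(- int k - 1) ^ 2 = int (Suc k ^ 2)" "- int k - 1 = - int (Suc k)"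
      by (simp_all add: power2_eq_square algebra_simps)
    then show ?thesis
      by (simp only: d_def power_int_of_nat power_int_minus) (simp add: divide_simps)
  qed
  define a where "a k N = qbin q N (int k) * c k + qbin q N (- int k - 1) * d k" for k N
  define A where "A N = (\<Prod>k<N. (1 + p ^ (2 * k + 1) * w) * (1 + p ^ (2 * k + 1) / w))" for N
  have sumsA: "(\<lambda>k. a k N) sums A N" for N
  proof -
    note h = finite_triple_product[OF p w0, of N, folded q_def A_def]
    show ?thesis
      using sums_int_split[OF has_sum_imp_summable[OF h], unfolded infsumI[OF h]]
      by (simp only: a_def mult.assoc t1 t2)
  qed
  have lim: "((\<lambda>N. a k N) \<longlongrightarrow> inverse (qE q) * (c k + d k)) sequentially" for k
    unfolding a_def distrib_left by (intro tendsto_intros qbin_LIMSEQ q)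
  have cb: "norm (c k) \<le> norm p ^ k" for k
  proof -
    have "norm (c k) \<le> norm p ^ (k ^ 2) * 1"
      unfolding c_def norm_mult norm_power using w by (intro mult_left_mono power_le_one) auto
    also have "\<dots> \<le> norm p ^ k"
      using p by (simp add: power_decreasing power2_nat_le_imp_le power2_eq_square)
    finally show ?thesis .
  qed
  have db: "norm (d k) \<le> norm p ^ k" for k
  proof -
    \<comment> \<open>This splits off just as many factors \<open>p\<close> as there are factors
      \<open>w\<close> in the denominator.\<close>
    have e: "Suc k ^ 2 = Suc k * k + Suc k" by (simp add: power2_eq_square)
    have "norm (d k) = norm p ^ (Suc k * k) * (norm p ^ Suc k / norm w ^ Suc k)"
      unfolding d_def norm_divide e power_add by (simp add: norm_power norm_mult)
    also have "\<dots> \<le> norm p ^ (Suc k * k) * 1"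
      using w w0 by (intro mult_left_mono) (auto simp: divide_le_eq_1 power_mono simp del: power_Suc)
    also have "\<dots> \<le> norm p ^ k" using p by (simp add: power_decreasing)
    finally show ?thesis .
  qed
  have ab: "norm (a k N) \<le> 2 * C * norm p ^ k" for k N
  proof -
    have "norm (a k N) \<le> C * norm p ^ k + C * norm p ^ k"
      unfolding a_def using C(1) cb db less_imp_le[OF C(2)]
      by (intro norm_triangle_le add_mono) (auto simp: norm_mult intro!: mult_mono)
    then show ?thesis by simp
  qed
  have sm: "summable (\<lambda>k. 2 * C * norm p ^ k)"
    using p by (intro summable_mult summable_geometric) auto
  have *: "summable (\<lambda>n. norm (inverse (qE q) * (c n + d n)))" 
    "((\<lambda>N. \<Sum>k. a k N) \<longlongrightarrow> (\<Sum>k. inverse (qE q) * (c k + d k))) sequentially"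
    using tannerys_theorem[where a = a, OF lim always_eventually sm] ab by auto
  have "(\<lambda>N. \<Sum>k. a k N) = A" using sumsA by (auto simp: sums_iff)
  then have "(\<Sum>k. inverse (qE q) * (c k + d k)) = L"
    using *(2) L LIMSEQ_unique unfolding A_def[symmetric] by metis
  then have "(\<lambda>k. inverse (qE q) * (c k + d k)) sums L"
    using summable_norm_cancel[OF *(1)] by (auto simp: sums_iff)
  from sums_mult[OF this, of "qE q"] show ?thesis
    using qE_nz[OF q] by (simp add: c_def d_def q_def mult.assoc[symmetric])
qed

section \<open>Theta series as products\<close>

lemma qE_0 [simp]: "qE 0 = 1" and qU_0 [simp]: "qU 0 = 1"
  by (simp_all add: qE_def qU_def)

lemma theta4_0: "theta4 0 = 1"
proof -
  have "((\<lambda>n::int. if n = 0 then 1 else 0 :: complex) has_sum 1) {0}"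
    using has_sum_finite[of "{0::int}" "\<lambda>n. if n = 0 then 1 else 0 :: complex"] by simp
  then have "((\<lambda>n::int. if n = 0 then 1 else 0 :: complex) has_sum 1) UNIV"
    by (subst has_sum_cong_neutral[where T = "{0}"]) auto
  moreover have "(-1) powi k * 0 powi (k\<^sup>2) = (if k = 0 then 1 else 0 :: complex)" for k
    by auto
  ultimately show ?thesis unfolding theta4_def by (simp add: infsumI)
qed

lemma summable_square_powers:
  fixes x :: complex assumes "norm x < 1"
  shows "summable (\<lambda>n. norm (x ^ (n ^ 2)))"
  by (rule summable_norm_power[OF assms]) (auto simp: strict_mono_def power_strict_mono)

text \<open>An integer and its square have the same parity, so the sign is absorbed into
  \<open>(-x) ^ (k ^ 2)\<close>.\<close>

lemma theta4_sums_pair: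
  assumes "norm x < 1"
  shows "(\<lambda>k. (-x) ^ (k ^ 2) + (-x) ^ (Suc k ^ 2)) sums theta4 x"
proof -
  define f where "f k = (-1) powi k * x powi (k ^ 2)" for k
  have f1: "f (int n) = (-x) ^ (n ^ 2)" for n
  proof -
    have "f (int n) = (-1) ^ n * x ^ (n ^ 2)"
      by (simp add: f_def flip: of_nat_power)
    also have "(-1) ^ n = (-1 :: complex) ^ (n ^ 2)" by (simp add: uminus_power_if)
    finally show ?thesis by (simp flip: power_mult_distrib)
  qed
  have f2: "f (- int n - 1) = (-x) ^ (Suc n ^ 2)" for n
  proof -
    have e: "(- int n - 1) ^ 2 = (int (Suc n)) ^ 2" "- int n - 1 = - int (Suc n)"
      by (simp_all add: power2_eq_square algebra_simps)
    have "(-1) powi (- int m) = ((-1) powi int m :: complex)" for m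
      by (cases "even m") (simp_all add: power_int_minus)
    then have "f (- int n - 1) = f (int (Suc n))"
      unfolding f_def e(2) power2_minus by (simp only:)
    then show ?thesis by (simp only: f1)
  qed
  have s: "summable (\<lambda>n. norm ((-x) ^ (n ^ 2)))"
    using summable_square_powers[of "-x"] assms by simp
  have "f summable_on UNIV"
  proof (rule summable_on_int)
    show "summable (\<lambda>n. norm (f (int n)))" unfolding f1 by (rule s)
    show "summable (\<lambda>n. norm (f (- int n - 1)))" unfolding f2
      using s by (subst summable_Suc_iff[of "\<lambda>n. norm ((-x) ^ (n ^ 2))"])
  qed
  from sums_int_split[OF this] show ?thesis
    by (simp only: f1 f2 theta4_def f_def[symmetric])
qed

lemma theta4_sums:
  assumes "norm x < 1"
  shows "(\<lambda>n. (-x) ^ (n ^ 2)) sums ((theta4 x + 1) / 2)"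
proof -
  define S where "S = (\<Sum>n. (-x) ^ (n ^ 2))"
  have s: "(\<lambda>n. (-x) ^ (n ^ 2)) sums S"
  proof -
    have "summable (\<lambda>n. norm ((-x) ^ (n ^ 2)))"
      using summable_square_powers[of "-x"] assms by simp
    then show ?thesis unfolding S_def by (intro summable_sums) (rule summable_norm_cancel)
  qed
  then have "(\<lambda>n. (-x) ^ (Suc n ^ 2)) sums (S - 1)"
    by (subst sums_Suc_iff[of "\<lambda>n. (-x) ^ (n ^ 2)" "S - 1"]) simp
  from sums_unique2[OF theta4_sums_pair[OF assms] sums_add[OF s this]]
  have "(theta4 x + 1) / 2 = S" by simp
  then show ?thesis using s by simp
qed

text \<open>The triple product at base \<open>-x\<close> and \<open>w = 1\<close> gives
  \<open>qE (x ^ 2) * qO x ^ 2\<close>, which Euler's identity turns into the quotient. The origin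
  is separate because the triple product requires a nonzero base.\<close>

theorem theta4_product:
  assumes "norm x < 1"
  shows "theta4 x = qE x / qU x"
proof -
  have *: "qE x / qU x = qE (x ^ 2) * (qO x * qO x)"
    using qE_split[OF assms] qU_mult_qO[OF assms] qU_nz[OF assms] by (simp add: field_simps)
  show ?thesis
  proof (cases "x = 0")
    case True
    then show ?thesis by (simp add: theta4_0)
  next
    case False
    have eq: "(\<Prod>k<N. (1 + (-x) ^ (2 * k + 1) * 1) * (1 + (-x) ^ (2 * k + 1) / 1))
        = (\<Prod>k<N. 1 - x ^ (2 * k + 1)) * (\<Prod>k<N. 1 - x ^ (2 * k + 1))" for N
      unfolding prod.distrib[symmetric] by (intro prod.cong) auto
    have "(\<lambda>N. \<Prod>k<N. (1 + (-x) ^ (2 * k + 1) * 1) * (1 + (-x) ^ (2 * k + 1) / 1)) \<longlonglongrightarrow> qO x * qO x"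
      unfolding eq by (intro tendsto_mult qO_LIMSEQ assms)
    from jacobi_triple_product[of "-x" 1, OF _ _ _ _ this]
    have "(\<lambda>k. (-x) ^ (k ^ 2) + (-x) ^ (Suc k ^ 2)) sums (qE (x ^ 2) * (qO x * qO x))"
      using assms False by simp
    from sums_unique2[OF theta4_sums_pair[OF assms] this] show ?thesis by (simp only: *)
  qed
qed

text \<open>Gauss's series over triangular numbers. At \<open>w = p\<close> the terms with indices k
  and -k-1 coincide, which doubles the series; on the product side the first factor
  \<open>1 + p / p\<close> is the matching 2.\<close>

theorem psi_product:
  assumes p: "norm p < 1" "p \<noteq> 0"
  shows "(\<lambda>k. p ^ (k * Suc k)) sums (qE (p ^ 2) * qU (p ^ 2) ^ 2)"
proof -
  note q = norm_square_less_1[OF p(1)]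
  have eq: "(\<Prod>k<Suc N. (1 + p ^ (2 * k + 1) * p) * (1 + p ^ (2 * k + 1) / p))
        = 2 * ((\<Prod>k<Suc N. 1 + (p ^ 2) ^ Suc k) * (\<Prod>k<N. 1 + (p ^ 2) ^ Suc k))" for N
  proof -
    have "(\<Prod>k<Suc N. (1 + p ^ (2 * k + 1) * p) * (1 + p ^ (2 * k + 1) / p)) =
       (\<Prod>k<Suc N. 1 + (p ^ 2) ^ Suc k) * (\<Prod>k<Suc N. 1 + (p ^ 2) ^ k)"
      unfolding prod.distrib[symmetric] using p(2)
      by (intro prod.cong refl) (simp add: power_mult power_add power2_eq_square power_mult_distrib mult_ac)
    also have "(\<Prod>k<Suc N. 1 + (p ^ 2) ^ k) = 2 * (\<Prod>k<N. 1 + (p ^ 2) ^ Suc k)"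
      unfolding prod.lessThan_Suc_shift by simp
    finally show ?thesis by (simp only: mult_ac)
  qed
  have "(\<lambda>N. \<Prod>k<Suc N. (1 + p ^ (2 * k + 1) * p) * (1 + p ^ (2 * k + 1) / p)) \<longlonglongrightarrow> 2 * (qU (p ^ 2) * qU (p ^ 2))"
    unfolding eq by (intro tendsto_mult tendsto_const qU_LIMSEQ q LIMSEQ_Suc[OF qU_LIMSEQ])
  then have "(\<lambda>N. \<Prod>k<N. (1 + p ^ (2 * k + 1) * p) * (1 + p ^ (2 * k + 1) / p)) \<longlonglongrightarrow> 2 * (qU (p ^ 2) * qU (p ^ 2))"
    by (subst (asm) filterlim_sequentially_Suc)
  from jacobi_triple_product[of p p, OF _ _ _ _ this]
  have "(\<lambda>k. p ^ (k ^ 2) * p ^ k + p ^ (Suc k ^ 2) / p ^ Suc k) sums (qE (p ^ 2) * (2 * (qU (p ^ 2) * qU (p ^ 2))))"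
    using p by simp
  moreover have "p ^ (k ^ 2) * p ^ k + p ^ (Suc k ^ 2) / p ^ Suc k = 2 * p ^ (k * Suc k)" for k
  proof -
    have "p ^ (k ^ 2) * p ^ k = p ^ (k * Suc k)"
      unfolding power_add[symmetric] by (rule arg_cong[where f = "power p"]) (simp add: power2_eq_square)
    moreover have "p ^ (Suc k ^ 2) = p ^ (k * Suc k) * p ^ Suc k"
      unfolding power_add[symmetric] by (rule arg_cong[where f = "power p"]) (simp add: power2_eq_square)
    ultimately show ?thesis using p(2) by simp
  qed
  ultimately have "(\<lambda>k. 2 * p ^ (k * Suc k)) sums (2 * (qE (p ^ 2) * (qU (p ^ 2) * qU (p ^ 2))))"
    by (simp add: mult_ac)
  from sums_mult[OF this, of "1/2"] show ?thesis by (simp add: power2_eq_square)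
qed

lemma theta4_holomorphic: "theta4 holomorphic_on ball 0 1"
proof -
  have "(\<lambda>x. qE x / qU x) holomorphic_on ball 0 1"
    by (intro holomorphic_intros qE_holomorphic qU_holomorphic) (auto simp: qU_nz)
  then show ?thesis by (rule holomorphic_transform) (auto simp: theta4_product)
qed

lemma theta4_nz: "norm x < 1 \<Longrightarrow> theta4 x \<noteq> 0"
  by (simp add: theta4_product qE_nz qU_nz)

text \<open>Even and odd indices in \<open>theta4 (- P)\<close> give \<open>theta4 (- P ^ 4)\<close> and the series of
  \<open>psi_product\<close>.\<close>

lemma theta4_dissect:
  assumes "norm P < 1" "P \<noteq> 0"
  shows "theta4 (- P) = theta4 (- (P ^ 4)) + 2 * P * (qE (P ^ 8) * qU (P ^ 8) ^ 2)"
proof -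
  have P4: "norm (P ^ 4) < 1" using assms by (simp add: norm_power power_less_one_iff)
  have "(\<lambda>n. P ^ (n ^ 2)) sums ((theta4 (- P) + 1) / 2)"
    using theta4_sums[of "-P"] assms by simp
  from sums_group[OF this, of 2]
  have "(\<lambda>n. \<Sum>k = n * 2..<n * 2 + 2. P ^ (k ^ 2)) sums ((theta4 (- P) + 1) / 2)" by simp
  moreover have "(\<Sum>k = n * 2..<n * 2 + 2. P ^ (k ^ 2)) = (P ^ 4) ^ (n ^ 2) + P * (P ^ 4) ^ (n * Suc n)" for n
  proof -
    have "{n * 2..<n * 2 + 2} = {2 * n, 2 * n + 1}" by auto
    moreover have "P ^ ((2 * n) ^ 2) = (P ^ 4) ^ (n ^ 2)"
      unfolding power_mult[symmetric] by (rule arg_cong[where f = "power P"]) (simp add: power2_eq_square)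
    moreover have "P ^ ((2 * n + 1) ^ 2) = P ^ (1 + 4 * (n * Suc n))"
      by (rule arg_cong[where f = "power P"]) (simp add: power2_eq_square)
    ultimately show ?thesis by (simp add: power_add power_mult)
  qed
  ultimately have 1: "(\<lambda>n. (P ^ 4) ^ (n ^ 2) + P * (P ^ 4) ^ (n * Suc n)) sums ((theta4 (- P) + 1) / 2)"
    by simp
  have "(\<lambda>n. (P ^ 4) ^ (n ^ 2)) sums ((theta4 (- (P ^ 4)) + 1) / 2)"
    using theta4_sums[of "- (P ^ 4)"] P4 by simp
  moreover have "(P ^ 4) ^ 2 = P ^ 8" by (simp flip: power_mult)
  ultimately have "(\<lambda>n. (P ^ 4) ^ (n ^ 2) + P * (P ^ 4) ^ (n * Suc n)) sums
     ((theta4 (- (P ^ 4)) + 1) / 2 + P * (qE (P ^ 8) * qU (P ^ 8) ^ 2))"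
    using psi_product[OF P4] assms by (intro sums_add sums_mult) auto
  with 1 have "(theta4 (- P) + 1) / 2 = (theta4 (- (P ^ 4)) + 1) / 2 + P * (qE (P ^ 8) * qU (P ^ 8) ^ 2)"
    by (rule sums_unique2)
  moreover have "a = b + 2 * c" if "(a + 1) / 2 = (b + 1) / 2 + c" for a b c :: complex
  proof -
    have "a + 1 = 2 * ((a + 1) / 2)" by (simp only: nonzero_mult_div_cancel_left times_divide_eq_right) simp
    also have "\<dots> = b + 1 + 2 * c" unfolding that by (simp add: distrib_left)
    finally show ?thesis by simp
  qed
  ultimately show ?thesis by (simp only: mult.assoc)
qed

section \<open>Poisson summation for the Gaussian\<close>

definition gauss :: "real \<Rightarrow> complex \<Rightarrow> complex" where
  "gauss t u = exp (- of_real pi * of_real t * u ^ 2)"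

text \<open>The integers are enumerated by the pairs \<open>m\<close>, \<open>- m - 1\<close>.\<close>

definition gauss_pair :: "real \<Rightarrow> nat \<Rightarrow> complex \<Rightarrow> complex" where
  "gauss_pair t m u = gauss t (u + of_nat m) + gauss t (u - of_nat m - 1)"

definition gauss_per :: "real \<Rightarrow> complex \<Rightarrow> complex" where
  "gauss_per t u = (\<Sum>m. gauss_pair t m u)"

text \<open>Completing the square: the quadratic term beats the linear term coming from
  \<open>u\<close> and still leaves one copy of the modulus of \<open>n\<close>, hence geometric
  decay uniform on discs. The constant \<open>(2 * R + 1)\<^sup>2 / 4\<close> is what the completion
  costs.\<close>

lemma norm_gauss_le:
  assumes t: "t > 0" and u: "norm u \<le> R" and m: "\<bar>n\<bar> \<ge> real m"
  shows "norm (gauss t (u + of_real n)) \<le> exp (pi * t * (R\<^sup>2 + (2 * R + 1)\<^sup>2 / 4)) * exp (- pi * t) ^ m"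
proof -
  have Re: "Re ((u + of_real n) ^ 2) = n\<^sup>2 + 2 * (n * Re u) + (Re u)\<^sup>2 - (Im u)\<^sup>2"
    by (simp add: power2_eq_square algebra_simps)
  have R: "\<bar>Re u\<bar> \<le> R" "\<bar>Im u\<bar> \<le> R" "R \<ge> 0"
    using u abs_Re_le_cmod[of u] abs_Im_le_cmod[of u] norm_ge_zero[of u] by linarith+
  have "(Im u)\<^sup>2 \<le> R\<^sup>2" using R by (metis abs_le_square_iff abs_of_nonneg)
  moreover have "\<bar>n * Re u\<bar> \<le> \<bar>n\<bar> * R" unfolding abs_mult using R by (intro mult_left_mono) auto
  moreover have "(\<bar>n\<bar> - (2 * R + 1) / 2)\<^sup>2 \<ge> 0" by simp
  then have "n\<^sup>2 - 2 * (\<bar>n\<bar> * R) - \<bar>n\<bar> + (2 * R + 1)\<^sup>2 / 4 \<ge> 0"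
    by (simp add: power2_eq_square field_simps)
  moreover have "(Re u)\<^sup>2 \<ge> 0" by simp
  ultimately have "Re ((u + of_real n) ^ 2) \<ge> real m - (R\<^sup>2 + (2 * R + 1)\<^sup>2 / 4)"
    unfolding Re using m by linarith
  then have "pi * t * (real m - (R\<^sup>2 + (2 * R + 1)\<^sup>2 / 4)) \<le> pi * t * Re ((u + of_real n) ^ 2)"
    using t by (intro mult_left_mono) auto
  moreover have "norm (gauss t (u + of_real n)) = exp (- (pi * t * Re ((u + of_real n) ^ 2)))"
    unfolding gauss_def norm_exp_eq_Re by (simp add: mult.assoc)
  moreover have "exp (pi * t * (R\<^sup>2 + (2 * R + 1)\<^sup>2 / 4)) * exp (- pi * t) ^ m =
     exp (- (pi * t * (real m - (R\<^sup>2 + (2 * R + 1)\<^sup>2 / 4))))"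
    by (simp add: exp_of_nat_mult[symmetric] exp_add[symmetric] algebra_simps)
  ultimately show ?thesis by simp
qed

lemma gauss_pair_bound:
  assumes "t > 0" "R \<ge> 0"
  obtains M where "summable M" "\<And>m u. norm u \<le> R \<Longrightarrow> norm (gauss_pair t m u) \<le> M m"
proof
  let ?C = "exp (pi * t * (R\<^sup>2 + (2 * R + 1)\<^sup>2 / 4))"
  show "summable (\<lambda>m. 2 * ?C * exp (- pi * t) ^ m)"
    using assms by (intro summable_mult summable_geometric) auto
  fix m u assume u: "norm (u :: complex) \<le> R"
  have "norm (gauss t (u + of_real (real m))) \<le> ?C * exp (- pi * t) ^ m"
    by (rule norm_gauss_le[OF assms(1) u]) auto
  moreover have "norm (gauss t (u + of_real (- real m - 1))) \<le> ?C * exp (- pi * t) ^ m"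
    by (rule norm_gauss_le[OF assms(1) u]) auto
  ultimately have "norm (gauss t (u + of_real (real m)) + gauss t (u + of_real (- real m - 1))) \<le>
      ?C * exp (- pi * t) ^ m + ?C * exp (- pi * t) ^ m"
    by (intro norm_triangle_mono)
  then show "norm (gauss_pair t m u) \<le> 2 * ?C * exp (- pi * t) ^ m"
    by (simp add: gauss_pair_def algebra_simps)
qed

lemma gauss_per_uniform:
  assumes "t > 0"
  shows "uniform_limit (cball 0 R) (\<lambda>M u. \<Sum>m<M. gauss_pair t m u) (gauss_per t) sequentially"
proof (cases "R \<ge> 0")
  case True
  obtain M where M: "summable M" "\<And>m u. norm u \<le> R \<Longrightarrow> norm (gauss_pair t m u) \<le> M m"
    using gauss_pair_bound[OF assms True] by blast
  show ?thesis unfolding gauss_per_def[abs_def]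
    using M by (intro Weierstrass_m_test) auto
qed auto

lemma gauss_pair_holomorphic: "gauss_pair t m holomorphic_on A"
  unfolding gauss_pair_def[abs_def] gauss_def[abs_def] by (intro holomorphic_intros)

lemma gauss_per_holomorphic:
  assumes "t > 0"
  shows "gauss_per t holomorphic_on UNIV"
proof (rule holomorphic_uniform_sequence)
  show "(\<lambda>u. \<Sum>m<M. gauss_pair t m u) holomorphic_on UNIV" for M
    by (intro holomorphic_intros gauss_pair_holomorphic)
  fix x :: complex
  have "norm y \<le> norm x + 1" if "dist x y \<le> 1" for y
    using norm_triangle_sub[of y x] that by (simp add: dist_norm norm_minus_commute)
  then have "cball x 1 \<subseteq> cball 0 (norm x + 1)" by auto
  then have "uniform_limit (cball x 1) (\<lambda>M u. \<Sum>m<M. gauss_pair t m u) (gauss_per t) sequentially"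
    using gauss_per_uniform[OF assms] uniform_limit_on_subset by blast
  then show "\<exists>d>0. cball x d \<subseteq> UNIV \<and>
      uniform_limit (cball x d) (\<lambda>M u. \<Sum>m<M. gauss_pair t m u) (gauss_per t) sequentially"
    by (intro exI[of _ 1]) auto
qed auto

section \<open>Fourier coefficients of the periodized Gaussian\<close>

definition wave :: "int \<Rightarrow> real \<Rightarrow> complex" where
  "wave k x = exp (- 2 * of_real pi * \<i> * of_int k * of_real x)"

lemma wave_shift: "wave k (x + of_int n) = wave k x"
proof -
  have "wave k (x + of_int n) = wave k x * exp (2 * of_real pi * \<i> * of_int (- k * n))"
    unfolding wave_def exp_add[symmetric] by (rule arg_cong[where f = exp]) (simp add: algebra_simps)
  also have "exp (2 * of_real pi * \<i> * of_int (- k * n)) = 1"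
    using exp_integer_2pi[of "of_int (- k * n)"] by (simp add: mult_ac)
  finally show ?thesis by simp
qed

lemma continuous_wave: "continuous_on A (wave k)"
  unfolding wave_def[abs_def] by (intro continuous_intros)

lemma continuous_gauss: "continuous_on A (\<lambda>x::real. gauss t (of_real x))"
  unfolding gauss_def[abs_def] by (intro continuous_intros)

lemma gauss_wave_integrable:
  "a \<le> b \<Longrightarrow> (\<lambda>x. gauss t (of_real x) * wave k x) integrable_on {a..b}"
  by (intro integrable_continuous_real continuous_intros continuous_wave continuous_gauss)

lemma gauss_shift_integral:
  "integral {-1/2..1/2} (\<lambda>x. gauss t (of_real x + of_int n) * wave k x) =
   integral {of_int n - 1/2..of_int n + 1/2} (\<lambda>x. gauss t (of_real x) * wave k x)"
proof -
  have "((\<lambda>x. gauss t (of_real x) * wave k x) has_integral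
     integral {of_int n - 1/2..of_int n + 1/2} (\<lambda>x. gauss t (of_real x) * wave k x)) (cbox (of_int n - 1/2) (of_int n + 1/2))"
    using gauss_wave_integrable[of "of_int n - 1/2" "of_int n + 1/2" t k] by (simp add: integrable_integral)
  from has_integral_affinity'[OF this, of 1 "of_int n"]
  have "((\<lambda>x. gauss t (of_real x + of_int n) * wave k x) has_integral
     integral {of_int n - 1/2..of_int n + 1/2} (\<lambda>x. gauss t (of_real x) * wave k x)) {-1/2..1/2}"
    by (simp add: wave_shift)
  then show ?thesis by (rule integral_unique)
qed

text \<open>The translates of the unit interval by the integers from \<open>-M\<close> to
  \<open>M - 1\<close> tile the range on the right; it is not symmetric because of the pairing of m
  with -m-1.\<close>

lemma gauss_pair_integral_sum:
  "integral {-1/2..1/2} (\<lambda>x. (\<Sum>m<M. gauss_pair t m (of_real x)) * wave k x) =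
   integral {- real M - 1/2..real M - 1/2} (\<lambda>x. gauss t (of_real x) * wave k x)"
proof (induction M)
  case (Suc M)
  let ?f = "\<lambda>x. gauss t (of_real x) * wave k x"
  have c: "continuous_on A (\<lambda>x::real. gauss t (of_real x + c))" for A c
    unfolding gauss_def by (intro continuous_intros)
  have "integral {-1/2..1/2} (\<lambda>x. (\<Sum>m<Suc M. gauss_pair t m (of_real x)) * wave k x) =
    integral {-1/2..1/2} (\<lambda>x. (\<Sum>m<M. gauss_pair t m (of_real x)) * wave k x
      + (gauss t (of_real x + of_int (int M)) * wave k x + gauss t (of_real x + of_int (- int M - 1)) * wave k x))"
    by (rule integral_cong) (simp add: gauss_pair_def algebra_simps)
  also have "\<dots> = integral {-1/2..1/2} (\<lambda>x. (\<Sum>m<M. gauss_pair t m (of_real x)) * wave k x)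
      + (integral {-1/2..1/2} (\<lambda>x. gauss t (of_real x + of_int (int M)) * wave k x)
      + integral {-1/2..1/2} (\<lambda>x. gauss t (of_real x + of_int (- int M - 1)) * wave k x))"
  proof -
    have i: "(\<lambda>x. gauss t (of_real x + c) * wave k x) integrable_on {-1/2..1/2}" for c
      by (intro integrable_continuous_real continuous_intros continuous_wave c)
    have "(\<lambda>x. (\<Sum>m<M. gauss_pair t m (of_real x)) * wave k x) integrable_on {-1/2..1/2}"
      unfolding gauss_pair_def gauss_def
      by (intro integrable_continuous_real continuous_intros continuous_wave)
    then show ?thesis using i by (simp only: integral_add integrable_add)
  qed
  also have "\<dots> = integral {- real M - 1/2..real M - 1/2} ?f
      + (integral {real M - 1/2..real M + 1/2} ?f + integral {- real M - 1 - 1/2..- real M - 1 + 1/2} ?f)"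
    unfolding Suc gauss_shift_integral by simp
  also have "\<dots> = integral {- real M - 1 - 1/2..real M + 1/2} ?f"
  proof -
    have e: "- real M - 1 + 1/2 = - real M - 1/2" by simp
    have 1: "integral {- real M - 1 - 1/2..- real M - 1/2} ?f + integral {- real M - 1/2..real M + 1/2} ?f =
        integral {- real M - 1 - 1/2..real M + 1/2} ?f"
      by (rule Henstock_Kurzweil_Integration.integral_combine) (auto intro!: gauss_wave_integrable)
    have 2: "integral {- real M - 1/2..real M - 1/2} ?f + integral {real M - 1/2..real M + 1/2} ?f =
        integral {- real M - 1/2..real M + 1/2} ?f"
      by (cases "M = 0", simp, rule Henstock_Kurzweil_Integration.integral_combine) (auto intro!: gauss_wave_integrable)
    show ?thesis unfolding e 1[symmetric] 2[symmetric] by (simp only: add_ac)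
  qed
  finally show ?case by (simp add: algebra_simps)
qed auto

text \<open>The substitution x = c y turns the Gaussian into the standard normal density, up to a
  constant, and the transform into the known characteristic function of that distribution.\<close>

lemma gauss_fourier:
  assumes t: "t > 0"
  shows "integrable lborel (\<lambda>x. gauss t (of_real x) * wave k x)"
    and "integral\<^sup>L lborel (\<lambda>x. gauss t (of_real x) * wave k x) = of_real (exp (- pi * (of_int k)\<^sup>2 / t) / sqrt t)"
proof -
  let ?f = "\<lambda>x. gauss t (of_real x) * wave k x"
  define c where "c = 1 / sqrt (2 * pi * t)"
  have c: "c > 0" using t by (simp add: c_def)
  define s where "s = - 2 * pi * of_int k * c"
  have tc: "t * c\<^sup>2 = 1 / (2 * pi)" using t by (simp add: c_def power_divide)
  have f: "?f (0 + c * y) = of_real (sqrt (2 * pi)) * (std_normal_density y *\<^sub>R iexp (s * y))" for y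
  proof -
    have e: "pi * t * (c * y)\<^sup>2 = y\<^sup>2 / 2" using tc by (simp add: power_mult_distrib field_simps)
    have "gauss t (of_real (c * y)) = exp (of_real (- (pi * t * (c * y)\<^sup>2)))"
      by (simp add: gauss_def)
    then have "gauss t (of_real (c * y)) = of_real (exp (- y\<^sup>2 / 2))"
      unfolding e by (simp flip: exp_of_real)
    moreover have "wave k (c * y) = iexp (s * y)"
      unfolding wave_def s_def by (rule arg_cong[where f = exp]) (simp add: algebra_simps)
    ultimately show ?thesis
      by (simp add: std_normal_density_def scaleR_conv_of_real)
  qed
  have int: "integrable lborel (\<lambda>y. std_normal_density y *\<^sub>R iexp (s * y))"
  proof -
    interpret prob_space std_normal_distribution by (rule prob_space_normal_density) simp
    have "complex_integrable std_normal_distribution (\<lambda>y. iexp (s * y))"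
      by (rule integrable_iexp) auto
    then show ?thesis by (subst (asm) integrable_density) auto
  qed
  then have "integrable lborel (\<lambda>y. ?f (0 + c * y))" unfolding f by (rule integrable_mult_right)
  then show "integrable lborel ?f"
    using lborel_integrable_real_affine_iff[of c ?f 0] c by simp
  have "integral\<^sup>L lborel ?f = \<bar>c\<bar> *\<^sub>R (LBINT y. ?f (0 + c * y))"
    using c by (intro lborel_integral_real_affine) auto
  also have "(LBINT y. ?f (0 + c * y)) = of_real (sqrt (2 * pi)) * (LBINT y. std_normal_density y *\<^sub>R iexp (s * y))"
    unfolding f by (rule integral_mult_right_zero)
  also have "(LBINT y. std_normal_density y *\<^sub>R iexp (s * y)) = char std_normal_distribution s"
    unfolding char_def by (subst integral_density) auto
  also have "\<dots> = of_real (exp (- s\<^sup>2 / 2))" by (simp add: char_std_normal_distribution)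
  also have "- s\<^sup>2 / 2 = - pi * (of_int k)\<^sup>2 / t"
    unfolding s_def c_def using t by (simp add: power_mult_distrib power_divide field_simps power2_eq_square)
  finally show "integral\<^sup>L lborel ?f = of_real (exp (- pi * (of_int k)\<^sup>2 / t) / sqrt t)"
    using c t by (simp add: c_def scaleR_conv_of_real real_sqrt_mult)
qed


lemma gauss_per_continuous: "t > 0 \<Longrightarrow> continuous_on A (\<lambda>x::real. gauss_per t (of_real x))"
  by (rule continuous_on_compose2[OF holomorphic_on_imp_continuous_on[OF gauss_per_holomorphic]])
    (auto intro!: continuous_intros)

text \<open>The integrals of the partial sums have two limits: by uniform convergence the
  coefficient of the periodization, and by dominated convergence the Fourier integral over the whole
  line.\<close>

lemma gauss_per_coeff:
  assumes t: "t > 0"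
  shows "integral {-1/2..1/2} (\<lambda>x. gauss_per t (of_real x) * wave k x) =
    of_real (exp (- pi * (of_int k)\<^sup>2 / t) / sqrt t)"
proof -
  let ?I = "{-1/2..1/2::real}"
  let ?f = "\<lambda>x. gauss t (of_real x) * wave k x" and ?A = "\<lambda>M. {- real M - 1/2..real M - 1/2}"
  have "uniform_limit ?I (\<lambda>M x. \<Sum>m<M. gauss_pair t m (of_real x)) (\<lambda>x. gauss_per t (of_real x)) sequentially"
    by (rule uniform_limit_compose'[OF gauss_per_uniform[OF t, of 1]]) auto
  moreover have "bounded ((\<lambda>x. gauss_per t (of_real x)) ` ?I)" "bounded (wave k ` ?I)"
    by (intro compact_imp_bounded compact_continuous_image gauss_per_continuous continuous_wave t; simp)+
  ultimately have "uniform_limit ?I (\<lambda>M x. (\<Sum>m<M. gauss_pair t m (of_real x)) * wave k x)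
     (\<lambda>x. gauss_per t (of_real x) * wave k x) sequentially"
    by (intro uniform_lim_mult uniform_limit_const)
  moreover have "continuous_on ?I (\<lambda>x. (\<Sum>m<M. gauss_pair t m (of_real x)) * wave k x)" for M
    unfolding gauss_pair_def gauss_def by (intro continuous_intros continuous_wave)
  ultimately obtain I J where I: "\<And>M. ((\<lambda>x. (\<Sum>m<M. gauss_pair t m (of_real x)) * wave k x) has_integral I M) ?I"
    and J: "((\<lambda>x. gauss_per t (of_real x) * wave k x) has_integral J) ?I" and "I \<longlonglongrightarrow> J"
    using uniform_limit_integral[OF _ _ sequentially_bot] by blast
  have I_eq: "I = (\<lambda>M. integral (?A M) ?f)"
    by (rule ext) (rule trans[OF integral_unique[OF I, symmetric] gauss_pair_integral_sum])
  have 1: "(\<lambda>M. integral (?A M) ?f) \<longlonglongrightarrow> J"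
    using \<open>I \<longlonglongrightarrow> J\<close> by (simp only: I_eq)
  have "(\<lambda>M. integral\<^sup>L lborel (\<lambda>x. indicator (?A M) x *\<^sub>R ?f x)) \<longlonglongrightarrow> integral\<^sup>L lborel ?f"
  proof (rule integral_dominated_convergence)
    show "integrable lborel (\<lambda>x. norm (?f x))"
      using gauss_fourier(1)[OF t] by (rule integrable_norm)
    show "AE x in lborel. (\<lambda>M. indicator (?A M) x *\<^sub>R ?f x) \<longlonglongrightarrow> ?f x"
    proof (intro AE_I2)
      fix x
      have "eventually (\<lambda>M. indicator (?A M) x *\<^sub>R ?f x = ?f x) sequentially"
        using eventually_ge_at_top[of "nat \<lceil>\<bar>x\<bar> + 1\<rceil>"]
      proof eventually_elim
        case (elim M)
        then have "x \<in> ?A M"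
          unfolding nat_ceiling_le_eq by (auto simp: abs_le_iff)
        then show ?case by simp
      qed
      then show "(\<lambda>M. indicator (?A M) x *\<^sub>R ?f x) \<longlonglongrightarrow> ?f x"
        by (rule tendsto_eventually)
    qed
    show "?f \<in> borel_measurable lborel" using gauss_fourier(1)[OF t] by (rule borel_measurable_integrable)
    then show "(\<lambda>x. indicator (?A M) x *\<^sub>R ?f x) \<in> borel_measurable lborel" for M
      by measurable
  qed (auto simp: indicator_def)
  moreover have "integral\<^sup>L lborel (\<lambda>x. indicator (?A M) x *\<^sub>R ?f x)
     = integral (?A M) ?f" for M
    using set_borel_integral_eq_integral(2)[of "?A M" ?f]
      integrable_mult_indicator[OF _ gauss_fourier(1)[OF t], of "?A M"]
    by (simp add: set_integrable_def set_lebesgue_integral_def)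
  ultimately have "(\<lambda>M. integral (?A M) ?f) \<longlonglongrightarrow> integral\<^sup>L lborel ?f" by simp
  then have "J = integral\<^sup>L lborel ?f" using 1 LIMSEQ_unique by blast
  then show ?thesis using integral_unique[OF J] gauss_fourier(2)[OF t] by simp
qed

lemma norm_wave [simp]: "norm (wave k x) = 1"
  unfolding wave_def norm_exp_eq_Re by simp

lemma wave_mult: "wave j x * wave k x = wave (j + k) x"
  unfolding wave_def exp_add[symmetric] by (rule arg_cong[where f = exp]) (simp add: algebra_simps)

lemma wave_0 [simp]: "wave 0 x = 1" by (simp add: wave_def)

lemma wave_has_vector_derivative:
  "(wave k has_vector_derivative - 2 * of_real pi * \<i> * of_int k * wave k x) (at x within A)"
  unfolding wave_def[abs_def]
  by (auto intro!: derivative_eq_intros has_vector_derivative_real_field simp: algebra_simps)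

text \<open>One integration by parts gains the factor 1/k. \<open>F\<close> is not assumed periodic,
  so the boundary terms stay; they are merely bounded.\<close>

lemma riemann_lebesgue_wave:
  assumes F: "F holomorphic_on ball 0 1"
  shows "\<exists>C. \<forall>k. k \<noteq> 0 \<longrightarrow> norm (integral {-1/2..1/2} (\<lambda>x. F (of_real x) * wave k x)) \<le> C / \<bar>of_int k\<bar>"
proof -
  let ?I = "{-1/2..1/2::real}"
  have sub: "of_real ` ?I \<subseteq> ball (0::complex) 1" by auto
  have "continuous_on ?I (\<lambda>x. G (of_real x))" if "G holomorphic_on ball 0 1" for G :: "complex \<Rightarrow> complex"
    by (rule continuous_on_compose2[OF holomorphic_on_imp_continuous_on[OF that] _ sub]) (intro continuous_intros)
  note c = this[OF F] this[OF holomorphic_deriv[OF F open_ball]]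
  obtain B where "\<forall>y\<in>(\<lambda>x. F (of_real x)) ` ?I. norm y \<le> B"
    using compact_imp_bounded[OF compact_continuous_image[OF c(1)]] unfolding bounded_iff by blast
  then have B: "norm (F (of_real x)) \<le> B" if "x \<in> ?I" for x
    using that by blast
  obtain B' where "\<forall>y\<in>(\<lambda>x. deriv F (of_real x)) ` ?I. norm y \<le> B'"
    using compact_imp_bounded[OF compact_continuous_image[OF c(2)]] unfolding bounded_iff by blast
  then have B': "norm (deriv F (of_real x)) \<le> B'" if "x \<in> ?I" for x
    using that by blast
  have "norm (integral ?I (\<lambda>x. F (of_real x) * wave k x)) \<le> (2 * B + B') / (2 * pi) / \<bar>of_int k\<bar>" if "k \<noteq> 0" for k
  proof -
    define a where "a = - 2 * of_real pi * \<i> * of_int k"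
    define A where "A = integral ?I (\<lambda>x. F (of_real x) * wave k x)"
    let ?J = "F (of_real (1/2)) * wave k (1/2) - F (of_real (-1/2)) * wave k (-1/2)"
    define D where "D = integral ?I (\<lambda>x. deriv F (of_real x) * wave k x)"
    have dF: "((\<lambda>x. F (of_real x)) has_vector_derivative deriv F (of_real x)) (at x within ?I)" if "x \<in> ?I" for x
      using that F by (intro has_vector_derivative_real_field holomorphic_derivI[of F "ball 0 1"]) auto
    have "((\<lambda>x. F (of_real x) * (a * wave k x) + deriv F (of_real x) * wave k x) has_integral
       ?J) ?I"
      unfolding a_def
      by (rule fundamental_theorem_of_calculus, simp)
        (rule has_vector_derivative_mult[OF dF wave_has_vector_derivative])
    moreover have "((\<lambda>x. F (of_real x) * (a * wave k x) + deriv F (of_real x) * wave k x) has_integral a * A + D) ?I"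
    proof (intro has_integral_add)
      have "((\<lambda>x. a * (F (of_real x) * wave k x)) has_integral a * A) ?I"
        unfolding A_def by (intro has_integral_mult_right integrable_integral integrable_continuous_real continuous_intros c continuous_wave)
      then show "((\<lambda>x. F (of_real x) * (a * wave k x)) has_integral a * A) ?I" by (simp add: mult_ac)
      show "((\<lambda>x. deriv F (of_real x) * wave k x) has_integral D) ?I"
        unfolding D_def by (intro integrable_integral integrable_continuous_real continuous_intros c continuous_wave)
    qed
    ultimately have "?J = a * A + D"
      by (rule has_integral_unique)
    then have e: "a * A = ?J - D"
      by simp
    have "norm D \<le> B' * (1/2 - - 1/2)"
      unfolding D_def using B'
      by (intro integral_bound continuous_intros c continuous_wave) (auto simp: norm_mult)
    then have "norm D \<le> B'" by simp
    moreover have "norm (?J) \<le> B + B"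
      using B[of "1/2"] B[of "-1/2"] by (intro norm_triangle_le_diff add_mono) (auto simp: norm_mult)
    ultimately have "norm (a * A) \<le> 2 * B + B'"
      unfolding e using norm_triangle_ineq4[of "?J" D] by linarith
    moreover have "norm (a * A) = 2 * pi * \<bar>of_int k\<bar> * norm A" by (simp add: a_def norm_mult)
    ultimately show ?thesis using that unfolding A_def[symmetric] by (simp add: field_simps)
  qed
  then show ?thesis by blast
qed

text \<open>The Dirichlet kernel over the frequencies from \<open>-N\<close> to
  \<open>N - 1\<close>: multiplication by \<open>1 - wave 1 x\<close> telescopes it.\<close>

lemma wave_kernel:
  "(1 - wave 1 x) * (\<Sum>k<N. wave (int k) x + wave (- int k - 1) x) = wave (- int N) x - wave (int N) x"
proof (induction N)
  case (Suc N)
  have "(1 - wave 1 x) * (wave (int N) x + wave (- int N - 1) x) =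
      wave (int N) x - wave (1 + int N) x + wave (- int N - 1) x - wave (1 + (- int N - 1)) x"
    unfolding wave_mult[symmetric] by (simp add: algebra_simps)
  moreover have "- int (Suc N) = - int N - 1" "int (Suc N) = 1 + int N" by auto
  ultimately show ?case using Suc by (simp only: sum.lessThan_Suc distrib_left) simp
qed simp

lemma wave_integral: "integral {-1/2..1/2} (wave k) = (if k = 0 then 1 else 0)"
proof (cases "k = 0")
  case False
  define a where "a = - 2 * of_real pi * \<i> * of_int k"
  have a: "a \<noteq> 0" using False by (simp add: a_def)
  have "((\<lambda>x. a * wave k x) has_integral wave k (1/2) - wave k (-1/2)) {-1/2..1/2}"
    unfolding a_def by (rule fundamental_theorem_of_calculus, simp) (rule wave_has_vector_derivative)
  from has_integral_mult_right[OF this, of "1/a"]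
  have "(wave k has_integral 1/a * (wave k (1/2) - wave k (-1/2))) {-1/2..1/2}" using a by simp
  moreover have "wave k (1/2) = wave k (-1/2)" using wave_shift[of k "-1/2" 1] by simp
  ultimately show ?thesis using False by (auto dest: integral_unique)
qed (auto simp: wave_0[abs_def])

text \<open>Dirichlet's argument at the point \<open>0\<close>: with \<open>F\<close> the quotient of \<open>gauss_per t u - gauss_per t 0\<close> by
  \<open>1 - wave 1 u\<close>, a partial sum of the Fourier series differs from its limit by a high Fourier
  coefficient of \<open>F\<close>.\<close>

theorem poisson_gauss:
  assumes t: "t > 0"
  shows "(\<lambda>k. of_real (exp (- pi * (of_int (int k))\<^sup>2 / t) / sqrt t)
            + of_real (exp (- pi * (of_int (- int k - 1))\<^sup>2 / t) / sqrt t)) sums gauss_per t 0"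
proof -
  let ?I = "{-1/2..1/2::real}" and ?g = "gauss_per t"
  let ?c = "\<lambda>k. complex_of_real (exp (- pi * (of_int k)\<^sup>2 / t) / sqrt t)"
  let ?S = "\<lambda>N. \<Sum>k<N. ?c (int k) + ?c (- int k - 1)"
  let ?K = "\<lambda>N x. \<Sum>k<N. wave (int k) x + wave (- int k - 1) x"
  \<comment> \<open>\<open>g1\<close> and \<open>e1\<close> are difference quotients at 0 of the
    numerator and the denominator of \<open>F\<close>, completed by the derivatives. As
    \<open>E\<close> vanishes only at integers and to first order at 0, their quotient is
    holomorphic on the whole disc.\<close>
  define g1 where "g1 u = (if u = 0 then deriv ?g 0 else (?g u - ?g 0) / (u - 0))" for u
  define E where "E u = 1 - exp (- 2 * of_real pi * \<i> * u)" for u :: complex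
  define e1 where "e1 u = (if u = 0 then deriv E 0 else (E u - E 0) / (u - 0))" for u
  have g1: "g1 holomorphic_on ball 0 1"
    unfolding g1_def[abs_def]
    by (rule pole_lemma_open[OF holomorphic_on_subset[OF gauss_per_holomorphic[OF t]]]) auto
  have e1: "e1 holomorphic_on ball 0 1"
    unfolding e1_def[abs_def] by (rule pole_lemma_open) (auto simp: E_def[abs_def] intro!: holomorphic_intros)
  have "(E has_field_derivative 2 * of_real pi * \<i>) (at 0)"
    unfolding E_def[abs_def] by (auto intro!: derivative_eq_intros)
  then have "deriv E 0 \<noteq> 0" by (simp add: DERIV_imp_deriv)
  moreover have "E u \<noteq> 0" if "u \<noteq> 0" "norm u < 1" for u
  proof
    assume "E u = 0"
    then have "exp (- 2 * of_real pi * \<i> * u) = 1" by (simp add: E_def)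
    then obtain n :: int where "- 2 * of_real pi * \<i> * u = of_real (of_int (2 * n) * pi) * \<i>"
      unfolding exp_eq_1 by (auto simp: complex_eq_iff)
    from arg_cong[OF this, of uminus]
    have "(2 * of_real pi * \<i>) * u = (2 * of_real pi * \<i>) * (- of_int n)" by (simp add: mult_ac)
    then have "u = - of_int n" by (subst (asm) mult_cancel_left) simp
    then have "\<bar>real_of_int n\<bar> < 1" "n \<noteq> 0" using that by auto
    then show False by linarith
  qed
  ultimately have e1nz: "e1 u \<noteq> 0" if "u \<in> ball 0 1" for u
    using that by (auto simp: e1_def E_def)
  define F where "F u = g1 u / e1 u" for u
  have F: "F holomorphic_on ball 0 1"
    unfolding F_def[abs_def] using e1nz by (intro holomorphic_intros g1 e1) auto
  have FE: "F u * E u = ?g u - ?g 0" if "u \<in> ball 0 1" for u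
    using that e1nz[of u] by (cases "u = 0") (auto simp: F_def g1_def e1_def E_def divide_simps)
  have EW: "E (of_real x) = 1 - wave 1 x" for x by (simp add: E_def wave_def)
  obtain C where C: "\<And>k. k \<noteq> 0 \<Longrightarrow> norm (integral ?I (\<lambda>x. F (of_real x) * wave k x)) \<le> C / \<bar>of_int k\<bar>"
    using riemann_lebesgue_wave[OF F] by blast
  have contF: "continuous_on ?I (\<lambda>x. F (of_real x))"
    by (rule continuous_on_compose2[of "ball 0 1"])
      (auto intro!: holomorphic_on_imp_continuous_on F continuous_intros)
  have key: "norm (?S N - ?g 0) \<le> 2 * C / real N" if N: "N > 0" for N
  proof -
    have cK: "continuous_on ?I (?K N)" by (intro continuous_intros continuous_wave)
    have iK: "integral ?I (?K N) = 1"
    proof -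
      have "integral ?I (?K N) = (\<Sum>k<N. integral ?I (wave (int k)) + integral ?I (wave (- int k - 1)))"
        by (subst integral_sum)
          (auto intro!: sum.cong integral_add integrable_continuous_real continuous_intros continuous_wave)
      also have "\<dots> = (\<Sum>k<N. if k = 0 then 1 else 0)"
        unfolding wave_integral by (intro sum.cong) auto
      finally show ?thesis using N by simp
    qed
    have "?S N = integral ?I (\<lambda>x. ?g (of_real x) * ?K N x)"
      unfolding gauss_per_coeff[OF t, symmetric] sum_distrib_left distrib_left
      by (subst integral_sum)
        (auto intro!: sum.cong integral_add[symmetric] integrable_continuous_real continuous_intros continuous_wave gauss_per_continuous t)
    \<comment> \<open>The kernel has integral 1, so the constant may be moved under the integral,
      where the difference with \<open>gauss_per t\<close> is divisible by \<open>E\<close>.\<close>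
    moreover have "?g 0 = integral ?I (\<lambda>x. ?g 0 * ?K N x)" using iK by simp
    ultimately have "?S N - ?g 0 =
        integral ?I (\<lambda>x. ?g (of_real x) * ?K N x - ?g 0 * ?K N x)"
      by (subst integral_diff)
        (auto intro!: integrable_continuous_real continuous_intros continuous_wave gauss_per_continuous t)
    also have "\<dots> = integral ?I (\<lambda>x. F (of_real x) * wave (- int N) x - F (of_real x) * wave (int N) x)"
    proof (rule integral_cong)
      fix x assume "x \<in> ?I"
      then have "of_real x \<in> ball (0::complex) 1" by auto
      have "?g (of_real x) * ?K N x - ?g 0 * ?K N x = F (of_real x) * ((1 - wave 1 x) * ?K N x)"
        unfolding left_diff_distrib[symmetric] FE[OF \<open>of_real x \<in> ball 0 1\<close>, symmetric] EW
        by (rule mult.assoc)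
      then show "?g (of_real x) * ?K N x - ?g 0 * ?K N x = F (of_real x) * wave (- int N) x - F (of_real x) * wave (int N) x"
        unfolding wave_kernel by (simp add: right_diff_distrib)
    qed
    also have "\<dots> = integral ?I (\<lambda>x. F (of_real x) * wave (- int N) x) - integral ?I (\<lambda>x. F (of_real x) * wave (int N) x)"
      by (intro integral_diff integrable_continuous_real continuous_intros contF continuous_wave)
    also have "norm \<dots> \<le> C / real N + C / real N"
      using C[of "- int N"] C[of "int N"] N by (intro norm_triangle_le_diff add_mono) auto
    finally show ?thesis by simp
  qed
  have "(\<lambda>N. ?S N - ?g 0) \<longlonglongrightarrow> 0"
  proof (rule Lim_null_comparison)
    show "eventually (\<lambda>N. norm (?S N - ?g 0) \<le> 2 * C / real N) sequentially"
      using eventually_gt_at_top[of 0] by eventually_elim (rule key)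
    show "(\<lambda>N. 2 * C / real N) \<longlonglongrightarrow> 0"
      by (rule lim_const_over_n)
  qed
  then show ?thesis unfolding sums_def by (simp add: LIM_zero_iff)
qed

section \<open>Inversion of theta functions and of the Weber function\<close>

abbreviation upper_half :: "complex set" where "upper_half \<equiv> {z. Im z > 0}"

definition nome :: "complex \<Rightarrow> complex" where "nome z = exp (of_real pi * \<i> * z)"
definition th3 :: "complex \<Rightarrow> complex" where "th3 z = theta4 (- nome z)"
definition th4 :: "complex \<Rightarrow> complex" where "th4 z = theta4 (nome z)"
text \<open>The second theta function in product form; writing \<open>nome (z / 4)\<close> fixes the
  branch of the fourth root of the nome.\<close>

definition th2 :: "complex \<Rightarrow> complex" where
  "th2 z = 2 * nome (z / 4) * (qE (nome (2 * z)) * qU (nome (2 * z)) ^ 2)"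
text \<open>The reciprocal of Weber's function \<open>f\<close>.\<close>

definition weber :: "complex \<Rightarrow> complex" where "weber z = nome (z / 24) * qU (- nome z)"

lemma open_upper_half: "open upper_half" by (rule open_halfspace_Im_gt)
lemma connected_upper_half: "connected upper_half"
  by (intro convex_connected convex_halfspace_Im_gt)

lemma nome_nz [simp]: "nome z \<noteq> 0" by (simp add: nome_def)
lemma norm_nome: "norm (nome z) = exp (- pi * Im z)" by (simp add: nome_def norm_exp_eq_Re)
lemma norm_nome_less_1: "Im z > 0 \<Longrightarrow> norm (nome z) < 1" by (simp add: norm_nome)
lemma nome_add: "nome (z + w) = nome z * nome w" by (simp add: nome_def distrib_left exp_add)
lemma nome_power: "nome z ^ n = nome (of_nat n * z)"
  by (simp add: nome_def exp_of_nat_mult[symmetric] mult_ac)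
lemma nome_1: "nome 1 = -1" by (simp add: nome_def)
lemma nome_2: "nome 2 = 1" using nome_add[of 1 1] by (simp add: nome_1)
lemma nome_holomorphic [holomorphic_intros]: "f holomorphic_on A \<Longrightarrow> (\<lambda>z. nome (f z)) holomorphic_on A"
  unfolding nome_def by (intro holomorphic_intros)

lemma th3_shift: "th3 (z + 1) = th4 z" and th4_shift: "th4 (z + 1) = th3 z"
  by (simp_all add: th3_def th4_def nome_add nome_1)
lemma th3_shift2: "th3 (z + 2) = th3 z" 
  by (simp add: th3_def nome_add nome_2)
lemma th2_shift: "th2 (z + 1) = nome (1 / 4) * th2 z"
proof -
  have "nome (2 * (z + 1)) = nome (2 * z)" by (simp add: distrib_left nome_add nome_2)
  then show ?thesis by (simp add: th2_def add_divide_distrib nome_add)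
qed
lemma weber_shift2: "weber (z + 2) = nome (1 / 12) * weber z"
  by (simp add: weber_def add_divide_distrib nome_add nome_2)

lemma holomorphic_disc_compose:
  assumes "g holomorphic_on ball 0 1" "f holomorphic_on A" "\<And>z. z \<in> A \<Longrightarrow> norm (f z) < 1"
  shows "(\<lambda>z. g (f z)) holomorphic_on A"
  using holomorphic_on_compose_gen[OF assms(2,1)] assms(3) by (simp add: o_def image_subset_iff)

lemma th3_holomorphic: "th3 holomorphic_on upper_half"
  unfolding th3_def[abs_def]
  by (rule holomorphic_disc_compose[OF theta4_holomorphic]) (auto intro!: holomorphic_intros simp: norm_nome_less_1)

lemma weber_holomorphic: "weber holomorphic_on upper_half"
  unfolding weber_def[abs_def]
  by (intro holomorphic_intros holomorphic_disc_compose[OF qU_holomorphic]) (auto simp: norm_nome_less_1)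

lemma th3_nz: "Im z > 0 \<Longrightarrow> th3 z \<noteq> 0" and th2_nz: "Im z > 0 \<Longrightarrow> th2 z \<noteq> 0" and weber_nz: "Im z > 0 \<Longrightarrow> weber z \<noteq> 0"
  by (simp_all add: th3_def th2_def weber_def theta4_nz qE_nz qU_nz norm_nome_less_1)

text \<open>Even and odd indices of the series at \<open>z / 4\<close>.\<close>

lemma th3_quarter: 
  assumes "Im z > 0"
  shows "th3 (z / 4) = th3 z + th2 z"
proof -
  have "norm (nome (z / 4)) < 1" using assms by (intro norm_nome_less_1) simp
  from theta4_dissect[OF this nome_nz] show ?thesis
    unfolding nome_power by (simp add: th3_def th2_def)
qed

text \<open>Four unit shifts preserve \<open>th3\<close> and change the sign of \<open>th2\<close>,
  so \<open>th4 z\<close> is \<open>th3 (4 * z) - th2 (4 * z)\<close>, while \<open>th3 z\<close> is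
  the sum. Thus \<open>th2\<close> and \<open>th4\<close> are both expressible by
  \<open>th3\<close>, and one inversion formula yields all three.\<close>

lemma th4_conv_th3:
  assumes "Im z > 0"
  shows "th4 z = 2 * th3 (4 * z) - th3 z"
proof -
  have z4: "Im (4 * z) > 0" "Im (4 * (z + 1)) > 0" using assms by auto
  have 4: "4 * (z + 1) = 4 * z + 1 + 1 + 1 + 1" by simp
  have "th4 z = th3 (z + 1)" by (simp add: th3_shift)
  also have "\<dots> = th3 (4 * (z + 1)) + th2 (4 * (z + 1))"
  proof -
    have "4 * (z + 1) / 4 = z + 1" by simp
    then show ?thesis using th3_quarter[OF z4(2)] by (simp only:)
  qed
  also have "th3 (4 * (z + 1)) = th3 (4 * z)" unfolding 4 th3_shift th4_shift ..
  also have "th2 (4 * (z + 1)) = nome (1 / 4) ^ 4 * th2 (4 * z)"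
    unfolding 4 th2_shift by (simp add: power4_eq_xxxx mult_ac)
  also have "nome (1 / 4) ^ 4 = -1" unfolding nome_power by (simp add: nome_1)
  finally show ?thesis using th3_quarter[OF z4(1)] by simp
qed

lemma Im_minus_inverse: "Im z > 0 \<Longrightarrow> Im (- (1 / z)) > 0"
  by (simp add: Im_divide) (metis divide_pos_pos less_irrefl not_sum_power2_lt_zero linorder_neqE_linordered_idom sum_power2_eq_zero_iff)

lemma csqrt_times_4: "csqrt (4 * w) = 2 * csqrt w"
  by (rule csqrt_unique) (use csqrt_principal[of w] in \<open>auto simp: power_mult_distrib\<close>)

lemma csqrt_power_4: "csqrt (- \<i> * z) ^ 4 = - (z ^ 2)"
proof -
  have "csqrt (- \<i> * z) ^ 4 = (csqrt (- \<i> * z) ^ 2) ^ 2" unfolding power_mult[symmetric] by simp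
  then show ?thesis by (simp add: power_mult_distrib)
qed

lemma gauss_per_0: "t > 0 \<Longrightarrow> gauss_per t 0 = th3 (\<i> * of_real t)"
proof -
  assume t: "t > 0"
  have n: "nome (\<i> * of_real t) = of_real (exp (- pi * t))"
    by (simp add: nome_def mult_ac flip: exp_of_real)
  have "(\<lambda>k. nome (\<i> * of_real t) ^ (k ^ 2) + nome (\<i> * of_real t) ^ (Suc k ^ 2)) sums th3 (\<i> * of_real t)"
    using theta4_sums_pair[of "- nome (\<i> * of_real t)"] norm_nome_less_1[of "\<i> * of_real t"] t by (simp add: th3_def)
  moreover have "nome (\<i> * of_real t) ^ (k ^ 2) = gauss t (of_nat k)" for k
    unfolding n gauss_def by (simp add: exp_of_nat_mult[symmetric] mult_ac flip: exp_of_real)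
  moreover have "gauss t (of_nat (Suc k)) = gauss t (- of_nat k - 1)" for k
  proof -
    have "(of_nat (Suc k)) ^ 2 = (- of_nat k - 1 :: complex) ^ 2" by (simp add: power2_eq_square algebra_simps)
    then show ?thesis unfolding gauss_def by simp
  qed
  ultimately show ?thesis unfolding gauss_per_def gauss_pair_def by (simp add: sums_iff)
qed

lemma th3_inversion_imag:
  assumes "t > 0"
  shows "th3 (\<i> * of_real (1 / t)) = of_real (sqrt t) * th3 (\<i> * of_real t)"
proof -
  let ?P = "nome (\<i> * of_real (1 / t))"
  have P: "?P = of_real (exp (- pi / t))"
    by (simp add: nome_def mult_ac flip: exp_of_real)
  have "(\<lambda>k. ?P ^ (k ^ 2) + ?P ^ (Suc k ^ 2)) sums th3 (\<i> * of_real (1 / t))"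
    using theta4_sums_pair[of "- ?P"] norm_nome_less_1[of "\<i> * of_real (1 / t)"] assms by (simp add: th3_def)
  from sums_divide[OF this, of "of_real (sqrt t)"]
  have "(\<lambda>k. (?P ^ (k ^ 2) + ?P ^ (Suc k ^ 2)) / of_real (sqrt t)) sums (th3 (\<i> * of_real (1 / t)) / of_real (sqrt t))" .
  moreover have "(?P ^ (k ^ 2) + ?P ^ (Suc k ^ 2)) / of_real (sqrt t) = 
     of_real (exp (- pi * (of_int (int k))\<^sup>2 / t) / sqrt t) + of_real (exp (- pi * (of_int (- int k - 1))\<^sup>2 / t) / sqrt t)" for k
  proof -
    have 1: "?P ^ (j ^ 2) = of_real (exp (- pi * (real j)\<^sup>2 / t))" for j
      unfolding P by (simp add: exp_of_nat_mult[symmetric] mult_ac flip: of_real_power)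
    have "(real_of_int (- int k - 1))\<^sup>2 = (real (Suc k))\<^sup>2" by (simp add: power2_eq_square algebra_simps)
    then show ?thesis unfolding 1 by (simp add: add_divide_distrib del: of_nat_Suc)
  qed
  ultimately have "th3 (\<i> * of_real (1 / t)) / of_real (sqrt t) = gauss_per t 0"
    using poisson_gauss[OF assms] sums_unique2 by simp
  then show ?thesis using gauss_per_0[OF assms] assms by (simp add: field_simps)
qed

lemma csqrt_holomorphic_upper: "(\<lambda>z. csqrt (- \<i> * z)) holomorphic_on upper_half"
  by (intro holomorphic_intros) (auto simp: complex_nonpos_Reals_iff)

text \<open>Poisson summation gives the formula on the imaginary axis, and the identity theorem
  extends it. Since \<open>- \<i> * z\<close> has positive real part, the principal root is
  holomorphic here.\<close>

theorem th3_inversion: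
  assumes "Im z > 0"
  shows "th3 (- (1 / z)) = csqrt (- \<i> * z) * th3 z"
proof -
  define f where "f z = th3 (- (1 / z)) - csqrt (- \<i> * z) * th3 z" for z
  have "(\<lambda>z. th3 (- (1 / z))) holomorphic_on upper_half"
    by (rule holomorphic_on_compose_gen[OF _ th3_holomorphic, unfolded o_def])
      (auto intro!: holomorphic_intros simp: Im_minus_inverse[simplified])
  then have f: "f holomorphic_on upper_half"
    unfolding f_def[abs_def] by (intro holomorphic_intros csqrt_holomorphic_upper th3_holomorphic)
  have lim: "\<i> islimpt ((\<lambda>t. \<i> * of_real t) ` {0<..})"
    unfolding islimpt_approachable
  proof (intro allI impI)
    fix e :: real assume "e > 0"
    then have "\<i> * of_real (1 + e / 2) \<noteq> \<i>" "dist (\<i> * of_real (1 + e / 2)) \<i> < e"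
      by (simp_all add: dist_norm distrib_left norm_mult complex_eq_iff)
    moreover have "\<i> * of_real (1 + e / 2) \<in> (\<lambda>t. \<i> * of_real t) ` {0<..}"
      using \<open>e > 0\<close> by (intro imageI) simp
    ultimately show "\<exists>x'\<in>(\<lambda>t. \<i> * complex_of_real t) ` {0<..}. x' \<noteq> \<i> \<and> dist x' \<i> < e"
      by blast
  qed
  have "f z = 0"
  proof (rule analytic_continuation[OF f open_upper_half connected_upper_half _ _ lim])
    show "(\<lambda>t. \<i> * of_real t) ` {0<..} \<subseteq> upper_half" "\<i> \<in> upper_half" "z \<in> upper_half" using assms by auto
    fix w assume "w \<in> (\<lambda>t. \<i> * complex_of_real t) ` {0<..}"
    then obtain t where t: "t > 0" "w = \<i> * of_real t" by auto
    have "- (1 / w) = \<i> * of_real (1 / t)" using t by (simp add: field_simps)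
    moreover have "csqrt (- \<i> * w) = of_real (sqrt t)" using t by (simp add: csqrt_of_real_nonneg)
    ultimately show "f w = 0" using th3_inversion_imag[OF t(1)] t by (simp add: f_def)
  qed
  then show ?thesis by (simp add: f_def)
qed

lemma th2_inversion:
  assumes "Im z > 0"
  shows "th2 (- (1 / z)) = csqrt (- \<i> * z) * th4 z"
proof -
  have "- (1 / z) / 4 = - (1 / (4 * z))" by simp
  then have "th2 (- (1 / z)) = th3 (- (1 / (4 * z))) - th3 (- (1 / z))"
    using th3_quarter[OF Im_minus_inverse[OF assms]] by (simp only: add_diff_cancel_left')
  also have "th3 (- (1 / (4 * z))) = csqrt (4 * (- \<i> * z)) * th3 (4 * z)"
    using th3_inversion[of "4 * z"] assms by (simp only: mult.left_commute) simp
  also have "csqrt (4 * (- \<i> * z)) = 2 * csqrt (- \<i> * z)"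
    by (rule csqrt_times_4)
  finally show ?thesis
    unfolding th3_inversion[OF assms] th4_conv_th3[OF assms] by (simp add: algebra_simps)
qed

lemma th4_inversion:
  assumes "Im z > 0"
  shows "th4 (- (1 / z)) = csqrt (- \<i> * z) * th2 z"
proof -
  have "4 * (- (1 / z)) = - (1 / (z / 4))" by simp
  then have "th4 (- (1 / z)) = 2 * th3 (- (1 / (z / 4))) - th3 (- (1 / z))"
    using th4_conv_th3[OF Im_minus_inverse[OF assms]] by (simp only:)
  also have "th3 (- (1 / (z / 4))) = csqrt (- \<i> * (z / 4)) * th3 (z / 4)"
    using assms by (intro th3_inversion) simp
  finally show ?thesis
    using csqrt_times_4[of "- \<i> * (z / 4)"]
    unfolding th3_inversion[OF assms] th3_quarter[OF assms] by (simp add: algebra_simps)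
qed

text \<open>Through this relation the inversion of \<open>weber\<close> is inherited from the theta
  functions, up to a sixth root of unity.\<close>

lemma weber_power_6:
  assumes "Im z > 0"
  shows "2 * th3 z ^ 2 * weber z ^ 6 = th2 z * th4 z"
proof -
  define p where "p = nome z"
  have p: "norm p < 1" "norm (-p) < 1" "norm (p ^ 2) < 1"
    using norm_nome_less_1[OF assms] by (auto simp: p_def norm_power power_less_one_iff)
  have p2: "nome (2 * z) = p ^ 2" by (simp add: p_def nome_power)
  have n24: "nome (z / 24) ^ 6 = nome (z / 4)" by (simp add: nome_power)
  note nz = qU_nz[OF p(1)] qU_nz[OF p(2)] qE_nz[OF p(2)] qE_nz[OF p(1)] qE_nz[OF p(3)] qU_nz[OF p(3)]
  have E: "qE p = qE (p ^ 2) / qU p" "qE (-p) = qE (p ^ 2) / qU (-p)" "qU (p ^ 2) = qU p * qU (-p)"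
    using qE_mult_qU[OF p(1)] qE_mult_qU[OF p(2)] qU_mult_qU_minus[OF p(1)] nz by (auto simp: field_simps)
  have gen: "2 * (e / b / b) ^ 2 * (n * b ^ 6) = 2 * n * (e * (a * b) ^ 2) * (e / a / a)"
    if "a \<noteq> 0" "b \<noteq> 0" for a b e n :: complex
    using that by (simp add: field_simps eval_nat_numeral)
  have "2 * (qE (-p) / qU (-p)) ^ 2 * (n * qU (-p) ^ 6) = 2 * n * (qE (p ^ 2) * qU (p ^ 2) ^ 2) * (qE p / qU p)" for n
    unfolding E by (rule gen[OF nz(1,2)])
  from this[of "nome (z / 4)"] show ?thesis
    using p by (simp add: th3_def th2_def th4_def weber_def theta4_product p_def[symmetric] p2 power_mult_distrib n24)
qed

text \<open>The quotient of the two sides is a continuous function with values among the sixth roots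
  of unity, hence constant on the half-plane, and at the fixed point \<open>\<i>\<close> it is
  1.\<close>

theorem weber_inversion:
  assumes "Im z > 0"
  shows "weber (- (1 / z)) = weber z"
proof -
  define g where "g z = weber (- (1 / z)) / weber z" for z
  have "(\<lambda>z. weber (- (1 / z))) holomorphic_on upper_half"
    by (rule holomorphic_on_compose_gen[OF _ weber_holomorphic, unfolded o_def])
      (auto intro!: holomorphic_intros simp: Im_minus_inverse[simplified])
  then have "g holomorphic_on upper_half"
    unfolding g_def[abs_def] by (intro holomorphic_intros weber_holomorphic) (auto simp: weber_nz)
  then have cont: "continuous_on upper_half g" by (rule holomorphic_on_imp_continuous_on)
  have g6: "g w ^ 6 = 1" if "Im w > 0" for w
  proof -
    have s: "csqrt (- \<i> * w) \<noteq> 0" using that by auto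
    have "2 * (csqrt (- \<i> * w) * th3 w) ^ 2 * weber (- (1 / w)) ^ 6 = (csqrt (- \<i> * w) * th4 w) * (csqrt (- \<i> * w) * th2 w)"
      using weber_power_6[OF Im_minus_inverse[OF that]] that
      by (simp only: th2_inversion th3_inversion th4_inversion)
    also have "\<dots> = csqrt (- \<i> * w) ^ 2 * (2 * th3 w ^ 2 * weber w ^ 6)"
      unfolding weber_power_6[OF that] by (simp add: power2_eq_square)
    finally have "weber (- (1 / w)) ^ 6 = weber w ^ 6"
      using s th3_nz[OF that] by (simp add: power_mult_distrib)
    then show ?thesis using weber_nz[OF that] by (simp add: g_def power_divide)
  qed
  have "finite (g ` upper_half)"
    by (rule finite_subset[OF _ finite_roots_unity[of 6]]) (auto simp: g6)
  with continuous_finite_range_constant[OF connected_upper_half cont]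
  obtain c where c: "g w = c" if "Im w > 0" for w unfolding constant_on_def by auto
  have "- (1 / \<i>) = \<i>" by simp
  then have "g \<i> = 1" using weber_nz[of \<i>] by (simp add: g_def)
  then have "g z = 1" using c[of \<i>] c[OF assms] by simp
  then show ?thesis using weber_nz[OF assms] by (simp add: g_def)
qed

section \<open>The theta group\<close>

definition theta_mat :: "int \<Rightarrow> int \<Rightarrow> int \<Rightarrow> int \<Rightarrow> bool" where
  "theta_mat a b c d \<longleftrightarrow> a * d - b * c = 1 \<and>
     ((odd a \<and> even b \<and> even c \<and> odd d) \<or> (even a \<and> odd b \<and> odd c \<and> even d))"

definition mob :: "int \<Rightarrow> int \<Rightarrow> int \<Rightarrow> int \<Rightarrow> complex \<Rightarrow> complex" where
  "mob a b c d z = (of_int a * z + of_int b) / (of_int c * z + of_int d)"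

text \<open>Euclid's algorithm with even quotients on the first column. The translation by a
  multiple of 2 reduces \<open>a\<close> modulo \<open>2 * c\<close>, the inversion then exchanges
  the rows, and the modulus of the lower left entry drops. At \<open>c = 0\<close> only even
  translations and their negatives are left, and minus the identity is the square of the
  inversion.\<close>

lemma theta_group_induct [consumes 1, case_names 1 2 3 4]:
  assumes G: "theta_mat a b c d"
    and I: "P 1 0 0 1"
    and T: "\<And>a b c d. theta_mat a b c d \<Longrightarrow> P a b c d \<Longrightarrow> P (a + 2 * c) (b + 2 * d) c d"
    and T': "\<And>a b c d. theta_mat a b c d \<Longrightarrow> P a b c d \<Longrightarrow> P (a - 2 * c) (b - 2 * d) c d"
    and S: "\<And>a b c d. theta_mat a b c d \<Longrightarrow> P a b c d \<Longrightarrow> P (- c) (- d) a b"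
  shows "P a b c d"
proof -
  have GT: "theta_mat (a + 2 * n * c) (b + 2 * n * d) c d" if "theta_mat a b c d" for a b c d n
    using that by (auto simp: theta_mat_def algebra_simps)
  have GS: "theta_mat (- c) (- d) a b" if "theta_mat a b c d" for a b c d
    using that by (auto simp: theta_mat_def algebra_simps)
  have TN: "P (a + 2 * n * c) (b + 2 * n * d) c d" if "theta_mat a b c d" "P a b c d" for a b c d n
  proof (induction n rule: int_induct[where k = 0])
    case base
    then show ?case using that by simp
  next
    case (step1 i)
    from T[OF GT[OF that(1)] step1(2)] show ?case by (simp add: algebra_simps)
  next
    case (step2 i)
    from T'[OF GT[OF that(1)] step2(2)] show ?case by (simp add: algebra_simps)
  qed
  have GI: "theta_mat 1 0 0 1" by (simp add: theta_mat_def)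
  note S1 = S[OF GI I, simplified]
  have GI': "theta_mat 0 (-1) 1 0" using GS[OF GI] by simp
  note S2 = S[OF GI' S1, simplified]
  have GI2: "theta_mat (-1) 0 0 (-1)" using GS[OF GI'] by simp
  show ?thesis
    using G
  proof (induction "nat \<bar>c\<bar>" arbitrary: a b c d rule: less_induct)
    case less
    show ?case
    proof (cases "c = 0")
      case True
      with less.prems have ad: "a * d = 1" "even b" by (auto simp: theta_mat_def)
      then consider "a = 1" "d = 1" | "a = -1" "d = -1" by (auto simp: zmult_eq_1_iff)
      then show ?thesis
      proof cases
        case 1
        then show ?thesis using TN[OF GI I, of "b div 2"] True ad by simp
      next
        case 2
        then show ?thesis using TN[OF GI2 S2, of "- (b div 2)"] True ad by simp
      qed
    next
      case False
      define r where "r = (a + \<bar>c\<bar>) mod (2 * \<bar>c\<bar>) - \<bar>c\<bar>"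
      define n where "n = sgn c * ((a + \<bar>c\<bar>) div (2 * \<bar>c\<bar>))"
      have "a + \<bar>c\<bar> = 2 * \<bar>c\<bar> * ((a + \<bar>c\<bar>) div (2 * \<bar>c\<bar>)) + (a + \<bar>c\<bar>) mod (2 * \<bar>c\<bar>)"
        by simp
      then have a: "a = r + 2 * n * c"
        unfolding r_def n_def by (simp add: abs_sgn algebra_simps)
      have "0 \<le> (a + \<bar>c\<bar>) mod (2 * \<bar>c\<bar>)" "(a + \<bar>c\<bar>) mod (2 * \<bar>c\<bar>) < 2 * \<bar>c\<bar>"
        using False by auto
      then have r: "- \<bar>c\<bar> \<le> r" "r < \<bar>c\<bar>" unfolding r_def by auto
      define b' where "b' = b - 2 * n * d"
      have G': "theta_mat r b' c d"
        using GT[OF less.prems, of "-n"] by (simp add: a b'_def)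
      \<comment> \<open>The entries of the first column have opposite parity, so the extreme residue
        cannot occur and the descent is strict.\<close>
      then have "r \<noteq> - \<bar>c\<bar>" by (auto simp: theta_mat_def)
      with r have "\<bar>r\<bar> < \<bar>c\<bar>" by auto
      moreover have G'': "theta_mat c d (- r) (- b')"
        using G' by (auto simp: theta_mat_def algebra_simps)
      ultimately have "P c d (- r) (- b')" by (intro less.hyps) auto
      from S[OF G'' this] have "P r b' c d" by simp
      from TN[OF G' this, of n] show ?thesis by (simp add: a b'_def)
    qed
  qed
qed

lemma denom_nz:
  assumes "Im z > 0" "a * d - b * c = (1::int)"
  shows "of_int c * z + of_int d \<noteq> 0"
proof
  assume *: "of_int c * z + of_int d = 0"
  then have "Im (of_int c * z + of_int d) = 0" by (simp only:) simp
  then have "c = 0" using assms by simp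
  with * have "d = 0" by simp
  with \<open>c = 0\<close> assms show False by simp
qed

lemma Im_mob:
  assumes "Im z > 0" "a * d - b * c = (1::int)"
  shows "Im (mob a b c d z) = Im z / (norm (of_int c * z + of_int d))\<^sup>2"
proof -
  have "Im (mob a b c d z) = ((of_int a * Im z) * (of_int c * Re z + of_int d)
      - (of_int a * Re z + of_int b) * (of_int c * Im z)) / (norm (of_int c * z + of_int d))\<^sup>2"
    unfolding mob_def Im_divide cmod_power2 by simp
  also have "(of_int a * Im z) * (of_int c * Re z + of_int d)
      - (of_int a * Re z + of_int b) * (of_int c * Im z) = of_int (a * d - b * c) * Im z"
    by (simp add: algebra_simps)
  finally show ?thesis by (simp add: assms)
qed

lemma Im_mob_pos:
  assumes "Im z > 0" "a * d - b * c = (1::int)"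
  shows "Im (mob a b c d z) > 0"
  unfolding Im_mob[OF assms] using assms denom_nz[OF assms] by simp

lemma mob_shift:
  assumes "Im z > 0" "a * d - b * c = (1::int)"
  shows "mob (a + 2 * c) (b + 2 * d) c d z = mob a b c d z + 2"
    and "mob (a - 2 * c) (b - 2 * d) c d z = mob a b c d z - 2"
  using denom_nz[OF assms] by (simp_all add: mob_def field_simps)

lemma mob_inversion: "mob (- c) (- d) a b z = - (1 / mob a b c d z)"
  by (simp add: mob_def minus_divide_left)

text \<open>The multipliers of \<open>th3 ^ 2\<close> and of \<open>weber\<close>. The latter is a 24th root of unity; since
  \<open>9\<close> is \<open>1\<close> modulo \<open>8\<close> and \<open>0\<close> modulo \<open>3\<close>, while \<open>- 16\<close> is \<open>0\<close> modulo \<open>8\<close> and \<open>- 1\<close> modulo \<open>3\<close>, the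
  two summands of its exponent determine it modulo \<open>8\<close> and modulo \<open>3\<close>.\<close>

definition theta_char :: "int \<Rightarrow> int \<Rightarrow> complex" where
  "theta_char c d = (if c mod 4 = 1 then - \<i> else if c mod 4 = 3 then \<i>
     else if d mod 4 = 1 then 1 else -1)"

definition weber_exp :: "int \<Rightarrow> int \<Rightarrow> int \<Rightarrow> int \<Rightarrow> int" where
  "weber_exp a b c d =
     9 * (if odd a then a * ((b - c) div 2) else c * ((a + d) div 2))
     - 16 * (b * d * (1 - c\<^sup>2) + c * (a + d))"

lemma dvd_24I: "8 dvd x \<Longrightarrow> 3 dvd x \<Longrightarrow> 24 dvd (x::int)"
  by presburger

lemma odd_square_mod_8: "odd (c::int) \<Longrightarrow> 8 dvd c\<^sup>2 - 1"
proof -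
  assume "odd c"
  then obtain k where k: "c = 2 * k + 1" by (elim oddE)
  have "even (k * (k + 1))" by simp
  then obtain j where "k * (k + 1) = 2 * j" by (elim evenE)
  then have "c\<^sup>2 - 1 = 8 * j" unfolding k by (simp add: power2_eq_square algebra_simps)
  then show ?thesis by simp
qed

text \<open>Translation by 2 multiplies \<open>weber\<close> by \<open>nome (1 / 12)\<close>, so the
  exponent has to grow by one modulo 24. This is checked modulo 8 and modulo 3 separately.\<close>

lemma weber_exp_shift:
  assumes "theta_mat a b c d"
  shows "24 dvd weber_exp (a + 2 * c) (b + 2 * d) c d - weber_exp a b c d - 1"
proof (rule dvd_24I)
  define e where "e = (if odd a then a * ((b - c) div 2) else c * ((a + d) div 2))"
  define e' where "e' = (if odd (a + 2 * c) then (a + 2 * c) * ((b + 2 * d - c) div 2) else c * ((a + 2 * c + d) div 2))"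
  have det: "a * d = 1 + b * c" using assms by (auto simp: theta_mat_def)
  have e8: "8 dvd e' - e - 1"
  proof (cases "odd a")
    case True
    with assms obtain b1 c1 where b1: "b = 2 * b1" and c1: "c = 2 * c1" and d: "odd d"
      by (auto simp: theta_mat_def elim!: evenE)
    have "(b - c) div 2 = b1 - c1" "(b + 2 * d - c) div 2 = b1 + d - c1" unfolding b1 c1 by auto
    \<comment> \<open>The first bracket vanishes by the determinant condition, and the last product
      is even because \<open>d\<close> is odd.\<close>
    then have "e' - e - 1 = (a * d - 1 - b * c) + 8 * (b1 * c1) + 4 * (c1 * (d - c1))"
      using True by (simp add: e_def e'_def b1 c1 algebra_simps)
    moreover have "even (c1 * (d - c1))" using d by auto
    then have "4 * 2 dvd 4 * (c1 * (d - c1))" by (intro mult_dvd_mono) auto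
    then have "8 dvd 4 * (c1 * (d - c1))" by simp
    ultimately show ?thesis using det by simp
  next
    case False
    with assms have "odd c" by (auto simp: theta_mat_def)
    moreover have "(a + 2 * c + d) div 2 = (a + d) div 2 + c"
      by (simp add: algebra_simps)
    then have "e' - e - 1 = c\<^sup>2 - 1"
      using False by (simp add: e_def e'_def power2_eq_square algebra_simps)
    ultimately show ?thesis using odd_square_mod_8 by simp
  qed
  have e3: "3 dvd - ((b + 2 * d) * d * (1 - c\<^sup>2) + c * (a + 2 * c + d)) + (b * d * (1 - c\<^sup>2) + c * (a + d)) - 1"
  proof -
    have sq: "3 dvd x\<^sup>2 - 1" if "\<not> 3 dvd x" for x :: int
    proof -
      from that have "x mod 3 = 1 \<or> x mod 3 = 2" by presburger
      then show ?thesis by (auto simp: mod_eq_dvd_iff[symmetric] power_mod[symmetric, of x])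
    qed
    have eq: "- ((b + 2 * d) * d * (1 - c\<^sup>2) + c * (a + 2 * c + d)) + (b * d * (1 - c\<^sup>2) + c * (a + d)) - 1
        = 3 * - (d\<^sup>2 * (1 - c\<^sup>2) + c\<^sup>2) + (d\<^sup>2 * (1 - c\<^sup>2) + (c\<^sup>2 - 1))"
      by (simp add: power2_eq_square algebra_simps)
    have "3 dvd d\<^sup>2 * (1 - c\<^sup>2) + (c\<^sup>2 - 1)"
    proof -
      \<comment> \<open>Modulo 3 the square of a nonmultiple of 3 is 1, and the determinant prevents
        \<open>c\<close> and \<open>d\<close> from both being multiples of 3, so one of the two
        factors vanishes.\<close>
      have "d\<^sup>2 * (1 - c\<^sup>2) + (c\<^sup>2 - 1) = - ((d\<^sup>2 - 1) * (c\<^sup>2 - 1))" by (simp add: algebra_simps)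
      moreover have "\<not> 3 dvd d \<or> \<not> 3 dvd c"
      proof (rule ccontr)
        assume "\<not> (\<not> 3 dvd d \<or> \<not> 3 dvd c)"
        then have "3 dvd a * d - b * c" by (intro dvd_diff dvd_mult) auto
        then show False using det by simp
      qed
      then have "3 dvd (d\<^sup>2 - 1) * (c\<^sup>2 - 1)" using sq by (auto intro: dvd_mult dvd_mult2)
      ultimately show ?thesis by simp
    qed
    from dvd_add[OF dvd_triv_left this] show ?thesis unfolding eq .
  qed
  let ?E = "weber_exp (a + 2 * c) (b + 2 * d) c d - weber_exp a b c d - 1"
  let ?X = "(b + 2 * d) * d * (1 - c\<^sup>2) + c * (a + 2 * c + d)" and ?Y = "b * d * (1 - c\<^sup>2) + c * (a + d)"
  have w: "weber_exp (a + 2 * c) (b + 2 * d) c d = 9 * e' - 16 * ?X" "weber_exp a b c d = 9 * e - 16 * ?Y"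
    by (simp_all only: weber_exp_def e_def e'_def)
  have "?E = (e' - e - 1) + 8 * (e' - e + 1 + 2 * ?Y - 2 * ?X) - 8"
    unfolding w by simp
  moreover have "8 dvd (e' - e - 1) + 8 * (e' - e + 1 + 2 * ?Y - 2 * ?X) - 8"
    by (rule dvd_diff[OF dvd_add[OF e8 dvd_triv_left] dvd_refl])
  ultimately show "8 dvd ?E" by (simp only:)
  have "?E = (- ?X + ?Y - 1) + 3 * (3 * e' - 3 * e + 5 * ?Y - 5 * ?X)"
    unfolding w by simp
  moreover have "3 dvd (- ?X + ?Y - 1) + 3 * (3 * e' - 3 * e + 5 * ?Y - 5 * ?X)"
    by (rule dvd_add[OF e3 dvd_triv_left])
  ultimately show "3 dvd ?E" by (simp only:)
qed

lemma mod3_check: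
  "\<forall>a\<in>{0,1,2::int}. \<forall>b\<in>{0,1,2}. \<forall>c\<in>{0,1,2}. \<forall>d\<in>{0,1,2}. (a * d - b * c) mod 3 = 1 \<longrightarrow>
     (b * d * (2 - a * a - c * c) - a * b + 2 * a * c + c * d) mod 3 = 0"
  by simp

text \<open>The summands with factor 9 agree exactly. What remains is 16 times the polynomial of
  \<open>mod3_check\<close>, so divisibility by 8 is free and divisibility by 3 is a finite check of
  residues.\<close>

lemma weber_exp_inversion:
  assumes "theta_mat a b c d"
  shows "24 dvd weber_exp (- c) (- d) a b - weber_exp a b c d"
proof -
  define e where "e = (if odd a then a * ((b - c) div 2) else c * ((a + d) div 2))"
  define e' where "e' = (if odd (- c) then - c * ((- d - a) div 2) else a * ((- c + b) div 2))"
  have par: "odd c \<longleftrightarrow> even a" "even a \<Longrightarrow> even (a + d)" using assms by (auto simp: theta_mat_def)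
  have ee: "e' = e"
  proof (cases "odd a")
    case True
    then show ?thesis using par by (simp add: e_def e'_def algebra_simps)
  next
    case False
    then have "even (a + d)" using par by blast
    then obtain k where k: "a + d = 2 * k" by (elim dvdE)
    then have "- d - a = 2 * (- k)" by simp
    then have h: "(- d - a) div 2 = - k" "(a + d) div 2 = k" using k by (simp_all only: nonzero_mult_div_cancel_left)
    show ?thesis unfolding e_def e'_def h using False par by simp
  qed
  define X where "X = b * d * (2 - a * a - c * c) - a * b + 2 * a * c + c * d"
  have "3 dvd X"
  proof -
    have "(a * d - b * c) mod 3 = 1" using assms by (simp add: theta_mat_def)
    moreover have "((a mod 3) * (d mod 3) - (b mod 3) * (c mod 3)) mod 3 = (a * d - b * c) mod 3"
      by (intro mod_diff_cong mod_mult_cong mod_mod_trivial)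
    ultimately have h: "((a mod 3) * (d mod 3) - (b mod 3) * (c mod 3)) mod 3 = 1" by (simp only:)
    have m: "x mod 3 \<in> {0,1,2}" for x :: int by auto
    have "((b mod 3) * (d mod 3) * (2 - (a mod 3) * (a mod 3) - (c mod 3) * (c mod 3))
       - (a mod 3) * (b mod 3) + 2 * (a mod 3) * (c mod 3) + (c mod 3) * (d mod 3)) mod 3 = 0"
      by (rule mod3_check[rule_format, OF m m m m h])
    moreover have "((b mod 3) * (d mod 3) * (2 - (a mod 3) * (a mod 3) - (c mod 3) * (c mod 3))
       - (a mod 3) * (b mod 3) + 2 * (a mod 3) * (c mod 3) + (c mod 3) * (d mod 3)) mod 3 = X mod 3"
      unfolding X_def by (intro mod_add_cong mod_diff_cong mod_mult_cong mod_mod_trivial refl)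
    ultimately have "X mod 3 = 0" by (simp only:)
    then show ?thesis by (simp add: dvd_eq_mod_eq_0)
  qed
  moreover have "weber_exp (- c) (- d) a b - weber_exp a b c d = 16 * X"
  proof -
    have "weber_exp (- c) (- d) a b = 9 * e' - 16 * (- d * b * (1 - a\<^sup>2) + a * (- c + b))"
      "weber_exp a b c d = 9 * e - 16 * (b * d * (1 - c\<^sup>2) + c * (a + d))"
      by (simp_all only: weber_exp_def e_def e'_def)
    then show ?thesis unfolding ee X_def by (simp add: power2_eq_square algebra_simps)
  qed
  ultimately show ?thesis by (intro dvd_24I) auto
qed

lemma nome_even_int: "nome (2 * of_int k) = 1"
proof -
  have "nome (2 * of_int k) = exp (2 * of_real pi * \<i> * of_int k)" by (simp add: nome_def mult_ac)
  then show ?thesis using exp_integer_2pi[of "of_int k"] by (simp add: mult_ac)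
qed

lemma nome_cong_24:
  assumes "24 dvd m - n"
  shows "nome (of_int m / 12) = nome (of_int n / 12)"
proof -
  obtain k where "m - n = 24 * k" using assms by auto
  then have "m = n + 24 * k" by simp
  then have "of_int m / 12 = of_int n / 12 + 2 * (of_int k :: complex)" by (simp add: add_divide_distrib)
  then show ?thesis by (simp only: nome_add nome_even_int) simp
qed

text \<open>The factor \<open>- \<i>\<close> is that of the squared root in
  \<open>th3_inversion\<close>. The residues modulo 4 are tied by the determinant:
  \<open>a * d\<close> is 1 modulo 4 if \<open>b\<close> and \<open>c\<close> are even, and
  \<open>b * c\<close> is 3 modulo 4 if \<open>a\<close> and \<open>d\<close> are even.\<close>

lemma theta_char_inversion:
  assumes "theta_mat a b c d"
  shows "theta_char a b = - \<i> * theta_char c d"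
proof -
  have det: "a * d - b * c = 1" using assms by (simp add: theta_mat_def)
  consider "odd a" "even b" "even c" "odd d" | "even a" "odd b" "odd c" "even d"
    using assms by (auto simp: theta_mat_def)
  then show ?thesis
  proof cases
    case 1
    then obtain b1 c1 where bc: "b = 2 * b1" "c = 2 * c1" by (auto elim!: evenE)
    have "(a mod 4) * (d mod 4) mod 4 = (a * d) mod 4" by (simp add: mod_simps)
    also have "a * d = 1 + 4 * (b1 * c1)" using det by (simp add: bc algebra_simps)
    also have "\<dots> mod 4 = 1" by simp
    finally have "(a mod 4) * (d mod 4) mod 4 = 1" .
    moreover have "a mod 4 = 1 \<or> a mod 4 = 3" "d mod 4 = 1 \<or> d mod 4 = 3" using 1 by presburger+
    moreover have "c mod 4 \<noteq> 1" "c mod 4 \<noteq> 3" using 1 by presburger+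
    ultimately show ?thesis unfolding theta_char_def by (elim disjE) simp_all
  next
    case 2
    then obtain a1 d1 where ad: "a = 2 * a1" "d = 2 * d1" by (auto elim!: evenE)
    have "(b mod 4) * (c mod 4) mod 4 = (b * c) mod 4" by (simp add: mod_simps)
    also have "b * c = 3 + 4 * (a1 * d1 - 1)" using det by (simp add: ad algebra_simps)
    also have "\<dots> mod 4 = 3" unfolding mod_mult_self2 by simp
    finally have "(b mod 4) * (c mod 4) mod 4 = 3" .
    moreover have "b mod 4 = 1 \<or> b mod 4 = 3" "c mod 4 = 1 \<or> c mod 4 = 3" using 2 by presburger+
    moreover have "a mod 4 \<noteq> 1" "a mod 4 \<noteq> 3" using 2 by presburger+
    ultimately show ?thesis unfolding theta_char_def by (elim disjE) simp_all
  qed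
qed

lemma th3_shift2': "th3 (z - 2) = th3 z" using th3_shift2[of "z - 2"] by simp
lemma weber_shift2': "weber (z - 2) = nome (- 1 / 12) * weber z"
proof -
  have "weber z = nome (1 / 12) * weber (z - 2)" using weber_shift2[of "z - 2"] by simp
  then have "nome (- 1 / 12) * weber z = nome (- 1 / 12 + 1 / 12) * weber (z - 2)"
    unfolding nome_add by simp
  then show ?thesis by (simp add: nome_def)
qed

text \<open>Closed formulas for the multipliers need only be compatible with the generators, so no
  word representing the matrix is ever needed.\<close>

theorem theta_group_action:
  assumes "theta_mat a b c d" "Im z > 0"
  shows "weber (mob a b c d z) = nome (of_int (weber_exp a b c d) / 12) * weber z"
    and "th3 (mob a b c d z) ^ 2 = theta_char c d * (of_int c * z + of_int d) * th3 z ^ 2"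
proof -
  have "weber (mob a b c d z) = nome (of_int (weber_exp a b c d) / 12) * weber z \<and>
    th3 (mob a b c d z) ^ 2 = theta_char c d * (of_int c * z + of_int d) * th3 z ^ 2"
    using assms(1)
  proof (induction rule: theta_group_induct)
    case 1
    then show ?case by (simp add: mob_def weber_exp_def theta_char_def nome_def)
  next
    case (2 a b c d)
    then have det: "a * d - b * c = 1" by (simp add: theta_mat_def)
    have "nome (of_int (weber_exp (a + 2 * c) (b + 2 * d) c d) / 12) = nome (of_int (weber_exp a b c d + 1) / 12)"
      using weber_exp_shift[OF 2(1)] by (intro nome_cong_24) (simp add: algebra_simps)
    also have "\<dots> = nome (1 / 12) * nome (of_int (weber_exp a b c d) / 12)"
      by (simp add: add_divide_distrib nome_add)
    finally show ?case using 2(2)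
      unfolding mob_shift[OF assms(2) det] weber_shift2 th3_shift2 by simp
  next
    case (3 a b c d)
    then have det: "a * d - b * c = 1" by (simp add: theta_mat_def)
    have G: "theta_mat (a - 2 * c) (b - 2 * d) c d"
      using 3(1) by (auto simp: theta_mat_def algebra_simps)
    have "nome (of_int (weber_exp (a - 2 * c) (b - 2 * d) c d) / 12) = nome (of_int (weber_exp a b c d - 1) / 12)"
    proof (rule nome_cong_24)
      have "weber_exp (a - 2 * c) (b - 2 * d) c d - (weber_exp a b c d - 1) =
          - (weber_exp a b c d - weber_exp (a - 2 * c) (b - 2 * d) c d - 1)" by simp
      then show "24 dvd weber_exp (a - 2 * c) (b - 2 * d) c d - (weber_exp a b c d - 1)"
        using weber_exp_shift[OF G] by (simp only: dvd_minus_iff) simp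
    qed
    also have "\<dots> = nome (- 1 / 12) * nome (of_int (weber_exp a b c d) / 12)"
      by (simp add: diff_divide_distrib flip: nome_add)
    finally show ?case using 3(2)
      unfolding mob_shift[OF assms(2) det] weber_shift2' th3_shift2' by simp
  next
    case (4 a b c d)
    then have det: "a * d - b * c = 1" by (simp add: theta_mat_def)
    let ?w = "mob a b c d z"
    have w: "Im ?w > 0" using Im_mob_pos[OF assms(2) det] .
    have nz: "of_int c * z + of_int d \<noteq> 0" using denom_nz[OF assms(2) det] .
    have "th3 (- (1 / ?w)) ^ 2 = - \<i> * ?w * th3 ?w ^ 2"
      unfolding th3_inversion[OF w] by (simp add: power_mult_distrib)
    also have "\<dots> = - \<i> * theta_char c d * (?w * (of_int c * z + of_int d)) * th3 z ^ 2"
      using 4(2) by simp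
    also have "?w * (of_int c * z + of_int d) = of_int a * z + of_int b"
      using nz by (simp add: mob_def)
    finally have "th3 (- (1 / ?w)) ^ 2 = theta_char a b * (of_int a * z + of_int b) * th3 z ^ 2"
      unfolding theta_char_inversion[OF 4(1)] .
    moreover have "nome (of_int (weber_exp (- c) (- d) a b) / 12) = nome (of_int (weber_exp a b c d) / 12)"
      using weber_exp_inversion[OF 4(1)] by (rule nome_cong_24)
    ultimately show ?case
      using 4(2) weber_inversion[OF w] unfolding mob_inversion by simp
  qed
  then show "weber (mob a b c d z) = nome (of_int (weber_exp a b c d) / 12) * weber z"
    and "th3 (mob a b c d z) ^ 2 = theta_char c d * (of_int c * z + of_int d) * th3 z ^ 2" by auto
qed

section \<open>A vanishing criterion\<close>

lemma mob_inverse: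
  assumes "Im z > 0" "a * d - b * c = (1::int)"
  shows "mob d (- b) (- c) a (mob a b c d z) = z"
proof -
  define D where "D = of_int c * z + (of_int d :: complex)"
  define N where "N = of_int a * z + (of_int b :: complex)"
  have D: "D \<noteq> 0" unfolding D_def by (rule denom_nz[OF assms])
  have det: "of_int a * of_int d - of_int b * of_int c = (1::complex)"
    using arg_cong[OF assms(2), of "of_int :: int \<Rightarrow> complex"] by simp
  have "of_int d * N - of_int b * D = (of_int a * of_int d - of_int b * of_int c) * z"
    "- of_int c * N + of_int a * D = of_int a * of_int d - of_int b * of_int c"
    by (simp_all add: N_def D_def algebra_simps)
  then have 1: "of_int d * N - of_int b * D = z" "- of_int c * N + of_int a * D = 1"
    unfolding det by simp_all
  have "mob d (- b) (- c) a (mob a b c d z) = (of_int d * (N / D) - of_int b) / (- of_int c * (N / D) + of_int a)"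
    by (simp add: mob_def N_def D_def)
  also have "\<dots> = ((of_int d * N - of_int b * D) / D) / ((- of_int c * N + of_int a * D) / D)"
    using D by (simp add: field_simps)
  finally show ?thesis using D unfolding 1 by simp
qed

text \<open>Minimizing \<open>norm (c * z + d)\<close> over lower rows maximizes the imaginary part
  in the orbit. Minimality against the inversion, and against the inversion after translation by -2,
  keeps \<open>z'\<close> outside the two unit circles. The strip is placed over [0, 2] so that the
  cusp 1 lies in its middle.\<close>

lemma theta_fundamental_domain:
  assumes z: "Im z > 0"
  obtains a b c d z' where "theta_mat a b c d" "z = mob a b c d z'" "Im z' > 0"
    "0 \<le> Re z'" "Re z' \<le> 2" "norm z' \<ge> 1" "norm (z' - 2) \<ge> 1"
proof -
  define den where "den = (\<lambda>(c, d). norm (of_int c * z + of_int d))"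
  \<comment> \<open>The cutoff at 1, the value for the identity, makes the set finite while keeping
    every candidate for the minimum.\<close>
  define S where "S = {(c, d). (\<exists>a b. theta_mat a b c d) \<and> den (c, d) \<le> 1}"
  have "finite S"
  proof (rule finite_subset)
    define M where "M = \<lceil>1 / Im z\<rceil>"
    define L where "L = \<lceil>1 + of_int M * norm z\<rceil>"
    show "S \<subseteq> {-M..M} \<times> {-L..L}"
    proof (clarify)
      fix c d assume "(c, d) \<in> S"
      then have n: "norm (of_int c * z + of_int d) \<le> 1" by (auto simp: S_def den_def)
      have "\<bar>of_int c\<bar> * Im z \<le> 1"
        using abs_Im_le_cmod[of "of_int c * z + of_int d"] n z by (simp add: abs_mult)
      then have "real_of_int \<bar>c\<bar> \<le> 1 / Im z" using z by (simp add: field_simps)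
      then have c: "\<bar>c\<bar> \<le> M" unfolding M_def by linarith
      have "real_of_int \<bar>d\<bar> = norm ((of_int c * z + of_int d) - of_int c * z)" by simp
      also have "\<dots> \<le> norm (of_int c * z + of_int d) + norm (of_int c * z)" by (rule norm_triangle_ineq4)
      also have "\<dots> \<le> 1 + of_int M * norm z"
        using n c by (intro add_mono) (auto simp: norm_mult intro!: mult_right_mono)
      finally have "\<bar>d\<bar> \<le> L" unfolding L_def by linarith
      with c show "c \<in> {-M..M} \<and> d \<in> {-L..L}" by auto
    qed
  qed auto
  moreover have "(0, 1) \<in> S"
    by (auto simp: S_def den_def theta_mat_def intro!: exI[of _ 1] exI[of _ 0])
  ultimately obtain m where m: "m \<in> S" "\<And>s. s \<in> S \<Longrightarrow> den m \<le> den s"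
    using arg_min_if_finite[of S den] by (metis empty_iff not_less)
  obtain c d where cd: "m = (c, d)" by fastforce
  from m(1) obtain a b where G: "theta_mat a b c d" and le1: "den (c, d) \<le> 1" by (auto simp: S_def cd)
  have min: "den (c, d) \<le> den (c', d')" if "theta_mat a' b' c' d'" for a' b' c' d'
  proof (cases "den (c', d') \<le> 1")
    case True
    then show ?thesis using m(2)[of "(c', d')"] that by (auto simp: S_def cd)
  next
    case False
    then show ?thesis using le1 by simp
  qed
  define n where "n = - \<lfloor>Re (mob a b c d z) / 2\<rfloor>"
  define a1 b1 where "a1 = a + 2 * n * c" and "b1 = b + 2 * n * d"
  define z' where "z' = mob a1 b1 c d z"
  have G1: "theta_mat a1 b1 c d"
    using G by (auto simp: theta_mat_def a1_def b1_def algebra_simps)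
  then have det: "a1 * d - b1 * c = 1" by (simp add: theta_mat_def)
  have det0: "a * d - b * c = 1" using G by (simp add: theta_mat_def)
  have nz: "of_int c * z + of_int d \<noteq> 0" using denom_nz[OF z det] .
  have z'n: "z' = mob a b c d z + 2 * of_int n"
    unfolding z'_def mob_def a1_def b1_def using nz by (simp add: field_simps)
  have Re': "0 \<le> Re z'" "Re z' \<le> 2"
    unfolding z'n n_def by (simp_all; linarith)+
  have Im': "Im z' > 0" unfolding z'_def by (rule Im_mob_pos[OF z det])
  have num: "of_int a1 * z + of_int b1 = z' * (of_int c * z + of_int d)"
    unfolding z'_def mob_def using nz by simp
  have "theta_mat (- c) (- d) a1 b1" using G1 by (auto simp: theta_mat_def algebra_simps)
  from min[OF this] have "1 * den (c, d) \<le> norm z' * den (c, d)"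
    by (simp add: den_def num norm_mult)
  then have n1: "norm z' \<ge> 1" using nz by (simp add: den_def)
  have "theta_mat (- c) (- d) (a1 - 2 * c) (b1 - 2 * d)"
    using G1 by (auto simp: theta_mat_def algebra_simps)
  from min[OF this] have "den (c, d) \<le> norm ((of_int a1 * z + of_int b1) - 2 * (of_int c * z + of_int d))"
    by (simp add: den_def algebra_simps)
  also have "\<dots> = norm ((z' - 2) * (of_int c * z + of_int d))" unfolding num by (simp add: algebra_simps)
  finally have "1 * den (c, d) \<le> norm (z' - 2) * den (c, d)" by (simp add: den_def norm_mult)
  then have n2: "norm (z' - 2) \<ge> 1" using nz by (simp add: den_def)
  have "theta_mat d (- b1) (- c) a1" using G1 by (auto simp: theta_mat_def algebra_simps)
  moreover have "z = mob d (- b1) (- c) a1 z'" unfolding z'_def using mob_inverse[OF z det] by simp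
  ultimately show ?thesis using that Im' Re' n1 n2 by blast
qed

text \<open>The analytic part isolated from theta functions. \<open>K_fricke\<close> says that
  \<open>K\<close> is invariant under \<open>z\<close> to \<open>- 1 / (l * z)\<close>; it expresses
  values on the nontrivial cosets through \<open>K\<close> itself, so that decay at infinity and at
  1, uniform in the real part, settles all cusps.\<close>

locale theta_level =
  fixes l :: nat and K :: "complex \<Rightarrow> complex"
  assumes prime_l: "prime l" and odd_l: "odd l"
    and K_holo: "K holomorphic_on upper_half"
    and K_inv: "\<And>a b c d z. theta_mat a b c d \<Longrightarrow> int l dvd c \<Longrightarrow> Im z > 0 \<Longrightarrow> K (mob a b c d z) = K z"
    and K_fricke: "\<And>z. Im z > 0 \<Longrightarrow> K (- (1 / z)) = K (z / of_nat l)"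
    and K_infinity: "\<And>e. e > 0 \<Longrightarrow> \<exists>Y. \<forall>z. Im z \<ge> Y \<longrightarrow> norm (K z) < e"
    and K_one: "\<And>e. e > 0 \<Longrightarrow> \<exists>Y. \<forall>u. Im u \<ge> Y \<longrightarrow> norm (K (1 - 1 / u)) < e"
begin

lemma l_pos: "l > 0" using prime_l prime_gt_0_nat by blast

lemma solve_mod_l:
  assumes "\<not> int l dvd c"
  obtains j where "0 \<le> j" "j < int l" "int l dvd d + j * c"
proof -
  have "coprime c (int l)" using assms prime_l
    by (metis coprime_commute prime_imp_coprime prime_nat_int_transfer)
  then obtain u where u: "[c * u = 1] (mod int l)" using cong_solve_coprime_int by blast
  define j where "j = (- d * u) mod int l"
  have "[d + j * c = d + (- d * u) * c] (mod int l)"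
    unfolding j_def by (intro cong_add cong_mult) (auto simp: cong_def)
  also have "d + (- d * u) * c = d + (- d) * (c * u)" by simp
  also have "[\<dots> = d + (- d) * 1] (mod int l)" by (intro cong_add cong_mult u) auto
  finally have "int l dvd d + j * c" by (simp add: cong_0_iff)
  then show ?thesis using that[of j] l_pos by (simp add: j_def)
qed

text \<open>The matrices \<open>1\<close> and \<open>S T^(2j)\<close> represent the cosets of the level \<open>l\<close> subgroup.\<close>

lemma K_coset:
  assumes G: "theta_mat a b c d" and z: "Im z > 0"
    and j: "int l dvd d - 2 * j * c"
  shows "K (mob a b c d z) = K ((z + 2 * of_int j) / of_nat l)"
proof -
  define b' d' where "b' = b - 2 * j * a" and "d' = d - 2 * j * c"
  define w where "w = z + 2 * of_int j"
  have w: "Im w > 0" using z by (simp add: w_def)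
  then have w0: "w \<noteq> 0" by auto
  have G0: "theta_mat (- b') a (- d') c"
    using G by (auto simp: theta_mat_def b'_def d'_def algebra_simps)
  have "mob (- b') a (- d') c (- (1 / w)) = mob a b c d z"
  proof -
    have "mob (- b') a (- d') c (- (1 / w)) = ((of_int b' + of_int a * w) / w) / ((of_int d' + of_int c * w) / w)"
      unfolding mob_def using w0 by (simp add: add_divide_distrib)
    also have "of_int b' + of_int a * w = of_int a * z + of_int b" by (simp add: b'_def w_def algebra_simps)
    also have "of_int d' + of_int c * w = of_int c * z + of_int d" by (simp add: d'_def w_def algebra_simps)
    finally show ?thesis using w0 by (simp add: mob_def)
  qed
  moreover have "int l dvd - d'" using j by (simp only: d'_def dvd_minus_iff)
  ultimately have "K (mob a b c d z) = K (- (1 / w))"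
    using K_inv[OF G0 _ Im_minus_inverse[OF w]] by simp
  then show ?thesis using K_fricke[OF w] by (simp add: w_def)
qed

lemma K_orbit:
  assumes G: "theta_mat a b c d" and z: "Im z > 0"
  shows "K (mob a b c d z) = K z \<or> (\<exists>j\<in>{0..<int l}. K (mob a b c d z) = K ((z + 2 * of_int j) / of_nat l))"
proof (cases "int l dvd c")
  case True
  then show ?thesis using K_inv[OF G _ z] by simp
next
  case False
  have "\<not> int l dvd - 2 * c"
  proof
    assume "int l dvd - 2 * c"
    then have "int l dvd 2 * c" by simp
    then have "int l dvd 2 \<or> int l dvd c" using prime_l by (meson prime_dvd_mult_iff prime_nat_int_transfer)
    then have "l dvd 2" using False by (metis int_dvd_int_iff of_nat_numeral)
    then have "l = 2" using primes_dvd_imp_eq[OF prime_l two_is_prime_nat] by blast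
    then show False using odd_l by simp
  qed
  then obtain j where j: "0 \<le> j" "j < int l" "int l dvd d + j * (- 2 * c)" by (rule solve_mod_l)
  then have "int l dvd d - 2 * j * c" by (simp add: algebra_simps)
  from K_coset[OF G z this] j show ?thesis by auto
qed

text \<open>Near the cusp 1 the coordinate is \<open>u\<close>, and the stabilizer acts by
  \<open>u\<close> to \<open>u + s\<close>. If \<open>l\<close> does not divide
  \<open>c + d\<close>, a suitable \<open>s\<close> brings the matrix into the level subgroup;
  otherwise the Fricke involution leads back to the cusp 1 with coordinate
  \<open>l * u\<close>.\<close>

lemma K_orbit_one:
  assumes G: "theta_mat a b c d" and u: "Im u > 0"
  shows "(\<exists>s::int. K (mob a b c d (1 - 1 / u)) = K (1 - 1 / (u + of_int s))) \<or>
         K (mob a b c d (1 - 1 / u)) = K (1 - 1 / (of_nat l * u))"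
proof (cases "int l dvd c + d")
  case True
  \<comment> \<open>With \<open>2 * j = l - 1\<close> the shift makes \<open>1 - 1 / u\<close> into
    \<open>l - 1 / u\<close>, and division by \<open>l\<close> returns to the cusp 1.\<close>
  obtain j where j: "int l = 2 * j + 1" using odd_l by (metis even_of_nat_iff oddE)
  have eq: "d - 2 * j * c = (c + d) - int l * c" unfolding j by (simp add: algebra_simps)
  have "int l dvd d - 2 * j * c" unfolding eq using True by (intro dvd_diff) auto
  moreover have "Im (1 - 1 / u) > 0" using Im_minus_inverse[OF u] by simp
  ultimately have "K (mob a b c d (1 - 1 / u)) = K ((1 - 1 / u + 2 * of_int j) / of_nat l)"
    using K_coset[OF G] by blast
  also have "1 - 1 / u + 2 * of_int j = of_nat l - 1 / u"
    using arg_cong[OF j, of "of_int :: int \<Rightarrow> complex"] by simp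
  also have "(of_nat l - 1 / u) / of_nat l = 1 - 1 / (of_nat l * u)"
    using l_pos by (simp add: field_simps)
  finally show ?thesis by blast
next
  case False
  then obtain s where s: "int l dvd c + s * (c + d)" by (rule solve_mod_l)
  define v where "v = u + of_int s"
  have v: "Im v > 0" using u by (simp add: v_def)
  then have v0: "v \<noteq> 0" by auto
  have u0: "u \<noteq> 0" using u by auto
  \<comment> \<open>The given matrix times the parabolic one with rows \<open>(1 + s, - s)\<close>
    and \<open>(s, 1 - s)\<close>, which fixes 1 and sends \<open>1 - 1 / v\<close> to
    \<open>1 - 1 / (v - s)\<close>.\<close>
  let ?a = "a * (s + 1) + b * s" and ?b = "- a * s + b * (1 - s)"
    and ?c = "c * (s + 1) + d * s" and ?d = "- c * s + d * (1 - s)"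
  have G0: "theta_mat ?a ?b ?c ?d"
  proof -
    have "?a * ?d - ?b * ?c = a * d - b * c" by (simp add: algebra_simps)
    then show ?thesis using G by (cases "even s") (auto simp: theta_mat_def)
  qed
  have eq: "of_int (p * (s + 1) + q * s) * (1 - 1 / v) + of_int (- p * s + q * (1 - s)) =
      (of_int p * (u - 1) + of_int q * u) / v" for p q :: int
    using v0 unfolding v_def by (simp add: field_simps)
  have "mob ?a ?b ?c ?d (1 - 1 / v) = ((of_int a * (u - 1) + of_int b * u) / v) / ((of_int c * (u - 1) + of_int d * u) / v)"
    unfolding mob_def eq ..
  also have "\<dots> = (of_int a * (u - 1) + of_int b * u) / (of_int c * (u - 1) + of_int d * u)"
    using v0 by simp
  also have "\<dots> = (u * (of_int a * (1 - 1 / u) + of_int b)) / (u * (of_int c * (1 - 1 / u) + of_int d))"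
  proof -
    have "of_int p * (u - 1) + of_int q * u = u * (of_int p * (1 - 1 / u) + of_int q)" for p q :: int
      using u0 by (simp add: field_simps)
    then show ?thesis by (simp only:)
  qed
  also have "\<dots> = mob a b c d (1 - 1 / u)" unfolding mob_def using u0 by simp
  finally have e: "mob ?a ?b ?c ?d (1 - 1 / v) = mob a b c d (1 - 1 / u)" .
  have "int l dvd ?c" using s by (simp add: algebra_simps)
  moreover have "Im (1 - 1 / v) > 0" using Im_minus_inverse[OF v] by simp
  ultimately have "K (mob a b c d (1 - 1 / u)) = K (1 - 1 / v)"
    using K_inv[OF G0, of "1 - 1 / v"] by (simp only: e)
  then show ?thesis unfolding v_def by blast
qed

text \<open>The two unit circles touch at 1, so the region reaches the real axis only there.
  Bounding the cusp coordinate \<open>1 / (1 - z)\<close> therefore keeps \<open>z\<close> away from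
  the axis: the circles force the distance of \<open>Re z\<close> from 1 to be at most
  \<open>(Im z)\<^sup>2\<close>.\<close>

lemma strip_bound:
  assumes "Im z > 0" "0 \<le> Re z" "Re z \<le> 2" "norm z \<ge> 1" "norm (z - 2) \<ge> 1"
    and Y: "Y \<ge> 1" "Im (1 / (1 - z)) \<le> Y"
  shows "1 / (2 * Y) \<le> Im z"
proof (rule ccontr)
  define x y where "x = Re z - 1" and "y = Im z"
  assume "\<not> ?thesis"
  then have y: "0 < y" "y * (2 * Y) < 1" using assms by (auto simp: y_def field_simps)
  have "y * 2 \<le> y * (2 * Y)" using Y y by simp
  then have y2: "y < 1" using y by linarith
  have x: "\<bar>x\<bar> \<le> 1" using assms by (auto simp: x_def)
  have "(x + 1)\<^sup>2 + y\<^sup>2 \<ge> 1\<^sup>2"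
    using power_mono[OF assms(4), of 2] unfolding cmod_power2 x_def y_def by simp
  moreover have "(x - 1)\<^sup>2 + y\<^sup>2 \<ge> 1\<^sup>2"
    using power_mono[OF assms(5), of 2] unfolding cmod_power2 x_def y_def by simp
  ultimately have "2 * \<bar>x\<bar> \<le> x\<^sup>2 + y\<^sup>2" by (auto simp: power2_eq_square algebra_simps abs_if)
  moreover have "x\<^sup>2 \<le> \<bar>x\<bar>" using x by (metis abs_ge_zero abs_mult_self_eq mult_left_le power2_eq_square)
  ultimately have xy: "\<bar>x\<bar> \<le> y\<^sup>2" by linarith
  then have "x\<^sup>2 \<le> y\<^sup>2" using \<open>x\<^sup>2 \<le> \<bar>x\<bar>\<close> by linarith
  then have D: "x\<^sup>2 + y\<^sup>2 \<le> 2 * y\<^sup>2" by simp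
  have "Im (1 / (1 - z)) = y / (x\<^sup>2 + y\<^sup>2)"
    unfolding Im_divide by (simp add: x_def y_def power2_eq_square algebra_simps)
  moreover have "y / (x\<^sup>2 + y\<^sup>2) \<ge> y / (2 * y\<^sup>2)"
    using D y by (intro divide_left_mono) (auto simp: add_nonneg_pos)
  moreover have "y / (2 * y\<^sup>2) = 1 / (2 * y)" using y by (simp add: power2_eq_square)
  ultimately have "1 / (2 * y) \<le> Y" using Y by linarith
  then show False using y by (simp add: field_simps)
qed

text \<open>Where the modulus of \<open>K\<close> is not below \<open>e\<close>, its value is
  attained on a compact set. So the modulus has a global maximum, \<open>K\<close> is constant, and
  its decay at infinity contradicts the nonzero value.\<close>

theorem K_eq_0:
  assumes "Im z0 > 0"
  shows "K z0 = 0"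
proof (rule ccontr)
  assume nz: "K z0 \<noteq> 0"
  define e where "e = norm (K z0)"
  have e: "e > 0" using nz by (simp add: e_def)
  obtain Y1 where Y1: "\<And>z. Im z \<ge> Y1 \<Longrightarrow> norm (K z) < e" using K_infinity[OF e] by blast
  obtain Y2 where Y2: "\<And>u. Im u \<ge> Y2 \<Longrightarrow> norm (K (1 - 1 / u)) < e" using K_one[OF e] by blast
  define Y where "Y = max 1 (max Y1 Y2)"
  have Y: "Y \<ge> 1" "Y \<ge> Y1" "Y \<ge> Y2" by (auto simp: Y_def)
  have l1: "real l \<ge> 1" using l_pos by simp
  \<comment> \<open>The height \<open>real l * Y\<close> ensures that points above it stay above
    \<open>Y\<close> after division by \<open>l\<close>. The set \<open>C'\<close> adds the images
    under the coset representatives.\<close>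
  define C where "C = cbox (Complex 0 (1 / (2 * Y))) (Complex 2 (real l * Y))"
  define C' where "C' = C \<union> (\<Union>j\<in>{0..<int l}. (\<lambda>z. (z + 2 * of_int j) / of_nat l) ` C)"
  have CH: "Im z > 0" if "z \<in> C" for z
  proof -
    have "1 / (2 * Y) \<le> Im z" using that by (auto simp: C_def in_cbox_complex_iff)
    moreover have "1 / (2 * Y) > 0" using Y by simp
    ultimately show ?thesis by linarith
  qed
  have C'H: "C' \<subseteq> upper_half"
    using CH l_pos by (auto simp: C'_def)
  have "compact C'"
    unfolding C'_def C_def
    by (intro compact_Un compact_UN compact_continuous_image compact_cbox continuous_intros) (use l_pos in auto)
  have cases: "norm (K z) < e \<or> (\<exists>y\<in>C'. K z = K y)" if "Im z > 0" for z
  proof -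
    obtain a b c d z' where G: "theta_mat a b c d" and zz: "z = mob a b c d z'" and z': "Im z' > 0"
      "0 \<le> Re z'" "Re z' \<le> 2" "norm z' \<ge> 1" "norm (z' - 2) \<ge> 1"
      by (rule theta_fundamental_domain[OF \<open>Im z > 0\<close>])
    consider "Im z' \<ge> real l * Y" | "Im (1 / (1 - z')) \<ge> Y" | "z' \<in> C"
    proof -
      have "z' \<in> C" if "\<not> Im z' \<ge> real l * Y" "\<not> Im (1 / (1 - z')) \<ge> Y"
        using strip_bound[OF z' Y(1)] z' that by (auto simp: C_def in_cbox_complex_iff)
      then show ?thesis using that by blast
    qed
    then show ?thesis
    proof cases
      case 1
      have "1 * Y \<le> real l * Y" using l1 Y by (intro mult_right_mono) auto
      then have "norm (K z') < e" using 1 Y by (intro Y1) linarith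
      moreover have "norm (K ((z' + 2 * of_int j) / of_nat l)) < e" for j :: int
      proof (rule Y1)
        have "Im ((z' + 2 * of_int j) / of_nat l) = Im z' / real l" by simp
        also have "\<dots> \<ge> Y" using 1 l1 by (simp add: field_simps)
        finally show "Y1 \<le> Im ((z' + 2 * of_int j) / of_nat l)" using Y by linarith
      qed
      ultimately show ?thesis using K_orbit[OF G z'(1)] unfolding zz by auto
    next
      case 2
      define u where "u = 1 / (1 - z')"
      have u: "Im u \<ge> Y" using 2 by (simp add: u_def)
      have "z' = 1 - 1 / u" by (simp add: u_def)
      have up: "Im u > 0" using u Y by linarith
      have "norm (K (1 - 1 / (u + of_int s))) < e" for s :: int
        using u Y by (intro Y2) simp
      moreover have "norm (K (1 - 1 / (of_nat l * u))) < e"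
      proof (rule Y2)
        have "1 * Im u \<le> real l * Im u" using l1 up by (intro mult_right_mono) auto
        moreover have "Im (of_nat l * u) = real l * Im u" by simp
        ultimately show "Y2 \<le> Im (of_nat l * u)" using u Y by linarith
      qed
      ultimately show ?thesis using K_orbit_one[OF G up] unfolding zz \<open>z' = 1 - 1 / u\<close> by auto
    next
      case 3
      then show ?thesis using K_orbit[OF G z'(1)] unfolding zz by (auto simp: C'_def)
    qed
  qed
  have "C' \<noteq> {}" using cases[OF assms] by (auto simp: e_def)
  moreover have "continuous_on C' (\<lambda>z. norm (K z))"
    using continuous_on_subset[OF holomorphic_on_imp_continuous_on[OF K_holo] C'H]
    by (intro continuous_intros)
  ultimately obtain x where x: "x \<in> C'" "\<And>y. y \<in> C' \<Longrightarrow> norm (K y) \<le> norm (K x)"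
    using continuous_attains_sup[OF \<open>compact C'\<close>] by blast
  have "e \<le> norm (K x)" using cases[OF assms] x(2) by (auto simp: e_def)
  then have max: "norm (K z) \<le> norm (K x)" if "Im z > 0" for z
    using cases[OF that] x(2) by auto
  have "K constant_on upper_half"
    using maximum_modulus_principle[OF K_holo open_upper_half connected_upper_half open_upper_half order_refl, of x]
      x(1) C'H max by auto
  then obtain k where k: "\<And>z. Im z > 0 \<Longrightarrow> K z = k" unfolding constant_on_def by auto
  have "K z0 = K (\<i> * of_real Y)" using k[of "\<i> * of_real Y"] k[OF assms] Y by simp
  moreover have "norm (K (\<i> * of_real Y)) < e" using Y by (intro Y1) simp
  ultimately show False by (simp add: e_def)
qed

end

section \<open>Invariance under the level subgroup\<close>

text \<open>\<open>rl\<close> trivializes the \<open>r\<close>th power of the product of the two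
  Weber multipliers and gives \<open>Hz\<close> a simple zero in the nome; \<open>rn\<close>
  balances the growth of \<open>Dz ^ e\<close> and \<open>Hz ^ n\<close> at the cusp 1;
  \<open>sign\<close> disposes of the sign left by the theta multipliers.\<close>

locale weber_level =
  fixes l r e n :: nat and P :: "complex poly"
  assumes prime_l: "prime l" and odd_l: "odd l" and rl: "r * (l + 1) = 24" and rn: "r * n = 6 * e"
    and sign: "l mod 4 = 3 \<or> even e" and deg_P: "degree P \<le> n"
begin

lemma l_pos: "l > 0" using prime_l prime_gt_0_nat by blast

definition phi :: "complex \<Rightarrow> complex" where "phi z = (th3 z / th3 (of_nat l * z)) ^ 2"
text \<open>The derivative of a function of weight 0 has weight 2, as has \<open>th3 ^ 4\<close>, so
  the quotient has weight 0. The normalization makes it agree with the determinant at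
  \<open>- nome z\<close>.\<close>

definition Dz :: "complex \<Rightarrow> complex" where
  "Dz z = - deriv phi z / (2 * of_real pi * \<i> * th3 z ^ 4)"
definition Hz :: "complex \<Rightarrow> complex" where "Hz z = - ((weber z * weber (of_nat l * z)) ^ r)"
text \<open>The exponent \<open>2 * n + 1\<close> makes the quotient vanish at the cusp \<open>1\<close>, and there is still a
  zero at infinity if the difference has a zero of order \<open>n + 1\<close> there.\<close>

definition Kz :: "complex \<Rightarrow> complex" where
  "Kz z = (Dz z ^ e - poly P (Hz z)) ^ 2 / Hz z ^ (2 * n + 1)"

lemma Im_l: "Im z > 0 \<Longrightarrow> Im (of_nat l * z) > 0" using l_pos by simp
lemma Im_div_l: "Im z > 0 \<Longrightarrow> Im (z / of_nat l) > 0" using l_pos by simp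

lemma th3_l_holomorphic: "(\<lambda>z. th3 (of_nat l * z)) holomorphic_on upper_half"
  by (rule holomorphic_on_compose_gen[OF _ th3_holomorphic, unfolded o_def])
    (auto intro!: holomorphic_intros simp: l_pos)

lemma weber_l_holomorphic: "(\<lambda>z. weber (of_nat l * z)) holomorphic_on upper_half"
  by (rule holomorphic_on_compose_gen[OF _ weber_holomorphic, unfolded o_def])
    (auto intro!: holomorphic_intros simp: l_pos)

lemma phi_holomorphic: "phi holomorphic_on upper_half"
  unfolding phi_def[abs_def]
  by (intro holomorphic_intros th3_holomorphic th3_l_holomorphic) (simp add: th3_nz l_pos)

lemma phi_deriv: "Im z > 0 \<Longrightarrow> (phi has_field_derivative deriv phi z) (at z)"
  using holomorphic_derivI[OF phi_holomorphic open_upper_half, of z] by simp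

lemma phi_nz: "Im z > 0 \<Longrightarrow> phi z \<noteq> 0"
  by (simp add: phi_def th3_nz l_pos)

lemma Hz_nz: "Im z > 0 \<Longrightarrow> Hz z \<noteq> 0"
  by (simp add: Hz_def weber_nz l_pos)

lemma Dz_holomorphic: "Dz holomorphic_on upper_half"
  unfolding Dz_def[abs_def]
  by (intro holomorphic_intros th3_holomorphic holomorphic_deriv[OF phi_holomorphic] open_upper_half)
    (simp add: th3_nz)

lemma Hz_holomorphic: "Hz holomorphic_on upper_half"
  unfolding Hz_def[abs_def] by (intro holomorphic_intros weber_holomorphic weber_l_holomorphic)

lemma Kz_holomorphic: "Kz holomorphic_on upper_half"
proof -
  have "(\<lambda>z. poly P (Hz z)) holomorphic_on upper_half"
    using Hz_holomorphic unfolding poly_altdef by (intro holomorphic_intros)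
  then show ?thesis
    unfolding Kz_def[abs_def]
    by (intro holomorphic_intros Dz_holomorphic Hz_holomorphic) (simp add: Hz_nz)
qed

lemma deriv_eq_upper:
  assumes "Im z > 0" "(f has_field_derivative f') (at z)" "(g has_field_derivative g') (at z)"
    "\<And>w. Im w > 0 \<Longrightarrow> f w = g w"
  shows "f' = g'"
proof -
  have "(g has_field_derivative f') (at z)"
    by (rule has_field_derivative_transform_within_open[OF assms(2) open_upper_half]) (use assms in auto)
  then show ?thesis using assms(3) DERIV_unique by blast
qed

lemma mob_deriv:
  assumes "Im z > 0" "a * d - b * c = (1::int)"
  shows "(mob a b c d has_field_derivative 1 / (of_int c * z + of_int d) ^ 2) (at z)"
proof -
  have nz: "of_int c * z + of_int d \<noteq> 0" by (rule denom_nz[OF assms])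
  have "of_int a * (of_int c * z + of_int d) - (of_int a * z + of_int b) * of_int c = (of_int (a * d - b * c) :: complex)"
    by (simp add: algebra_simps)
  then have "of_int a * (of_int c * z + of_int d) - (of_int a * z + of_int b) * of_int c = (1 :: complex)"
    using assms by simp
  then show ?thesis unfolding mob_def[abs_def]
    using nz by (auto intro!: derivative_eq_intros simp: power2_eq_square)
qed

section \<open>Action of one matrix of the level subgroup\<close>

context
  fixes a b c d c' :: int
  assumes G: "theta_mat a b c d" and c: "c = int l * c'"
begin

lemma det: "a * d - b * c = 1" using G by (simp add: theta_mat_def)

lemma G': "theta_mat a (b * int l) c' d"
  using G odd_l by (auto simp: theta_mat_def c mult_ac)

text \<open>Conjugation by the diagonal matrix with entries \<open>l\<close> and 1; it remains
  integral as \<open>l\<close> divides \<open>c\<close>, and inside the theta group as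
  \<open>l\<close> is odd.\<close>

lemma mob_l: "of_nat l * mob a b c d z = mob a (b * int l) c' d (of_nat l * z)"
  by (simp add: mob_def c algebra_simps)

text \<open>For even \<open>c\<close> both characters are the same sign, determined by
  \<open>d\<close>. For odd \<open>c\<close> they are \<open>\<i>\<close> and \<open>- \<i>\<close>
  in some order if \<open>l\<close> is 3 modulo 4, but equal if \<open>l\<close> is 1 modulo 4; the
  product -1 then requires an even \<open>e\<close>.\<close>

lemma theta_char_level: "(theta_char c d * theta_char c' d) ^ e = 1"
proof (cases "even c")
  case True
  then have "even c'" using odd_l by (simp add: c)
  have "c mod 4 \<noteq> 1" "c mod 4 \<noteq> 3" "c' mod 4 \<noteq> 1" "c' mod 4 \<noteq> 3"
    using True \<open>even c'\<close> by presburger+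
  then have "theta_char c d * theta_char c' d = 1" by (simp add: theta_char_def)
  then show ?thesis by simp
next
  case False
  then have "odd c'" by (simp add: c)
  then have c'4: "c' mod 4 = 1 \<or> c' mod 4 = 3" by presburger
  have cm: "c mod 4 = ((int l mod 4) * (c' mod 4)) mod 4" unfolding c by (simp add: mod_mult_eq)
  show ?thesis
  proof (cases "l mod 4 = 3")
    case True
    then have "int l mod 4 = 3" by (metis of_nat_mod of_nat_numeral)
    then have "theta_char c d * theta_char c' d = 1"
      using c'4 unfolding theta_char_def cm by (elim disjE) simp_all
    then show ?thesis by simp
  next
    case False
    have "l mod 4 = 1" using False odd_l by presburger
    then have "int l mod 4 = 1" by (metis of_nat_mod of_nat_numeral of_nat_1)
    then have "theta_char c d * theta_char c' d = -1"
      using c'4 unfolding theta_char_def cm by (elim disjE) simp_all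
    then show ?thesis using sign False by simp
  qed
qed

lemma theta_char_nz: "theta_char p q \<noteq> 0" by (simp add: theta_char_def)

lemma phi_mob:
  assumes "Im z > 0"
  shows "phi (mob a b c d z) = theta_char c d / theta_char c' d * phi z"
proof -
  have eq: "of_int c' * (of_nat l * z) + of_int d = of_int c * z + of_int d" by (simp add: c)
  have "of_int c * z + of_int d \<noteq> 0" by (rule denom_nz[OF assms det])
  then show ?thesis
    unfolding phi_def power_divide mob_l theta_group_action(2)[OF G assms]
      theta_group_action(2)[OF G' Im_l[OF assms]] eq by simp
qed

lemma Dz_mob:
  assumes z: "Im z > 0"
  shows "Dz (mob a b c d z) ^ e = Dz z ^ e"
proof -
  let ?w = "mob a b c d z" and ?t = "of_int c * z + of_int d"
  define k where "k = theta_char c d" 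
  define k' where "k' = theta_char c' d"
  have k: "k \<noteq> 0" "k' \<noteq> 0" by (simp_all add: k_def k'_def theta_char_nz)
  have t: "?t \<noteq> 0" by (rule denom_nz[OF z det])
  have "deriv phi ?w * (1 / ?t ^ 2) = k / k' * deriv phi z"
  proof (rule deriv_eq_upper[OF z])
    show "((\<lambda>z. phi (mob a b c d z)) has_field_derivative deriv phi ?w * (1 / ?t ^ 2)) (at z)"
      by (rule DERIV_chain2[OF phi_deriv[OF Im_mob_pos[OF z det]] mob_deriv[OF z det]])
    show "((\<lambda>z. k / k' * phi z) has_field_derivative k / k' * deriv phi z) (at z)"
      by (rule DERIV_cmult[OF phi_deriv[OF z]])
  qed (simp add: phi_mob k_def k'_def)
  then have d: "deriv phi ?w = k / k' * deriv phi z * ?t ^ 2" using t by (simp add: field_simps)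
  have "th3 ?w ^ 4 = (th3 ?w ^ 2) ^ 2" by (simp flip: power_mult)
  also have "\<dots> = k ^ 2 * ?t ^ 2 * th3 z ^ 4"
    unfolding theta_group_action(2)[OF G z] k_def by (simp add: power_mult_distrib flip: power_mult)
  finally have th: "th3 ?w ^ 4 = k ^ 2 * ?t ^ 2 * th3 z ^ 4" .
  have gen: "- (k / k' * D * T ^ 2) / (C * (k ^ 2 * T ^ 2 * H)) = 1 / (k * k') * (- D / (C * H))"
    if "T \<noteq> 0" "C \<noteq> 0" "H \<noteq> 0" for D T C H :: complex
    using that k by (simp add: field_simps power2_eq_square)
  have "Dz ?w = 1 / (k * k') * Dz z"
    unfolding Dz_def d th using th3_nz[OF z] by (intro gen t) auto
  then have "Dz ?w ^ e = 1 / (k * k') ^ e * Dz z ^ e" by (simp add: power_mult_distrib power_divide)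
  then show ?thesis using theta_char_level by (simp add: k_def k'_def)
qed

text \<open>Replacing \<open>(b, c)\<close> by \<open>(l * b, c div l)\<close> pairs each term of
  the exponent with a partner so that \<open>l + 1\<close> splits off.\<close>

lemma weber_exp_level: "int (l + 1) dvd weber_exp a b c d + weber_exp a (b * int l) c' d"
proof -
  define s where "s = (if odd a then a * ((b - c) div 2) else c * ((a + d) div 2))"
  define s' where "s' = (if odd a then a * ((b * int l - c') div 2) else c' * ((a + d) div 2))"
  have "int (l + 1) dvd s + s'"
  proof (cases "odd a")
    case True
    with G' obtain c1 where c1: "c' = 2 * c1" by (auto simp: theta_mat_def elim!: evenE)
    from True G obtain b1 where b1: "b = 2 * b1" by (auto simp: theta_mat_def elim!: evenE)
    have "b - c = 2 * (b1 - int l * c1)" "b * int l - c' = 2 * (b1 * int l - c1)"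
      unfolding c c1 b1 by (simp_all add: algebra_simps)
    then have h: "(b - c) div 2 = b1 - int l * c1" "(b * int l - c') div 2 = b1 * int l - c1" by simp_all
    have "s + s' = int (l + 1) * (a * (b1 - c1))"
      unfolding s_def s'_def h using True by (simp add: algebra_simps)
    then show ?thesis by simp
  next
    case False
    then have "s + s' = int (l + 1) * (c' * ((a + d) div 2))"
      by (simp add: s_def s'_def c algebra_simps)
    then show ?thesis by simp
  qed
  moreover have "(b * d * (1 - c\<^sup>2) + c * (a + d)) + (b * int l * d * (1 - c'\<^sup>2) + c' * (a + d))
      = int (l + 1) * (b * d * (1 - int l * c'\<^sup>2) + c' * (a + d))"
    unfolding c by (simp add: power2_eq_square algebra_simps)
  moreover have "weber_exp a b c d + weber_exp a (b * int l) c' d = 9 * (s + s') -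
      16 * ((b * d * (1 - c\<^sup>2) + c * (a + d)) + (b * int l * d * (1 - c'\<^sup>2) + c' * (a + d)))"
    unfolding weber_exp_def s_def s'_def by simp
  ultimately show ?thesis by (simp only: dvd_diff dvd_mult dvd_triv_left)
qed

lemma Hz_mob:
  assumes z: "Im z > 0"
  shows "Hz (mob a b c d z) = Hz z"
proof -
  let ?E = "weber_exp a b c d" and ?E' = "weber_exp a (b * int l) c' d"
  obtain m where m: "?E + ?E' = int (l + 1) * m" using weber_exp_level by blast
  have "nome (of_int ?E / 12) * nome (of_int ?E' / 12) = nome (of_int (?E + ?E') / 12)"
    by (simp add: add_divide_distrib nome_add)
  then have "(nome (of_int ?E / 12) * nome (of_int ?E' / 12)) ^ r = nome (of_nat r * (of_int (?E + ?E') / 12))"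
    by (simp only: nome_power)
  also have "of_nat r * (of_int (?E + ?E') / 12) = of_nat (r * (l + 1)) * (of_int m :: complex) / 12"
    unfolding m by (simp add: algebra_simps)
  also have "\<dots> = 2 * of_int m" unfolding rl by simp
  also have "nome (2 * of_int m) = 1" by (rule nome_even_int)
  finally have *: "(nome (of_int ?E / 12) * nome (of_int ?E' / 12)) ^ r = 1" .
  have "Hz (mob a b c d z) = - ((nome (of_int ?E / 12) * nome (of_int ?E' / 12)) ^ r * (weber z * weber (of_nat l * z)) ^ r)"
    unfolding Hz_def mob_l theta_group_action(1)[OF G z] theta_group_action(1)[OF G' Im_l[OF z]]
    by (simp add: power_mult_distrib mult_ac)
  then show ?thesis unfolding * by (simp add: Hz_def)
qed

end

lemma Kz_inv:
  assumes "theta_mat a b c d" "int l dvd c" "Im z > 0"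
  shows "Kz (mob a b c d z) = Kz z"
proof -
  from assms(2) obtain c' where c': "c = int l * c'" by blast
  show ?thesis
    unfolding Kz_def Hz_mob[OF assms(1) c' assms(3)] Dz_mob[OF assms(1) c' assms(3)] ..
qed

section \<open>The Fricke involution\<close>

lemma Hz_fricke:
  assumes z: "Im z > 0"
  shows "Hz (- (1 / z)) = Hz (z / of_nat l)"
proof -
  have "of_nat l * - (1 / z) = - (1 / (z / of_nat l))" using l_pos by simp
  then have "weber (of_nat l * - (1 / z)) = weber (z / of_nat l)"
    using weber_inversion[OF Im_div_l[OF z]] by (simp only:)
  then show ?thesis using l_pos weber_inversion[OF z] by (simp add: Hz_def mult.commute)
qed

lemma phi_fricke:
  assumes z: "Im z > 0"
  shows "phi (- (1 / z)) = of_nat l / phi (z / of_nat l)"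
proof -
  have e: "of_nat l * - (1 / z) = - (1 / (z / of_nat l))" using l_pos by simp
  have sq: "th3 (- (1 / w)) ^ 2 = - \<i> * w * th3 w ^ 2" if "Im w > 0" for w
    unfolding th3_inversion[OF that] by (simp add: power_mult_distrib)
  have "z \<noteq> 0" using z by auto
  then show ?thesis
    unfolding phi_def power_divide e sq[OF z] sq[OF Im_div_l[OF z]] using l_pos by simp
qed

text \<open>The involution inverts \<open>phi\<close> up to the factor \<open>l\<close>, which gives
  the derivative a minus sign; it cancels against that of \<open>csqrt_power_4\<close> in the
  transformation of \<open>th3 ^ 4\<close>.\<close>

lemma Dz_fricke:
  assumes z: "Im z > 0"
  shows "Dz (- (1 / z)) = Dz (z / of_nat l)"
proof -
  have z0: "z \<noteq> 0" using z by auto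
  let ?z' = "z / of_nat l"
  have "deriv phi (- (1 / z)) * (1 / z ^ 2) = - (of_nat l * (deriv phi ?z' * (1 / of_nat l))) / phi ?z' ^ 2"
  proof (rule deriv_eq_upper[OF z])
    have "((\<lambda>z. - (1 / z)) has_field_derivative 1 / z ^ 2) (at z)"
      using z0 by (auto intro!: derivative_eq_intros simp: power2_eq_square)
    then show "((\<lambda>z. phi (- (1 / z))) has_field_derivative deriv phi (- (1 / z)) * (1 / z ^ 2)) (at z)"
      by (rule DERIV_chain2[where f = phi and g = "\<lambda>z. - (1 / z)", OF phi_deriv[OF Im_minus_inverse[OF z]]])
    have "((\<lambda>z. z / of_nat l) has_field_derivative 1 / of_nat l) (at z)"
      using l_pos by (auto intro!: derivative_eq_intros)
    from DERIV_chain2[where f = phi and g = "\<lambda>z. z / of_nat l", OF phi_deriv[OF Im_div_l[OF z]] this]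
    have "((\<lambda>z. phi (z / of_nat l)) has_field_derivative deriv phi ?z' * (1 / of_nat l)) (at z)" .
    from DERIV_divide[OF DERIV_const[of "of_nat l"] this phi_nz[OF Im_div_l[OF z]]]
    show "((\<lambda>z. of_nat l / phi (z / of_nat l)) has_field_derivative
        - (of_nat l * (deriv phi ?z' * (1 / of_nat l))) / phi ?z' ^ 2) (at z)"
      by (simp add: power2_eq_square)
  qed (rule phi_fricke)
  then have d: "deriv phi (- (1 / z)) = - deriv phi ?z' * z ^ 2 / phi ?z' ^ 2"
    using z0 l_pos by (simp add: field_simps)
  have "th3 (- (1 / z)) ^ 4 = csqrt (- \<i> * z) ^ 4 * th3 z ^ 4"
    unfolding th3_inversion[OF z] by (rule power_mult_distrib)
  also note csqrt_power_4
  finally have t: "th3 (- (1 / z)) ^ 4 = - (z ^ 2) * th3 z ^ 4" .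
  have "phi ?z' ^ 2 * th3 z ^ 4 = th3 ?z' ^ 4"
    using l_pos th3_nz[OF z] by (simp add: phi_def power_divide flip: power_mult)
  then have "th3 ?z' ^ 4 = phi ?z' ^ 2 * th3 z ^ 4" ..
  then show ?thesis
    unfolding Dz_def d t using z0 phi_nz[OF Im_div_l[OF z]] th3_nz[OF z] by (simp add: field_simps)
qed

lemma Kz_fricke: "Im z > 0 \<Longrightarrow> Kz (- (1 / z)) = Kz (z / of_nat l)"
  unfolding Kz_def by (simp only: Dz_fricke Hz_fricke)

end

section \<open>Behaviour at the cusps\<close>

text \<open>In the disc variable the cusp infinity becomes an interior point, so expansions there
  are Taylor expansions at 0.\<close>

definition D_disc :: "nat \<Rightarrow> complex \<Rightarrow> complex" where
  "D_disc l x = (theta4 x * (of_nat l * x ^ l * deriv theta4 (x ^ l)) - theta4 (x ^ l) * (x * deriv theta4 x)) /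
     (theta4 x ^ 3 * theta4 (x ^ l) ^ 3)"

definition H_disc :: "nat \<Rightarrow> nat \<Rightarrow> complex \<Rightarrow> complex" where
  "H_disc l r x = x * (qU x * qU (x ^ l)) ^ r"

lemma norm_power_less_1: "norm (x :: complex) < 1 \<Longrightarrow> l > 0 \<Longrightarrow> norm (x ^ l) < 1"
  by (simp add: norm_power power_less_one_iff)

lemma theta4_deriv: "norm x < 1 \<Longrightarrow> (theta4 has_field_derivative deriv theta4 x) (at x)"
  using holomorphic_derivI[OF theta4_holomorphic open_ball, of x] by simp

lemma theta4_power_deriv:
  assumes "norm x < 1" "l > 0"
  shows "((\<lambda>z. theta4 (z ^ l)) has_field_derivative deriv theta4 (x ^ l) * (of_nat l * x ^ (l - 1))) (at x)"
proof -
  have "((\<lambda>z. z ^ l) has_field_derivative of_nat l * x ^ (l - 1)) (at x)"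
    by (auto intro!: derivative_eq_intros)
  from DERIV_chain2[where f = theta4 and g = "\<lambda>z. z ^ l", OF theta4_deriv[OF norm_power_less_1[OF assms]] this]
  show ?thesis .
qed

lemma times_power_diff_1: "l > 0 \<Longrightarrow> (x :: complex) * x ^ (l - 1) = x ^ l"
  by (cases l) auto

lemma D_hat_eq_D_disc:
  assumes "norm x < 1" "l > 0"
  shows "D_hat l x = D_disc l x"
proof -
  have "x * (deriv theta4 (x ^ l) * (of_nat l * x ^ (l - 1))) = of_nat l * x ^ l * deriv theta4 (x ^ l)"
    using times_power_diff_1[OF assms(2), of x] by (simp add: mult_ac)
  then show ?thesis
    unfolding D_hat_def D_disc_def det_2 vector_2 DERIV_imp_deriv[OF theta4_power_deriv[OF assms]]
    by simp
qed

text \<open>Ramanujan's psi, the generating function of the triangular numbers by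
  \<open>psi_product\<close>.\<close>

definition psi :: "complex \<Rightarrow> complex" where "psi y = qE y * qU y ^ 2"

lemma psi_holomorphic: "psi holomorphic_on ball 0 1"
  unfolding psi_def[abs_def] by (intro holomorphic_intros qE_holomorphic qU_holomorphic)

lemma psi_nz: "norm y < 1 \<Longrightarrow> psi y \<noteq> 0"
  by (simp add: psi_def qE_nz qU_nz)

lemma psi_0 [simp]: "psi 0 = 1" by (simp add: psi_def)

lemma th2_psi: "th2 z = 2 * nome (z / 4) * psi (nome (2 * z))"
  by (simp add: th2_def psi_def)

text \<open>Approach to infinity uniformly in the real part, as \<open>theta_level\<close>
  demands.\<close>

definition upinf :: "complex filter" where "upinf = filtercomap Im at_top"

lemma eventually_upinf: "eventually Q upinf \<longleftrightarrow> (\<exists>Y. \<forall>z. Im z \<ge> Y \<longrightarrow> Q z)"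
  unfolding upinf_def by (simp add: eventually_filtercomap_at_top_linorder)

lemma eventually_upinf_pos: "eventually (\<lambda>z. Im z > 0) upinf"
  unfolding eventually_upinf by (intro exI[of _ 1]) auto

lemma filterlim_Im_upinf: "filterlim Im at_top upinf"
  unfolding upinf_def by (rule filterlim_filtercomap)

lemma filterlim_scale_upinf:
  assumes "s > 0"
  shows "filterlim (\<lambda>z. of_real s * z) upinf upinf"
  unfolding upinf_def filterlim_filtercomap_iff
  using filterlim_tendsto_pos_mult_at_top[OF tendsto_const assms filterlim_Im_upinf]
  by (simp add: upinf_def o_def)

lemma nome_tendsto_0: "(nome \<longlongrightarrow> 0) upinf"
proof (rule tendsto_norm_zero_cancel)
  have "filterlim (\<lambda>z. - pi * Im z) at_bot upinf"
    by (rule filterlim_tendsto_neg_mult_at_bot[OF tendsto_const _ filterlim_Im_upinf]) simp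
  from filterlim_compose[OF exp_at_bot this]
  show "((\<lambda>z. norm (nome z)) \<longlongrightarrow> 0) upinf" unfolding norm_nome .
qed

lemma nome_scale_tendsto_0: "s > 0 \<Longrightarrow> ((\<lambda>z. nome (of_real s * z)) \<longlongrightarrow> 0) upinf"
  by (rule filterlim_compose[OF nome_tendsto_0 filterlim_scale_upinf])

lemma disc_tendsto:
  assumes "f holomorphic_on ball 0 1" "(g \<longlongrightarrow> 0) F"
  shows "((\<lambda>z. f (g z)) \<longlongrightarrow> f 0) F"
proof -
  have "isCont f 0"
    using holomorphic_on_imp_continuous_on[OF assms(1)] by (simp add: continuous_on_eq_continuous_at)
  then show ?thesis using assms(2) isCont_tendsto_compose by blast
qed

lemma th3_tendsto: "(th3 \<longlongrightarrow> 1) upinf" and th4_tendsto: "(th4 \<longlongrightarrow> 1) upinf"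
  using disc_tendsto[OF theta4_holomorphic nome_tendsto_0]
    disc_tendsto[OF theta4_holomorphic, of "\<lambda>z. - nome z" upinf] tendsto_minus[OF nome_tendsto_0]
  by (simp_all add: th3_def[abs_def] th4_def[abs_def] theta4_0)

lemma norm_weber_shift: "norm (weber (z + 2 * of_nat k)) = norm (weber z)"
proof (induction k)
  case (Suc k)
  have "z + 2 * of_nat (Suc k) = (z + 2 * of_nat k) + 2" by simp
  then have "norm (weber (z + 2 * of_nat (Suc k))) = norm (nome (1 / 12)) * norm (weber (z + 2 * of_nat k))"
    by (simp only: weber_shift2 norm_mult)
  then show ?case using Suc by (simp add: norm_nome)
qed simp

definition weber_quot :: "complex \<Rightarrow> complex" where
  "weber_quot u = th3 u * th4 u / (8 * psi (nome (2 * u)) ^ 2)"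

lemma weber_quot_tendsto: "(weber_quot \<longlongrightarrow> 1 / 8) upinf"
proof -
  have "((\<lambda>u. psi (nome (of_real 2 * u))) \<longlongrightarrow> psi 0) upinf"
    by (rule disc_tendsto[OF psi_holomorphic nome_scale_tendsto_0]) simp
  then have "((\<lambda>u. th3 u * th4 u / (8 * psi (nome (2 * u)) ^ 2)) \<longlongrightarrow> 1 * 1 / (8 * 1 ^ 2)) upinf"
    by (intro tendsto_intros th3_tendsto th4_tendsto) auto
  then show ?thesis by (simp add: weber_quot_def[abs_def])
qed

text \<open>Shift and inversion permute the theta functions in \<open>weber_power_6\<close> so that
  \<open>th2 u ^ 2\<close> lands in the denominator. Its factor \<open>nome (u / 2)\<close> produces
  the growth, and \<open>weber_quot\<close> is what is left.\<close>

lemma weber_one: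
  assumes u: "Im u > 0"
  shows "norm (weber (1 - 1 / u)) ^ 6 = norm (nome (- u / 2)) * norm (weber_quot u)"
proof -
  define s where "s = csqrt (- \<i> * u)"
  have s: "s \<noteq> 0" using u by (auto simp: s_def)
  define w where "w = - (1 / u)"
  have w: "Im w > 0" unfolding w_def by (rule Im_minus_inverse[OF u])
  have e: "1 - 1 / u = w + 1" by (simp add: w_def)
  have "Im (w + 1) > 0" using w by simp
  from weber_power_6[OF this]
  have "2 * (s * th2 u) ^ 2 * weber (w + 1) ^ 6 = nome (1 / 4) * (s * th4 u) * (s * th3 u)"
    unfolding th3_shift th2_shift th4_shift
    by (simp add: w_def th2_inversion[OF u, folded s_def] th3_inversion[OF u, folded s_def]
      th4_inversion[OF u, folded s_def] del: minus_divide_left)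
  then have "2 * th2 u ^ 2 * weber (w + 1) ^ 6 = nome (1 / 4) * th4 u * th3 u"
    using s by (simp add: power2_eq_square mult.assoc)
  then have eq: "weber (w + 1) ^ 6 = nome (1 / 4) * (th3 u * th4 u / (2 * th2 u ^ 2))"
    using th2_nz[OF u] by (simp add: field_simps)
  have "nome (u / 4) ^ 2 * nome (- u / 2) = 1"
    unfolding nome_power nome_add[symmetric] by (simp add: nome_def)
  then have "2 * th2 u ^ 2 * nome (- u / 2) = 8 * psi (nome (2 * u)) ^ 2"
    unfolding th2_psi power_mult_distrib by (simp add: mult_ac)
  then have "th3 u * th4 u / (2 * th2 u ^ 2) = nome (- u / 2) * weber_quot u"
    using th2_nz[OF u] nome_nz[of "- u / 2"] unfolding weber_quot_def
    by (metis (no_types, lifting) mult.commute nonzero_mult_divide_mult_cancel_left times_divide_eq_right)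
  then have "weber (w + 1) ^ 6 = nome (1 / 4) * (nome (- u / 2) * weber_quot u)" using eq by simp
  then have "norm (weber (w + 1) ^ 6) = norm (nome (1 / 4)) * (norm (nome (- u / 2)) * norm (weber_quot u))"
    by (simp only: norm_mult)
  then show ?thesis by (simp add: e norm_power norm_nome)
qed

context weber_level begin

lemma nome_l: "(- nome z) ^ l = - nome (of_nat l * z)"
  using odd_l by (simp add: nome_power)

lemma Hz_eq_H_disc: "Hz z = H_disc l r (- nome z)"
proof -
  have "(nome (z / 24) * nome (of_nat l * z / 24)) ^ r = nome (of_nat (r * (l + 1)) * z / 24)"
    unfolding nome_add[symmetric] nome_power by (simp add: field_simps)
  also have "\<dots> = nome z" unfolding rl by simp
  finally have *: "(nome (z / 24) * nome (of_nat l * z / 24)) ^ r = nome z" .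
  have "Hz z = - ((nome (z / 24) * nome (of_nat l * z / 24)) ^ r * (qU (- nome z) * qU ((- nome z) ^ l)) ^ r)"
    unfolding Hz_def weber_def nome_l by (simp add: power_mult_distrib mult_ac)
  then show ?thesis unfolding * by (simp add: H_disc_def)
qed

lemma Dz_eq_D_disc:
  assumes z: "Im z > 0"
  shows "Dz z = D_disc l (- nome z)"
proof -
  define x where "x = - nome z"
  have x: "norm x < 1" using norm_nome_less_1[OF z] by (simp add: x_def)
  have x0: "x \<noteq> 0" by (simp add: x_def)
  define A B A' B' where "A = theta4 x" and "B = theta4 (x ^ l)" and "A' = deriv theta4 x"
    and "B' = deriv theta4 (x ^ l) * (of_nat l * x ^ (l - 1))"
  have nz: "A \<noteq> 0" "B \<noteq> 0" using x l_pos by (auto simp: A_def B_def theta4_nz norm_power_less_1)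
  have "((\<lambda>y. (theta4 y / theta4 (y ^ l)) ^ 2) has_field_derivative
      2 * (A / B) * ((A' * B - A * B') / (B * B))) (at x)"
    using nz theta4_deriv[OF x] theta4_power_deriv[OF x l_pos]
    by (auto intro!: derivative_eq_intros simp: A_def B_def A'_def B'_def mult_ac)
  moreover have "((\<lambda>z. - nome z) has_field_derivative of_real pi * \<i> * x) (at z)"
    unfolding nome_def[abs_def] x_def by (auto intro!: derivative_eq_intros)
  ultimately have "((\<lambda>z. (theta4 (- nome z) / theta4 ((- nome z) ^ l)) ^ 2) has_field_derivative
      2 * (A / B) * ((A' * B - A * B') / (B * B)) * (of_real pi * \<i> * x)) (at z)"
    unfolding x_def by (rule DERIV_chain2)
  moreover have "phi = (\<lambda>z. (theta4 (- nome z) / theta4 ((- nome z) ^ l)) ^ 2)"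
    by (simp add: phi_def[abs_def] th3_def nome_l)
  ultimately have d: "deriv phi z = 2 * (A / B) * ((A' * B - A * B') / (B * B)) * (of_real pi * \<i> * x)"
    by (simp add: DERIV_imp_deriv)
  have "th3 z = A" by (simp add: A_def x_def th3_def)
  then have "Dz z = (A * (x * B') - B * (x * A')) / (A ^ 3 * B ^ 3)"
    unfolding Dz_def d using nz by (simp add: field_simps eval_nat_numeral)
  moreover have "x * B' = of_nat l * x ^ l * deriv theta4 (x ^ l)"
    using times_power_diff_1[OF l_pos, of x] by (simp add: B'_def mult_ac)
  ultimately show ?thesis unfolding D_disc_def x_def[symmetric] by (simp add: A_def B_def A'_def)
qed

definition F_disc :: "complex \<Rightarrow> complex" where
  "F_disc x = D_disc l x ^ e - poly P (H_disc l r x)"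

lemma Kz_infinity:
  assumes F: "F_disc \<in> O[at 0](\<lambda>x. x ^ (n + 1))"
  shows "(Kz \<longlongrightarrow> 0) upinf"
proof -
  define h where "h x = (qU x * qU (x ^ l)) ^ r" for x
  have hh: "h holomorphic_on ball 0 1"
    unfolding h_def[abs_def]
    by (intro holomorphic_intros qU_holomorphic holomorphic_disc_compose[OF qU_holomorphic])
      (auto intro!: norm_power_less_1 l_pos)
  have h0: "h 0 = 1" using l_pos by (simp add: h_def zero_power)
  define G where "G x = F_disc x ^ 2 / H_disc l r x ^ (2 * n + 1)" for x
  obtain C where C: "C > 0" "eventually (\<lambda>x. norm (F_disc x) \<le> C * norm (x ^ (n + 1))) (at 0)"
    using F by (elim landau_o.bigE)
  have "((\<lambda>x. C ^ 2 * norm x / norm (h x) ^ (2 * n + 1)) \<longlongrightarrow> C ^ 2 * norm (0::complex) / norm (h 0) ^ (2 * n + 1)) (at 0)"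
    using disc_tendsto[OF hh tendsto_ident_at] h0 by (intro tendsto_intros) auto
  then have lim: "((\<lambda>x. C ^ 2 * norm x / norm (h x) ^ (2 * n + 1)) \<longlongrightarrow> 0) (at 0)" by simp
  have "(G \<longlongrightarrow> 0) (at 0)"
  proof (rule Lim_null_comparison[OF _ lim])
    have "eventually (\<lambda>x::complex. x \<noteq> 0) (at 0)" by (simp add: eventually_at_filter)
    with C(2) show "eventually (\<lambda>x. norm (G x) \<le> C ^ 2 * norm x / norm (h x) ^ (2 * n + 1)) (at 0)"
    proof eventually_elim
      case (elim x)
      have e: "n + 1 + (n + 1) = (2 * n + 1) + 1" by simp
      have "norm (F_disc x) ^ 2 \<le> (C * norm (x ^ (n + 1))) ^ 2" using elim(1) by (intro power_mono) auto
      also have "\<dots> = C ^ 2 * norm x * norm x ^ (2 * n + 1)"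
        unfolding power_mult_distrib norm_power power2_eq_square power_add[symmetric] e
        by (simp add: power_add mult_2 mult_2_right mult_ac)
      finally have "norm (F_disc x) ^ 2 / (norm x ^ (2 * n + 1) * norm (h x) ^ (2 * n + 1)) \<le>
          C ^ 2 * norm x * norm x ^ (2 * n + 1) / (norm x ^ (2 * n + 1) * norm (h x) ^ (2 * n + 1))"
        by (intro divide_right_mono) auto
      also have "\<dots> = C ^ 2 * norm x / norm (h x) ^ (2 * n + 1)" using elim(2) by simp
      also have "norm (F_disc x) ^ 2 / (norm x ^ (2 * n + 1) * norm (h x) ^ (2 * n + 1)) = norm (G x)"
        by (simp only: G_def H_disc_def h_def norm_divide norm_power norm_mult power_mult_distrib)
      finally show ?case .
    qed
  qed
  moreover have "filterlim (\<lambda>z. - nome z) (at 0) upinf"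
    unfolding filterlim_at using tendsto_minus[OF nome_tendsto_0] by simp
  ultimately have "((\<lambda>z. G (- nome z)) \<longlongrightarrow> 0) upinf" by (rule filterlim_compose)
  moreover have "eventually (\<lambda>z. G (- nome z) = Kz z) upinf"
    using eventually_upinf_pos
    by eventually_elim (simp add: G_def Kz_def F_disc_def Dz_eq_D_disc Hz_eq_H_disc)
  ultimately show ?thesis by (rule Lim_transform_eventually)
qed

text \<open>At this cusp \<open>th3\<close> becomes \<open>th2\<close>, for both arguments, because
  \<open>l * (1 - 1 / u)\<close> differs from \<open>1 - 1 / (u / l)\<close> by the even number
  \<open>l - 1\<close>. The common local parameter is \<open>nome (2 * u / l)\<close>, whose
  \<open>l\<close>th power belongs to \<open>th2 u\<close>.\<close>

lemma phi_one:
  assumes u: "Im u > 0"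
  shows "phi (1 - 1 / u) = of_nat l * (nome ((1 - 1 / of_nat l) / 2 * u) *
     (psi (nome (2 * u / of_nat l) ^ l) / psi (nome (2 * u / of_nat l))) ^ 2)"
proof -
  let ?L = "of_nat l :: complex"
  have L: "?L \<noteq> 0" using l_pos by simp
  have sq: "th3 (1 - 1 / w) ^ 2 = - \<i> * w * th2 w ^ 2" if "Im w > 0" for w
  proof -
    have "1 - 1 / w = - (1 / w) + 1" by simp
    then show ?thesis using th4_inversion[OF that] by (simp only: th3_shift) (simp add: power_mult_distrib)
  qed
  obtain k where k: "l = 2 * k + 1" using odd_l by (elim oddE)
  have shift: "th3 (w + 2 * of_nat j) = th3 w" for w j
  proof (induction j)
    case (Suc j)
    have "w + 2 * of_nat (Suc j) = (w + 2 * of_nat j) + 2" by simp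
    then show ?case using Suc by (simp only: th3_shift2)
  qed simp
  have "?L * (1 - 1 / u) = (1 - 1 / (u / ?L)) + 2 * of_nat k"
    using L unfolding k by (simp add: right_diff_distrib add_divide_distrib)
  then have t: "th3 (?L * (1 - 1 / u)) = th3 (1 - 1 / (u / ?L))" by (simp only: shift)
  have "phi (1 - 1 / u) = (u * th2 u ^ 2) / (u / ?L * th2 (u / ?L) ^ 2)"
    unfolding phi_def power_divide t sq[OF u] sq[OF Im_div_l[OF u]] by simp
  also have "\<dots> = ?L * (th2 u / th2 (u / ?L)) ^ 2"
    using u L by (auto simp: power_divide field_simps)
  also have "th2 u / th2 (u / ?L) = nome ((1 - 1 / ?L) / 4 * u) * (psi (nome (2 * u / ?L) ^ l) / psi (nome (2 * u / ?L)))"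
  proof -
    have "nome (2 * u / ?L) ^ l = nome (2 * u)" using L by (simp add: nome_power)
    moreover have "nome (u / 4) = nome ((1 - 1 / ?L) / 4 * u) * nome (u / ?L / 4)"
      unfolding nome_add[symmetric] using L by (intro arg_cong[where f = nome]) (simp add: field_simps)
    ultimately show ?thesis unfolding th2_psi by (simp add: field_simps)
  qed
  also have "(nome ((1 - 1 / ?L) / 4 * u) * (psi (nome (2 * u / ?L) ^ l) / psi (nome (2 * u / ?L)))) ^ 2 =
      nome ((1 - 1 / ?L) / 2 * u) * (psi (nome (2 * u / ?L) ^ l) / psi (nome (2 * u / ?L))) ^ 2"
    unfolding power_mult_distrib nome_power by (simp add: mult.commute)
  finally show ?thesis .
qed

text \<open>The exponent is (1 - 1/l)/2 from \<open>phi\<close> minus 1 from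
  \<open>th2 u ^ 4\<close>. The factors \<open>u ^ 2\<close> from the chain rule and from the
  inversion cancel, so the remainder is holomorphic in the local parameter and has a limit.\<close>

lemma Dz_one:
  obtains S S0 where "(S \<longlongrightarrow> S0) upinf"
    "\<And>u. Im u > 0 \<Longrightarrow> Dz (1 - 1 / u) = nome (- (1 + 1 / of_nat l) / 2 * u) * S u"
proof -
  let ?L = "of_nat l :: complex"
  have L: "?L \<noteq> 0" using l_pos by simp
  define R where "R v = (psi (v ^ l) / psi v) ^ 2" for v
  have psi_l: "(\<lambda>v. psi (v ^ l)) holomorphic_on ball 0 1"
    by (intro holomorphic_disc_compose[OF psi_holomorphic] holomorphic_intros)
      (auto intro!: norm_power_less_1 l_pos)
  have R: "R holomorphic_on ball 0 1"
    unfolding R_def[abs_def] by (intro holomorphic_intros psi_l psi_holomorphic) (auto simp: psi_nz)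
  define a where "a = (1 - 1 / ?L) / 2"
  define m where "m u = nome (2 * u / ?L)" for u
  define S where "S v = ?L * (of_real pi * \<i> * a * R v + (2 * of_real pi * \<i> / ?L) * v * deriv R v) /
     (32 * of_real pi * \<i> * psi (v ^ l) ^ 4)" for v
  have "S holomorphic_on ball 0 1"
    unfolding S_def[abs_def]
    by (intro holomorphic_intros R holomorphic_deriv[OF R] psi_l open_ball)
      (auto simp: psi_nz norm_power_less_1 l_pos)
  moreover have "(m \<longlongrightarrow> 0) upinf"
    using nome_scale_tendsto_0[of "2 / real l"] l_pos by (simp add: m_def[abs_def])
  ultimately have lim: "((\<lambda>u. S (m u)) \<longlongrightarrow> S 0) upinf" by (rule disc_tendsto)
  have "Dz (1 - 1 / u) = nome (- (1 + 1 / ?L) / 2 * u) * S (m u)" if u: "Im u > 0" for u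
  proof -
    define v where "v = m u"
    have u0: "u \<noteq> 0" using u by auto
    have v: "norm v < 1" unfolding v_def m_def using u l_pos by (intro norm_nome_less_1) simp
    let ?w = "1 - 1 / u"
    have w: "Im ?w > 0" using Im_minus_inverse[OF u] by simp
    have "deriv phi ?w * (1 / u ^ 2) = ?L * (of_real pi * \<i> * a * nome (a * u) * R v +
        nome (a * u) * (deriv R v * (of_real pi * \<i> * (2 / ?L) * v)))"
    proof (rule deriv_eq_upper[OF u])
      have "((\<lambda>u. 1 - 1 / u) has_field_derivative 1 / u ^ 2) (at u)"
        using u0 by (auto intro!: derivative_eq_intros simp: power2_eq_square)
      then show "((\<lambda>u. phi (1 - 1 / u)) has_field_derivative deriv phi ?w * (1 / u ^ 2)) (at u)"
        by (rule DERIV_chain2[where f = phi and g = "\<lambda>u. 1 - 1 / u", OF phi_deriv[OF w]])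
      have "(m has_field_derivative of_real pi * \<i> * (2 / ?L) * v) (at u)"
        unfolding m_def[abs_def] v_def nome_def using L by (auto intro!: derivative_eq_intros simp: field_simps)
      moreover have "(R has_field_derivative deriv R v) (at (m u))"
        using holomorphic_derivI[OF R open_ball, of v] v by (simp add: v_def)
      ultimately have "((\<lambda>u. R (m u)) has_field_derivative deriv R v * (of_real pi * \<i> * (2 / ?L) * v)) (at u)"
        by (rule DERIV_chain2[rotated])
      moreover have "((\<lambda>u. nome (a * u)) has_field_derivative of_real pi * \<i> * a * nome (a * u)) (at u)"
        unfolding nome_def by (auto intro!: derivative_eq_intros simp: mult_ac)
      ultimately show "((\<lambda>u. ?L * (nome (a * u) * R (m u))) has_field_derivative
         ?L * (of_real pi * \<i> * a * nome (a * u) * R v + nome (a * u) * (deriv R v * (of_real pi * \<i> * (2 / ?L) * v)))) (at u)"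
        by (auto intro!: derivative_eq_intros simp: v_def algebra_simps)
    qed (simp add: phi_one R_def m_def a_def)
    then have d: "deriv phi ?w = u ^ 2 * ?L * nome (a * u) * (of_real pi * \<i> * a * R v + (2 * of_real pi * \<i> / ?L) * v * deriv R v)"
      using u0 by (simp add: field_simps)
    have "1 - 1 / u = - (1 / u) + 1" by simp
    then have "th3 ?w = csqrt (- \<i> * u) * th2 u" using th4_inversion[OF u] by (simp only: th3_shift)
    then have "th3 ?w ^ 4 = csqrt (- \<i> * u) ^ 4 * th2 u ^ 4" by (simp only: power_mult_distrib)
    also note csqrt_power_4
    also have "th2 u ^ 4 = 16 * nome u * psi (v ^ l) ^ 4"
    proof -
      have "v ^ l = nome (2 * u)" unfolding v_def m_def using L by (simp add: nome_power)
      then show ?thesis unfolding th2_psi power_mult_distrib nome_power by simp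
    qed
    finally have t: "th3 ?w ^ 4 = - (u ^ 2) * (16 * nome u * psi (v ^ l) ^ 4)" .
    have "nome (a * u) = nome (- (1 + 1 / ?L) / 2 * u) * nome u"
      unfolding nome_add[symmetric] a_def using L by (intro arg_cong[where f = nome]) (simp add: field_simps)
    moreover have "- (u ^ 2 * ?L * (b * q) * X) / (2 * of_real pi * \<i> * (- (u ^ 2) * (16 * q * y))) =
        b * (?L * X / (32 * of_real pi * \<i> * y))" if "q \<noteq> 0" for b q X y :: complex
      using that u0 by (simp add: mult_ac)
    ultimately show ?thesis
      unfolding Dz_def d t v_def[symmetric] S_def by simp
  qed
  then show ?thesis using that lim by blast
qed

lemma Hz_one:
  assumes u: "Im u > 0"
  shows "norm (Hz (1 - 1 / u)) ^ 6 = (norm (nome (- (1 + 1 / of_nat l) / 2 * u)) *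
     (norm (weber_quot u) * norm (weber_quot (u / of_nat l)))) ^ r"
proof -
  let ?L = "of_nat l :: complex"
  have L: "?L \<noteq> 0" using l_pos by simp
  obtain k where k: "l = 2 * k + 1" using odd_l by (elim oddE)
  have e: "?L * (1 - 1 / u) = (1 - 1 / (u / ?L)) + 2 * of_nat k"
    using L unfolding k by (simp add: right_diff_distrib add_divide_distrib)
  have n: "norm (nome (- (1 + 1 / ?L) / 2 * u)) = norm (nome (- u / 2)) * norm (nome (- (u / ?L) / 2))"
    unfolding norm_mult[symmetric] nome_add[symmetric]
    by (intro arg_cong[where f = "\<lambda>z. norm (nome z)"]) (simp add: field_simps)
  have "norm (Hz (1 - 1 / u)) ^ 6 = (norm (weber (1 - 1 / u)) ^ 6 * norm (weber (1 - 1 / (u / ?L))) ^ 6) ^ r"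
    unfolding Hz_def e norm_minus_cancel norm_power norm_mult norm_weber_shift
    by (simp add: power_mult_distrib mult.commute flip: power_mult)
  then show ?thesis
    unfolding weber_one[OF u] weber_one[OF Im_div_l[OF u]] n by (simp add: mult_ac)
qed

lemma r_pos: "r > 0" using rl by (cases r) auto

text \<open>Both \<open>Dz ^ e\<close> and \<open>poly P\<close> at \<open>Hz\<close> are bounded by
  a multiple of the \<open>n\<close>th power of \<open>norm Hz\<close>, which tends to infinity; the
  odd exponent in \<open>Kz\<close> leaves one factor to spare.\<close>

lemma Kz_one: "((\<lambda>u. Kz (1 - 1 / u)) \<longlongrightarrow> 0) upinf"
proof -
  let ?L = "of_nat l :: complex"
  obtain S S0 where S: "(S \<longlongrightarrow> S0) upinf"
    "\<And>u. Im u > 0 \<Longrightarrow> Dz (1 - 1 / u) = nome (- (1 + 1 / ?L) / 2 * u) * S u"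
    using Dz_one by blast
  define b where "b u = norm (nome (- (1 + 1 / ?L) / 2 * u))" for u
  define q where "q u = norm (weber_quot u) * norm (weber_quot (u / ?L))" for u
  define h where "h u = norm (Hz (1 - 1 / u))" for u
  have b_pos: "b u > 0" for u by (simp add: b_def)
  have "((\<lambda>u. weber_quot (of_real (1 / real l) * u)) \<longlongrightarrow> 1 / 8) upinf"
    using l_pos by (intro filterlim_compose[OF weber_quot_tendsto] filterlim_scale_upinf) simp
  then have "(q \<longlongrightarrow> norm (1 / 8 :: complex) * norm (1 / 8 :: complex)) upinf"
    unfolding q_def[abs_def] by (intro tendsto_intros weber_quot_tendsto) simp
  then have q: "(q \<longlongrightarrow> 1 / 64) upinf" by simp
  have q_pos: "eventually (\<lambda>u. q u > 0) upinf"
    using order_tendstoD(1)[OF q, of 0] by simp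
  have b_inf: "filterlim b at_top upinf"
  proof -
    have bu: "b u = exp (pi * (1 + 1 / real l) / 2 * Im u)" for u
    proof -
      have e: "- (1 + 1 / ?L) / 2 * u = of_real (- (1 + 1 / real l) / 2) * u" by simp
      have "- pi * Im (of_real (- (1 + 1 / real l) / 2) * u) = pi * (1 + 1 / real l) / 2 * Im u"
        by (simp add: field_simps)
      then show ?thesis unfolding b_def norm_nome e by (rule arg_cong)
    qed
    have "filterlim (\<lambda>u. pi * (1 + 1 / real l) / 2 * Im u) at_top upinf"
      by (rule filterlim_tendsto_pos_mult_at_top[OF tendsto_const _ filterlim_Im_upinf])
        (simp add: add_pos_nonneg)
    from filterlim_compose[OF exp_at_top this] show ?thesis unfolding bu[symmetric] .
  qed
  have h6: "h u ^ 6 = (b u * q u) ^ r" if "Im u > 0" for u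
    unfolding h_def b_def q_def by (rule Hz_one[OF that])
  have bq_inf: "filterlim (\<lambda>u. b u * q u) at_top upinf"
    by (rule filterlim_at_top_mult_tendsto_pos[OF q _ b_inf]) simp
  have h_inf: "filterlim h at_top upinf"
    unfolding filterlim_at_top_ge[where c = 1]
  proof (intro allI impI)
    fix M :: real assume M: "M \<ge> 1"
    have "eventually (\<lambda>u. b u * q u \<ge> M ^ 6) upinf" using bq_inf by (simp add: filterlim_at_top)
    with eventually_upinf_pos show "eventually (\<lambda>u. M \<le> h u) upinf"
    proof eventually_elim
      case (elim u)
      have "1 \<le> M ^ 6" using M by (rule one_le_power)
      then have "1 \<le> b u * q u" using elim by linarith
      then have "(b u * q u) ^ 1 \<le> (b u * q u) ^ r" using r_pos by (intro power_increasing) auto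
      then have "M ^ 6 \<le> h u ^ 6" using elim by (simp add: h6)
      then show ?case by (rule power_le_imp_le_base[of _ 5, simplified]) (simp add: h_def)
    qed
  qed
  \<comment> \<open>The growth of \<open>Hz\<close> is known for sixth powers only;
    \<open>rn\<close> is what makes the comparison of exponents exact.\<close>
  have hn: "h u ^ n = (b u * q u) ^ e" if "Im u > 0" "q u > 0" for u
  proof -
    have "(h u ^ n) ^ 6 = (h u ^ 6) ^ n" by (simp add: mult.commute flip: power_mult)
    also have "\<dots> = (b u * q u) ^ (6 * e)" unfolding h6[OF that(1)] rn[symmetric] by (rule power_mult[symmetric])
    also have "\<dots> = ((b u * q u) ^ e) ^ 6" by (simp add: mult.commute flip: power_mult)
    finally show ?thesis
      by (rule power_eq_imp_eq_base) (use that b_pos[of u] in \<open>auto simp: h_def\<close>)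
  qed
  define B1 where "B1 = (norm S0 / (1 / 64)) ^ e + 1"
  have "((\<lambda>u. (norm (S u) / q u) ^ e) \<longlongrightarrow> (norm S0 / (1 / 64)) ^ e) upinf"
    by (intro tendsto_intros S q) simp
  then have ev1: "eventually (\<lambda>u. (norm (S u) / q u) ^ e < B1) upinf"
    by (rule order_tendstoD) (simp add: B1_def)
  define B2 where "B2 = (\<Sum>i\<le>degree P. norm (coeff P i))"
  have B2: "norm (poly P y) \<le> B2 * norm y ^ n" if "norm y \<ge> 1" for y
  proof -
    have "norm (poly P y) \<le> (\<Sum>i\<le>degree P. norm (coeff P i * y ^ i))"
      unfolding poly_altdef by (rule norm_sum)
    also have "\<dots> \<le> (\<Sum>i\<le>degree P. norm (coeff P i) * norm y ^ n)"
      unfolding norm_mult norm_power using that deg_P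
      by (intro sum_mono mult_left_mono power_increasing) auto
    finally show ?thesis by (simp add: B2_def sum_distrib_right)
  qed
  have "eventually (\<lambda>u. h u \<ge> 1) upinf" using h_inf by (simp add: filterlim_at_top)
  with eventually_upinf_pos q_pos ev1
  have "eventually (\<lambda>u. norm (Kz (1 - 1 / u)) \<le> (B1 + B2) ^ 2 / h u) upinf"
  proof eventually_elim
    case (elim u)
    let ?D = "Dz (1 - 1 / u)" and ?H = "Hz (1 - 1 / u)"
    have h: "h u > 0" using elim by linarith
    have "norm (?D ^ e) = (b u * norm (S u)) ^ e"
      unfolding S(2)[OF elim(1)] b_def by (simp add: norm_mult norm_power)
    also have "\<dots> = (norm (S u) / q u) ^ e * h u ^ n"
      unfolding hn[OF elim(1,2)] power_mult_distrib[symmetric] using elim(2) by (simp add: mult.commute)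
    also have "\<dots> \<le> B1 * h u ^ n" using elim h by (intro mult_right_mono) auto
    finally have "norm (?D ^ e - poly P ?H) \<le> B1 * h u ^ n + B2 * h u ^ n"
      using B2[of ?H] elim by (intro norm_triangle_le_diff add_mono) (auto simp: h_def)
    then have "norm (?D ^ e - poly P ?H) ^ 2 \<le> ((B1 + B2) * h u ^ n) ^ 2"
      by (intro power_mono) (auto simp: distrib_right)
    then have "norm (Kz (1 - 1 / u)) \<le> ((B1 + B2) * h u ^ n) ^ 2 / h u ^ (2 * n + 1)"
      unfolding Kz_def norm_divide norm_power h_def[symmetric] using h by (intro divide_right_mono) auto
    also have "\<dots> = (B1 + B2) ^ 2 / h u"
      using h by (simp add: power_mult_distrib power_mult[symmetric] power_add mult.commute)
    finally show ?case .
  qed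
  moreover have "((\<lambda>u. (B1 + B2) ^ 2 / h u) \<longlongrightarrow> 0) upinf"
    by (rule real_tendsto_divide_at_top[OF tendsto_const h_inf])
  ultimately show ?thesis by (rule Lim_null_comparison)
qed

theorem F_disc_eq_0:
  assumes F: "F_disc \<in> O[at 0](\<lambda>x. x ^ (n + 1))" and z: "Im z > 0"
  shows "F_disc (- nome z) = 0"
proof -
  interpret theta_level l Kz
  proof
    show "\<exists>Y. \<forall>z. Y \<le> Im z \<longrightarrow> norm (Kz z) < a" if "a > 0" for a
      using tendstoD[OF Kz_infinity[OF F] that] by (simp add: eventually_upinf)
    show "\<exists>Y. \<forall>u. Y \<le> Im u \<longrightarrow> norm (Kz (1 - 1 / u)) < a" if "a > 0" for a
      using tendstoD[OF Kz_one that] by (simp add: eventually_upinf)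
  qed (auto simp: prime_l odd_l Kz_holomorphic Kz_inv Kz_fricke)
  have "Kz z = 0" by (rule K_eq_0[OF z])
  then have "Dz z ^ e - poly P (Hz z) = 0" using Hz_nz[OF z] by (simp add: Kz_def)
  then show ?thesis by (simp add: F_disc_def Dz_eq_D_disc[OF z] Hz_eq_H_disc)
qed

end

section \<open>Taylor coefficients\<close>

text \<open>Boundedness is included because congruences can be multiplied only for bounded factors.
  The polynomial need not be reduced, so products may stay unexpanded.\<close>

definition taylor_cong :: "nat \<Rightarrow> (complex \<Rightarrow> complex) \<Rightarrow> complex poly \<Rightarrow> bool" where
  "taylor_cong N f p \<longleftrightarrow> f \<in> O[at 0](\<lambda>_. 1) \<and> (\<lambda>x. f x - poly p x) \<in> O[at 0](\<lambda>x. x ^ N)"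

lemma tendsto_bigo_1: "(f \<longlongrightarrow> (c :: complex)) (at (0 :: complex)) \<Longrightarrow> f \<in> O[at 0](\<lambda>_. 1)"
  by (rule bigoI_tendsto[where c = c]) auto

lemma poly_bigo_1: "poly p \<in> O[at (0 :: complex)](\<lambda>_. 1 :: complex)"
  by (rule tendsto_bigo_1[OF isContD[OF poly_isCont]])

lemma power_bigo_mono: "M \<le> N \<Longrightarrow> (\<lambda>x :: complex. x ^ N) \<in> O[at 0](\<lambda>x. x ^ M)"
proof -
  assume "M \<le> N"
  then have "(\<lambda>x :: complex. x ^ N) = (\<lambda>x. x ^ M * x ^ (N - M))"
    by (simp flip: power_add)
  moreover have *: "(\<lambda>x :: complex. x ^ (N - M)) \<in> O[at 0](\<lambda>_. 1)"
    by (rule tendsto_bigo_1[of _ "0 ^ (N - M)"]) (intro tendsto_intros)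
  ultimately show ?thesis
    using landau_o.big.mult[OF landau_o.big_refl[of "\<lambda>x. x ^ M"] *] by (simp only: mult_1_right)
qed

lemma taylor_mono: "taylor_cong N f p \<Longrightarrow> M \<le> N \<Longrightarrow> taylor_cong M f p"
  unfolding taylor_cong_def using power_bigo_mono landau_o.big_trans by blast

lemma taylor_poly: "taylor_cong N (poly p) p" by (simp add: taylor_cong_def poly_bigo_1)

lemma taylor_const: "taylor_cong N (\<lambda>_. c) [:c:]" using taylor_poly[of N "[:c:]"] by (simp add: taylor_cong_def)

lemma taylor_diff: "taylor_cong N f p \<Longrightarrow> taylor_cong N g q \<Longrightarrow> taylor_cong N (\<lambda>x. f x - g x) (p - q)"
proof -
  assume "taylor_cong N f p" "taylor_cong N g q"
  then have "(\<lambda>x. f x - g x) \<in> O[at 0](\<lambda>_. 1)" "(\<lambda>x. (f x - poly p x) - (g x - poly q x)) \<in> O[at 0](\<lambda>x. x ^ N)"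
    unfolding taylor_cong_def by (auto simp only: intro!: sum_in_bigo(2))
  then show ?thesis by (simp add: taylor_cong_def algebra_simps)
qed

lemma taylor_mult: "taylor_cong N f p \<Longrightarrow> taylor_cong N g q \<Longrightarrow> taylor_cong N (\<lambda>x. f x * g x) (p * q)"
proof -
  assume *: "taylor_cong N f p" "taylor_cong N g q"
  have "(\<lambda>x. f x * (g x - poly q x)) \<in> O[at 0](\<lambda>x. 1 * x ^ N)"
    "(\<lambda>x. poly q x * (f x - poly p x)) \<in> O[at 0](\<lambda>x. 1 * x ^ N)"
    "(\<lambda>x. f x * g x) \<in> O[at 0](\<lambda>x. 1 * 1)"
    using * poly_bigo_1[of q] unfolding taylor_cong_def by (auto simp only: intro!: landau_o.big.mult)
  then have "(\<lambda>x. f x * (g x - poly q x) + poly q x * (f x - poly p x)) \<in> O[at 0](\<lambda>x. x ^ N)"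
    "(\<lambda>x. f x * g x) \<in> O[at 0](\<lambda>x. 1)"
    by (auto simp only: mult_1_left intro!: sum_in_bigo(1))
  then show ?thesis by (simp add: taylor_cong_def algebra_simps)
qed

lemma taylor_power: "taylor_cong N f p \<Longrightarrow> taylor_cong N (\<lambda>x. f x ^ k) (p ^ k)"
proof (induction k)
  case 0
  then show ?case using taylor_const[of N 1] by (simp add: one_pCons)
next
  case (Suc k)
  then show ?case using taylor_mult[of N f p "\<lambda>x. f x ^ k" "p ^ k"] by simp
qed

lemma taylor_poly_compose: "taylor_cong N f p \<Longrightarrow> taylor_cong N (\<lambda>x. poly P (f x)) (pcompose P p)"
proof (induction P)
  case 0
  then show ?case using taylor_const[of N 0] by simp
next
  case (pCons a P)
  have "taylor_cong N (\<lambda>x. a - (- 1) * (f x * poly P (f x))) ([:a:] - [:-1:] * (p * pcompose P p))"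
    by (intro taylor_diff taylor_mult taylor_const pCons)
  then show ?case by (simp add: pcompose_pCons)
qed

lemma taylor_shift: "taylor_cong N f p \<Longrightarrow> taylor_cong (N + 1) (\<lambda>x. x * f x) ([:0, 1:] * p)"
proof -
  assume *: "taylor_cong N f p"
  have "taylor_cong 0 (\<lambda>x. poly [:0, 1:] x * f x) ([:0, 1:] * p)"
    by (intro taylor_mult taylor_poly taylor_mono[OF *]) simp
  then have 1: "(\<lambda>x. x * f x) \<in> O[at 0](\<lambda>_. 1)" by (simp add: taylor_cong_def)
  have "(\<lambda>x. x * (f x - poly p x)) \<in> O[at 0](\<lambda>x. x * x ^ N)"
    using * by (intro landau_o.big.mult) (auto simp: taylor_cong_def)
  with 1 show ?thesis by (simp add: taylor_cong_def algebra_simps)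
qed

lemma pCons_0_power_bigo: "poly ((pCons 0 ^^ N) q) \<in> O[at 0](\<lambda>x :: complex. x ^ N)"
proof -
  have "poly ((pCons 0 ^^ N) q) x = x ^ N * poly q x" for x
    by (induction N) (simp_all add: mult_ac)
  then have e: "poly ((pCons 0 ^^ N) q) = (\<lambda>x. x ^ N * poly q x)" by auto
  show ?thesis
    unfolding e using landau_o.big.mult[OF landau_o.big_refl[of "\<lambda>x. x ^ N"] poly_bigo_1[of q]]
    by (simp only: mult_1_right)
qed

lemma taylor_truncate:
  assumes "taylor_cong N f p" "p = p' + (pCons 0 ^^ N) q"
  shows "taylor_cong N f p'"
proof -
  have "(\<lambda>x. f x - poly p x) \<in> O[at 0](\<lambda>x. x ^ N)" using assms(1) by (simp add: taylor_cong_def)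
  from sum_in_bigo(1)[OF this pCons_0_power_bigo[of N q]] show ?thesis
    using assms(1) unfolding assms(2) by (simp add: taylor_cong_def)
qed

lemma taylor_imp_bigo:
  assumes "taylor_cong N f p" "p = (pCons 0 ^^ N) q"
  shows "f \<in> O[at 0](\<lambda>x. x ^ N)"
  using taylor_truncate[of N f p 0 q] assms by (simp add: taylor_cong_def)

lemma holomorphic_bigo_1:
  assumes "f holomorphic_on ball 0 1"
  shows "f \<in> O[at 0](\<lambda>_. 1)"
  by (rule tendsto_bigo_1[OF disc_tendsto[OF assms tendsto_ident_at]])

lemma taylor_subst_power:
  assumes f: "f holomorphic_on ball 0 1" and l: "N \<le> l" "l > 0"
  shows "taylor_cong N (\<lambda>x. f (x ^ l)) [:f 0:]"
proof -
  have "(f has_field_derivative deriv f 0) (at 0)"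
    using holomorphic_derivI[OF f open_ball, of 0] by simp
  then have "((\<lambda>x. (f x - f 0) / x) \<longlongrightarrow> deriv f 0) (at 0)"
    by (simp add: has_field_derivative_iff)
  then have "(\<lambda>x. f x - f 0) \<in> O[at 0](\<lambda>x. x)"
    by (rule bigoI_tendsto) (simp add: eventually_at_filter)
  moreover have "filterlim (\<lambda>x::complex. x ^ l) (at 0) (at 0)"
    unfolding filterlim_at
  proof
    have "((\<lambda>x::complex. x ^ l) \<longlongrightarrow> 0 ^ l) (at 0)" by (intro tendsto_intros)
    then show "((\<lambda>x::complex. x ^ l) \<longlongrightarrow> 0) (at 0)" using l by (simp add: zero_power)
  qed (unfold eventually_at_filter, simp)
  ultimately have "(\<lambda>x. f (x ^ l) - f 0) \<in> O[at 0](\<lambda>x. x ^ l)"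
    by (rule landau_o.big.compose)
  then have 1: "(\<lambda>x. f (x ^ l) - f 0) \<in> O[at 0](\<lambda>x. x ^ N)"
    using power_bigo_mono[OF l(1)] landau_o.big_trans by blast
  have "(\<lambda>x. f (x ^ l)) holomorphic_on ball 0 1"
    by (intro holomorphic_disc_compose[OF f] holomorphic_intros) (auto intro: norm_power_less_1 l)
  from holomorphic_bigo_1[OF this] 1 show ?thesis by (simp add: taylor_cong_def)
qed

text \<open>Unlike general O-estimates, those for holomorphic functions can be differentiated:
  Cauchy's inequality on the disc of radius \<open>norm x / 2\<close> about \<open>x\<close> costs
  one order.\<close>

lemma deriv_bigo:
  assumes f: "f holomorphic_on ball 0 1" and b: "f \<in> O[at 0](\<lambda>x. x ^ Suc N)"
  shows "deriv f \<in> O[at 0](\<lambda>x. x ^ N)"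
proof -
  obtain C where C: "C > 0" "eventually (\<lambda>x. norm (f x) \<le> C * norm (x ^ Suc N)) (at 0)"
    using b by (elim landau_o.bigE)
  from C(2) obtain d where d: "d > 0" "\<And>x. x \<noteq> 0 \<Longrightarrow> norm x < d \<Longrightarrow> norm (f x) \<le> C * norm x ^ Suc N"
    unfolding eventually_at by (auto simp: norm_power dist_norm norm_mult)
  show ?thesis
  proof (rule bigoI)
    show "eventually (\<lambda>x. norm (deriv f x) \<le> (C * 2 ^ Suc N * 2) * norm (x ^ N)) (at 0)"
      unfolding eventually_at
    proof (intro exI[of _ "min (d / 2) (1 / 2)"] conjI ballI impI)
      fix x :: complex assume "x \<noteq> 0 \<and> dist x 0 < min (d / 2) (1 / 2)"
      then have x: "x \<noteq> 0" "norm x < d / 2" "norm x < 1 / 2" by auto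
      define s where "s = norm x / 2"
      have s: "s > 0" using x by (simp add: s_def)
      have near: "norm y \<le> 2 * norm x" "y \<noteq> 0" if "dist x y \<le> s" for y
      proof -
        have "norm (y - x) \<le> norm x / 2" using that by (simp add: s_def dist_norm norm_minus_commute)
        then show "norm y \<le> 2 * norm x" using norm_triangle_sub[of y x] norm_ge_zero[of x] by linarith
        show "y \<noteq> 0" using that s x by (auto simp: s_def dist_norm)
      qed
      have sub: "cball x s \<subseteq> ball 0 1" using near x by (force intro: le_less_trans)
      have "norm ((deriv ^^ 1) f x) \<le> fact 1 * (C * (2 * norm x) ^ Suc N) / s ^ 1"
      proof (rule Cauchy_inequality)
        show "f holomorphic_on ball x s" using f sub ball_subset_cball holomorphic_on_subset by blast
        show "continuous_on (cball x s) f"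
          using f sub holomorphic_on_imp_continuous_on continuous_on_subset by blast
        fix y assume "norm (x - y) = s"
        then have y: "norm y \<le> 2 * norm x" "y \<noteq> 0" using near[of y] by (auto simp: dist_norm)
        then have "norm (f y) \<le> C * norm y ^ Suc N" using x by (intro d) auto
        also have "\<dots> \<le> C * (2 * norm x) ^ Suc N" using C y by (intro mult_left_mono power_mono) auto
        finally show "norm (f y) \<le> C * (2 * norm x) ^ Suc N" .
      qed (rule s)
      also have "fact 1 * (C * (2 * norm x) ^ Suc N) / s ^ 1 = C * 2 ^ Suc N * 2 * norm (x ^ N)"
        using x by (simp add: s_def power_mult_distrib norm_power)
      finally show "norm (deriv f x) \<le> C * 2 ^ Suc N * 2 * norm (x ^ N)" by simp
    qed (use d in auto)
  qed
qed

section \<open>Explicit expansions of the theta and partition series\<close>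

lemma bigo_of_bound:
  assumes "\<And>x. norm x \<le> 1 / 2 \<Longrightarrow> norm (f x) \<le> C * norm x ^ N"
  shows "f \<in> O[at (0::complex)](\<lambda>x. x ^ N :: complex)"
proof (rule bigoI)
  show "eventually (\<lambda>x. norm (f x) \<le> C * norm (x ^ N)) (at 0)"
    unfolding eventually_at using assms by (intro exI[of _ "1/2"]) (auto simp: norm_power)
qed

text \<open>The next square exponent is 9, and the tail from index 3 on is dominated by a geometric
  series.\<close>

lemma theta4_taylor: "taylor_cong 9 theta4 [:1, -2, 0, 0, 2:]"
proof -
  have "norm (theta4 x - poly [:1, -2, 0, 0, 2:] x) \<le> 4 * norm x ^ 9" if x: "norm x \<le> 1 / 2" for x
  proof -
    have x1: "norm x < 1" using x by linarith
    note s = theta4_sums[OF x1]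
    have "(\<lambda>n. (-x) ^ ((n + 3) ^ 2)) sums ((theta4 x + 1) / 2 - (\<Sum>n<3. (-x) ^ (n ^ 2)))"
      using sums_split_initial_segment[OF s, of 3] .
    also have "(\<Sum>n<3. (-x) ^ (n ^ 2)) = 1 - x + x ^ 4" by (simp add: eval_nat_numeral)
    finally have S: "(\<lambda>n. (-x) ^ ((n + 3) ^ 2)) sums ((theta4 x + 1) / 2 - (1 - x + x ^ 4))" .
    have "norm (\<Sum>n. (-x) ^ ((n + 3) ^ 2)) \<le> (\<Sum>n. norm x ^ 9 * (1 / 2) ^ n)"
    proof (rule norm_suminf_le)
      fix n
      have "norm ((-x) ^ ((n + 3) ^ 2)) = norm x ^ ((n + 3) ^ 2)" by (simp add: norm_power)
      also have "\<dots> \<le> norm x ^ (9 + n)"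
        using x1 by (intro power_decreasing) (auto simp: power2_eq_square algebra_simps)
      also have "\<dots> = norm x ^ 9 * norm x ^ n" by (rule power_add)
      also have "\<dots> \<le> norm x ^ 9 * (1 / 2) ^ n" using x by (intro mult_left_mono power_mono) auto
      finally show "norm ((-x) ^ ((n + 3) ^ 2)) \<le> norm x ^ 9 * (1 / 2) ^ n" .
    qed (intro summable_mult summable_geometric, simp)
    also have "\<dots> = 2 * norm x ^ 9"
      by (subst suminf_mult) (simp_all add: suminf_geometric summable_geometric)
    finally have "norm ((theta4 x + 1) / 2 - (1 - x + x ^ 4)) \<le> 2 * norm x ^ 9"
      using S by (simp add: sums_iff)
    moreover have "theta4 x - poly [:1, -2, 0, 0, 2:] x = 2 * ((theta4 x + 1) / 2 - (1 - x + x ^ 4))"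
      by (simp add: algebra_simps eval_nat_numeral add_divide_distrib)
    ultimately show ?thesis by (simp only: norm_mult) simp
  qed
  from bigo_of_bound[of "\<lambda>x. theta4 x - poly [:1, -2, 0, 0, 2:] x" 4 9, OF this]
  show ?thesis using holomorphic_bigo_1[OF theta4_holomorphic] by (simp only: taylor_cong_def)
qed

text \<open>The order lost by differentiation is regained by the factor \<open>x\<close>.\<close>

lemma theta4_deriv_taylor: "taylor_cong 9 (\<lambda>x. x * deriv theta4 x) [:0, -2, 0, 0, 8:]"
proof -
  let ?p = "[:1, -2, 0, 0, 2:] :: complex poly"
  have h: "(\<lambda>x. theta4 x - poly ?p x) holomorphic_on ball 0 1"
    by (intro holomorphic_intros theta4_holomorphic)
  have "deriv (\<lambda>x. theta4 x - poly ?p x) \<in> O[at 0](\<lambda>x. x ^ 8)"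
    using theta4_taylor by (intro deriv_bigo h) (simp add: taylor_cong_def)
  moreover have "eventually (\<lambda>x. deriv (\<lambda>x. theta4 x - poly ?p x) x = deriv theta4 x - poly (pderiv ?p) x) (at 0)"
    unfolding eventually_at
  proof (intro exI[of _ 1] conjI ballI impI)
    fix x :: complex assume "x \<noteq> 0 \<and> dist x 0 < 1"
    then have "((\<lambda>x. theta4 x - poly ?p x) has_field_derivative deriv theta4 x - poly (pderiv ?p) x) (at x)"
      by (intro DERIV_diff theta4_deriv poly_DERIV) simp
    then show "deriv (\<lambda>x. theta4 x - poly ?p x) x = deriv theta4 x - poly (pderiv ?p) x"
      by (rule DERIV_imp_deriv)
  qed simp
  ultimately have "(\<lambda>x. deriv theta4 x - poly (pderiv ?p) x) \<in> O[at 0](\<lambda>x. x ^ 8)"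
    by (subst (asm) landau_o.big.in_cong) auto
  moreover have "deriv theta4 \<in> O[at 0](\<lambda>_. 1)"
    by (intro holomorphic_bigo_1 holomorphic_deriv theta4_holomorphic open_ball)
  ultimately have "taylor_cong 8 (deriv theta4) (pderiv ?p)" by (simp add: taylor_cong_def)
  from taylor_shift[OF this] show ?thesis by (simp add: pderiv_pCons)
qed

text \<open>The coefficients count partitions into distinct parts. Five factors determine them below
  order 6, since the product of the others is 1 up to that order.\<close>

lemma qU_taylor: "taylor_cong 6 qU [:1, 1, 1, 2, 2, 3:]"
proof -
  let ?p = "\<Prod>k<5. [:1:] + [:0, 1:] ^ Suc k :: complex poly"
  have "norm (qU x - poly ?p x) \<le> 128 * norm x ^ 6" if x: "norm x \<le> 1 / 2" for x
  proof -
    have x1: "norm x < 1" using x by linarith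
    have p: "poly ?p x = (\<Prod>k<5. 1 + x ^ Suc k)" by (simp add: poly_prod)
    have lim: "(\<lambda>M. (\<Prod>k<M. 1 + x ^ Suc (k + 5)) - 1) \<longlonglongrightarrow> (\<Prod>k. 1 + x ^ Suc (k + 5)) - 1"
    proof -
      have "convergent_prod (\<lambda>k. 1 + x ^ Suc (k + 5))"
        using conv_qU[OF x1] by (subst convergent_prod_iff_shift[of "\<lambda>k. 1 + x ^ Suc k"])
      from LIMSEQ_prod[OF this] show ?thesis by (intro tendsto_intros)
    qed
    have bound: "norm ((\<Prod>k<M. 1 + x ^ Suc (k + 5)) - 1) \<le> 4 * norm x ^ 6" for M
    proof -
      define s where "s = (\<Sum>k<M. norm (x ^ Suc (k + 5)))"
      have "s \<le> (\<Sum>k<M. norm x ^ 6 * (1 / 2) ^ k)"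
        unfolding s_def
      proof (rule sum_mono)
        fix k
        have "norm (x ^ Suc (k + 5)) = norm x ^ 6 * norm x ^ k"
          unfolding norm_power power_add[symmetric] by (rule arg_cong[where f = "power (norm x)"]) simp
        also have "\<dots> \<le> norm x ^ 6 * (1 / 2) ^ k" using x by (intro mult_left_mono power_mono) auto
        finally show "norm (x ^ Suc (k + 5)) \<le> norm x ^ 6 * (1 / 2) ^ k" .
      qed
      also have "\<dots> = norm x ^ 6 * (\<Sum>k<M. (1 / 2) ^ k)" by (simp add: sum_distrib_left)
      also have "\<dots> \<le> norm x ^ 6 * 2"
        by (intro mult_left_mono) (simp_all add: sum_gp_strict)
      finally have s: "s \<le> 2 * norm x ^ 6" by simp
      have "norm x ^ 6 \<le> 1 / 64" using power_mono[OF x norm_ge_zero, of 6] by (simp add: power_divide)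
      then have s1: "s \<le> 1" using s by linarith
      have s0: "s \<ge> 0" by (simp add: s_def sum_nonneg)
      have "norm ((\<Prod>k<M. 1 + x ^ Suc (k + 5)) - 1) \<le> (\<Prod>k<M. 1 + norm (x ^ Suc (k + 5))) - 1"
        by (rule norm_prod_minus1_le_prod_minus1)
      also have "\<dots> \<le> exp s - 1"
        unfolding s_def using prod_le_exp_sum[of "{..<M}" "\<lambda>k. norm (x ^ Suc (k + 5))"] by simp
      also have "\<dots> \<le> s + s\<^sup>2" using exp_bound[OF s0 s1] by simp
      also have "\<dots> \<le> 2 * s" using s0 s1 by (simp add: power2_eq_square mult_left_le)
      finally show ?thesis using s by simp
    qed
    have T: "norm ((\<Prod>k. 1 + x ^ Suc (k + 5)) - 1) \<le> 4 * norm x ^ 6"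
      by (rule tendsto_upperbound[OF tendsto_norm[OF lim] always_eventually[OF allI[OF bound]] sequentially_bot])
    have ne: "1 + x ^ Suc k \<noteq> 0" for k
      using power_Suc_neq_unit[OF x1, of "Suc k" "-1"] by (simp add: add_eq_0_iff)
    have "qU x = poly ?p x * (\<Prod>k. 1 + x ^ Suc (k + 5))"
      unfolding qU_def p using prodinf_split_initial_segment[OF conv_qU[OF x1] ne, of 5] by (simp add: mult.commute)
    then have "qU x - poly ?p x = poly ?p x * ((\<Prod>k. 1 + x ^ Suc (k + 5)) - 1)"
      by (simp add: right_diff_distrib)
    moreover have "norm (poly ?p x) \<le> (\<Prod>k<5::nat. 2)"
      unfolding p prod_norm[symmetric]
    proof (intro prod_mono conjI norm_ge_zero)
      fix k
      have "norm (1 + x ^ Suc k) \<le> norm (1::complex) + norm (x ^ Suc k)" by (rule norm_triangle_ineq)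
      also have "norm (x ^ Suc k) \<le> 1" unfolding norm_power using x1 by (intro power_le_one) auto
      finally show "norm (1 + x ^ Suc k) \<le> 2" by simp
    qed
    ultimately have "norm (qU x - poly ?p x) \<le> 32 * (4 * norm x ^ 6)"
      using T by (simp only: norm_mult) (intro mult_mono, simp_all)
    then show ?thesis by simp
  qed
  from bigo_of_bound[of "\<lambda>x. qU x - poly ?p x" 128 6, OF this]
  have "taylor_cong 6 qU ?p" using holomorphic_bigo_1[OF qU_holomorphic] by (simp only: taylor_cong_def)
  moreover have "?p = [:1, 1, 1, 2, 2, 3:] + (pCons 0 ^^ 6) [:3, 3, 3, 3, 3, 2, 2, 1, 1, 1:]"
    by (simp add: eval_nat_numeral one_pCons)
  ultimately show ?thesis by (rule taylor_truncate)
qed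

text \<open>The polynomials are truncations of \<open>- x * deriv theta4 x\<close>, \<open>theta4\<close> and \<open>qU\<close>; the factors at
  \<open>x ^ l\<close> are \<open>1\<close> to the order considered, as \<open>n < l\<close>.\<close>

lemma (in weber_level) F_disc_bigo:
  assumes N: "n + 1 \<le> l" "n \<le> 6"
    and ex: "\<exists>Q. [:0, 2, 0, 0, -8:] ^ e - [:1, -2, 0, 0, 2:] ^ (3 * e) *
        pcompose P ([:0, 1:] * [:1, 1, 1, 2, 2, 3:] ^ r) = (pCons 0 ^^ (n + 1)) Q"
      (is "\<exists>Q. ?p = _")
  shows "F_disc \<in> O[at 0](\<lambda>x. x ^ (n + 1))"
proof -
  from ex obtain Q where id: "?p = (pCons 0 ^^ (n + 1)) Q" by blast
  let ?N = "n + 1"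
  have dh: "(\<lambda>y. y * deriv theta4 y) holomorphic_on ball 0 1"
    by (intro holomorphic_intros holomorphic_deriv theta4_holomorphic open_ball)
  define W where "W x = theta4 x * (of_nat l * (x ^ l * deriv theta4 (x ^ l))) - theta4 (x ^ l) * (x * deriv theta4 x)" for x
  define A where "A x = theta4 x ^ 3 * theta4 (x ^ l) ^ 3" for x
  have t: "taylor_cong ?N theta4 [:1, -2, 0, 0, 2:]" using N by (intro taylor_mono[OF theta4_taylor]) simp
  have tl: "taylor_cong ?N (\<lambda>x. theta4 (x ^ l)) [:1:]"
    using taylor_subst_power[OF theta4_holomorphic N(1) l_pos] by (simp add: theta4_0)
  have t': "taylor_cong ?N (\<lambda>x. x * deriv theta4 x) [:0, -2, 0, 0, 8:]"
    using N by (intro taylor_mono[OF theta4_deriv_taylor]) simp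
  have tl': "taylor_cong ?N (\<lambda>x. x ^ l * deriv theta4 (x ^ l)) [:0:]"
    using taylor_subst_power[OF dh N(1) l_pos] by simp
  \<comment> \<open>Order \<open>n\<close> is enough here, since the factor \<open>x\<close> of
    \<open>H_disc\<close> adds one.\<close>
  have u: "taylor_cong n qU [:1, 1, 1, 2, 2, 3:]" using N by (intro taylor_mono[OF qU_taylor]) simp
  have ul: "taylor_cong n (\<lambda>x. qU (x ^ l)) [:1:]"
    using taylor_subst_power[OF qU_holomorphic _ l_pos, of n] N by simp
  have H: "taylor_cong ?N (H_disc l r) ([:0, 1:] * ([:1, 1, 1, 2, 2, 3:] * [:1:]) ^ r)"
    unfolding H_disc_def[abs_def] by (intro taylor_shift taylor_power taylor_mult u ul)
  \<comment> \<open>Clearing the denominator \<open>A x ^ e\<close> beforehand avoids expanding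
    reciprocals of theta series.\<close>
  have "taylor_cong ?N (\<lambda>x. W x ^ e - A x ^ e * poly P (H_disc l r x))
     (([:1, -2, 0, 0, 2:] * ([:of_nat l:] * [:0:]) - [:1:] * [:0, -2, 0, 0, 8:]) ^ e -
      ([:1, -2, 0, 0, 2:] ^ 3 * [:1:] ^ 3) ^ e * pcompose P ([:0, 1:] * ([:1, 1, 1, 2, 2, 3:] * [:1:]) ^ r))"
    unfolding W_def A_def
    by (intro taylor_diff taylor_power taylor_mult taylor_poly_compose taylor_const t tl t' tl' H)
  moreover have "([:1, -2, 0, 0, 2:] * ([:of_nat l:] * [:0:]) - [:1:] * [:0, -2, 0, 0, 8:]) ^ e -
      ([:1, -2, 0, 0, 2:] ^ 3 * [:1:] ^ 3) ^ e * pcompose P ([:0, 1:] * ([:1, 1, 1, 2, 2, 3:] * [:1:]) ^ r)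
      = (pCons 0 ^^ ?N) Q"
    unfolding id[symmetric] by (simp add: power_mult flip: one_pCons)
  ultimately have num: "(\<lambda>x. W x ^ e - A x ^ e * poly P (H_disc l r x)) \<in> O[at 0](\<lambda>x. x ^ ?N)"
    by (rule taylor_imp_bigo)
  have th: "(\<lambda>x. theta4 (x ^ l)) holomorphic_on ball 0 1"
    by (intro holomorphic_disc_compose[OF theta4_holomorphic] holomorphic_intros) (auto intro: norm_power_less_1 l_pos)
  have "(\<lambda>x. 1 / A x ^ e) holomorphic_on ball 0 1"
    unfolding A_def[abs_def]
    by (intro holomorphic_intros theta4_holomorphic th) (auto simp: theta4_nz norm_power_less_1 l_pos)
  from landau_o.big.mult[OF num holomorphic_bigo_1[OF this]]
  have "(\<lambda>x. (W x ^ e - A x ^ e * poly P (H_disc l r x)) * (1 / A x ^ e)) \<in> O[at 0](\<lambda>x. x ^ ?N)"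
    by (simp only: mult_1_right)
  moreover have "eventually (\<lambda>x. (W x ^ e - A x ^ e * poly P (H_disc l r x)) * (1 / A x ^ e) = F_disc x) (at 0)"
    unfolding eventually_at
  proof (intro exI[of _ 1] conjI ballI impI)
    fix x :: complex assume "x \<noteq> 0 \<and> dist x 0 < 1"
    then have "A x \<noteq> 0" by (auto simp: A_def theta4_nz norm_power_less_1 l_pos)
    moreover have "D_disc l x = W x / A x" by (simp add: D_disc_def W_def A_def mult.assoc)
    then have "D_disc l x ^ e = W x ^ e / A x ^ e" by (simp only: power_divide)
    ultimately show "(W x ^ e - A x ^ e * poly P (H_disc l r x)) * (1 / A x ^ e) = F_disc x"
      unfolding F_disc_def by (simp add: diff_divide_distrib)
  qed simp
  ultimately show ?thesis by (subst (asm) landau_o.big.in_cong)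
qed

section \<open>Eta quotients and the five identities\<close>

lemma dedekind_eta_qE: "dedekind_eta \<tau> = nome (\<tau> / 12) * qE (nome (2 * \<tau>))"
proof -
  have "exp (2 * of_real pi * \<i> * of_nat (Suc k) * \<tau>) = nome (2 * \<tau>) ^ Suc k" for k
    unfolding nome_power by (simp add: nome_def mult_ac)
  then show ?thesis by (simp add: dedekind_eta_def qE_def nome_def)
qed

lemma dedekind_eta_double:
  assumes "Im \<tau> > 0"
  shows "dedekind_eta (2 * \<tau>) / dedekind_eta \<tau> = nome (\<tau> / 12) * qU (nome (2 * \<tau>))"
proof -
  have x: "norm (nome (2 * \<tau>)) < 1" using assms by (intro norm_nome_less_1) simp
  have "nome (2 * (2 * \<tau>)) = nome (2 * \<tau>) ^ 2" "nome (2 * \<tau> / 12) = nome (\<tau> / 12) ^ 2"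
    unfolding nome_power by simp_all
  then show ?thesis
    unfolding dedekind_eta_qE using qE_mult_qU[OF x] qE_nz[OF x]
    by (simp add: power2_eq_square field_simps)
qed

lemma H_eta_eq_H_disc:
  assumes "Im \<tau> > 0" "l > 0" "(24 div (l + 1)) * (l + 1) = 24"
  shows "H_eta l \<tau> = H_disc l (24 div (l + 1)) (nome (2 * \<tau>))"
proof -
  let ?r = "24 div (l + 1)"
  have l: "Im (of_nat l * \<tau>) > 0" using assms by simp
  have "H_eta l \<tau> = ((dedekind_eta (2 * \<tau>) / dedekind_eta \<tau>) *
     (dedekind_eta (2 * (of_nat l * \<tau>)) / dedekind_eta (of_nat l * \<tau>))) ^ ?r"
    unfolding H_eta_def by (simp add: mult.assoc)
  also have "\<dots> = (nome (\<tau> / 12) * nome (of_nat l * \<tau> / 12)) ^ ?r *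
      (qU (nome (2 * \<tau>)) * qU (nome (2 * (of_nat l * \<tau>)))) ^ ?r"
    unfolding dedekind_eta_double[OF assms(1)] dedekind_eta_double[OF l]
    by (simp add: power_mult_distrib mult_ac)
  also have "nome (2 * (of_nat l * \<tau>)) = nome (2 * \<tau>) ^ l"
    unfolding nome_power by (simp add: mult_ac)
  also have "(nome (\<tau> / 12) * nome (of_nat l * \<tau> / 12)) ^ ?r = nome (of_nat (?r * (l + 1)) * \<tau> / 12)"
    unfolding nome_add[symmetric] nome_power by (rule arg_cong[where f = nome]) (simp add: field_simps)
  also have "\<dots> = nome (2 * \<tau>)" unfolding assms(3) by simp
  finally show ?thesis by (simp only: H_disc_def)
qed

lemma (in weber_level) eta_identity:
  assumes "n + 1 \<le> l" "n \<le> 6"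
    and "\<exists>Q. [:0, 2, 0, 0, -8:] ^ e - [:1, -2, 0, 0, 2:] ^ (3 * e) *
        pcompose P ([:0, 1:] * [:1, 1, 1, 2, 2, 3:] ^ r) = (pCons 0 ^^ (n + 1)) Q"
    and \<tau>: "Im \<tau> > 0"
  shows "D_hat l (nome \<tau> ^ 2) ^ e = poly P (H_eta l \<tau>)"
proof -
  have r: "24 div (l + 1) = r" using rl by (metis add_eq_0_iff_both_eq_0 nonzero_mult_div_cancel_right one_neq_zero)
  have x: "nome \<tau> ^ 2 = nome (2 * \<tau>)" unfolding nome_power by simp
  have "norm (nome (2 * \<tau>)) < 1" using \<tau> by (intro norm_nome_less_1) simp
  then have D: "D_hat l (nome (2 * \<tau>)) = D_disc l (nome (2 * \<tau>))" by (rule D_hat_eq_D_disc[OF _ l_pos])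
  have H: "H_eta l \<tau> = H_disc l r (nome (2 * \<tau>))"
    using H_eta_eq_H_disc[OF \<tau> l_pos] rl by (simp only: r)
  \<comment> \<open>The shift by 1 cancels the minus sign, so the disc variable is exactly
    \<open>q ^ 2\<close>.\<close>
  have "F_disc (- nome (2 * \<tau> + 1)) = 0"
    using \<tau> by (intro F_disc_eq_0 F_disc_bigo[OF assms(1-3)]) simp
  then show ?thesis unfolding x D H by (simp add: F_disc_def nome_add nome_1)
qed

theorem theorem3p2:
  fixes \<tau> q :: complex
  assumes "Im \<tau> > 0"
    and "q = exp (of_real pi * \<i> * \<tau>)"
  shows "D_hat 3 (q\<^sup>2) = 2 * H_eta 3 \<tau> \<and>
         (D_hat 5 (q\<^sup>2))\<^sup>2 = 4 * (H_eta 5 \<tau>)\<^sup>2 * (1 + 4 * H_eta 5 \<tau>) \<and>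
         D_hat 7 (q\<^sup>2) = 2 * H_eta 7 \<tau> * (1 + 3 * H_eta 7 \<tau>) \<and>
         D_hat 11 (q\<^sup>2) =
           2 * H_eta 11 \<tau> * (1 + 4 * H_eta 11 \<tau> + 5 * (H_eta 11 \<tau>)\<^sup>2) \<and>
         D_hat 23 (q\<^sup>2) =
           2 * H_eta 23 \<tau> *
             (1 + 5 * H_eta 23 \<tau> + 13 * (H_eta 23 \<tau>)\<^sup>2 + 20 * H_eta 23 \<tau> ^ 3
                + 20 * H_eta 23 \<tau> ^ 4 + 11 * H_eta 23 \<tau> ^ 5)"
proof -
  have q: "q = nome \<tau>" using assms(2) by (simp add: nome_def)
  \<comment> \<open>The parameters are \<open>l r e n\<close>, with \<open>r = 24 / (l + 1)\<close>
    and \<open>n = 6 * e / r\<close>; the list holds the coefficients of the right-hand side as a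
    polynomial in H.\<close>
  interpret l3: weber_level 3 6 1 1 "[:0, 2:]" by unfold_locales auto
  interpret l5: weber_level 5 4 2 3 "[:0, 0, 4, 16:]" by unfold_locales auto
  interpret l7: weber_level 7 3 1 2 "[:0, 2, 6:]" by unfold_locales auto
  interpret l11: weber_level 11 2 1 3 "[:0, 2, 8, 10:]" by unfold_locales auto
  interpret l23: weber_level 23 1 1 6 "[:0, 2, 10, 26, 40, 40, 22:]" by unfold_locales auto
  \<comment> \<open>Exponents in successor form let the powers be multiplied out; the low
    coefficients vanish and the witness \<open>Q\<close> consists of the remaining ones.\<close>
  note eval = numeral_eq_Suc pcompose_pCons one_pCons
  have "D_hat 3 (nome \<tau> ^ 2) ^ 1 = poly [:0, 2:] (H_eta 3 \<tau>)"
    by (rule l3.eta_identity) (simp_all add: eval assms)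
  moreover have "D_hat 5 (nome \<tau> ^ 2) ^ 2 = poly [:0, 0, 4, 16:] (H_eta 5 \<tau>)"
    by (rule l5.eta_identity) (simp_all add: eval assms)
  moreover have "D_hat 7 (nome \<tau> ^ 2) ^ 1 = poly [:0, 2, 6:] (H_eta 7 \<tau>)"
    by (rule l7.eta_identity) (simp_all add: eval assms)
  moreover have "D_hat 11 (nome \<tau> ^ 2) ^ 1 = poly [:0, 2, 8, 10:] (H_eta 11 \<tau>)"
    by (rule l11.eta_identity) (simp_all add: eval assms)
  moreover have "D_hat 23 (nome \<tau> ^ 2) ^ 1 = poly [:0, 2, 10, 26, 40, 40, 22:] (H_eta 23 \<tau>)"
    by (rule l23.eta_identity) (simp_all add: eval assms)
  ultimately show ?thesis unfolding q by (simp add: algebra_simps eval_nat_numeral)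
qed

end
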